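(* Let $r\ge2$ and let $Z$ be a $C^{r+1}$ map from an open neighborhood of $0$ in $(\mathbb{R}^d)^{N+1}$ to $\mathbb{R}^d$ with $Z(0)=0$ and $B_0=\partial_0Z(0)$ invertible. Let $\boldsymbol\lambda=(\lambda_1,\ldots,\lambda_m)\in\mathbb{R}^m$ be a stable non-resonant vector of eigenvalues with real eigenvectors $v_1,\ldots,v_m$ ($T(\lambda_j)v_j=0$), linearly independent, and let $\Lambda=\mathrm{diag}(\lambda_1,\ldots,\lambda_m)$, $V=(v_1\cdots v_m)$. Assume there exists $\mu$ with $\|\Lambda\|^r\le\mu<1$ and $\sum_{i=1}^N\mu^i\|B_0^{-1}B_i\|<1$. Then there exist $\rho>0$ and a $C^r$ map $P:D_\rho\to\mathbb{R}^d$, $D_\rho=\{z\in\mathbb{R}^m:\|z\|_\infty\le\rho\}$, such that $P(0)=0$, $DP(0)=V$ (so the range of $DP(0)$ is the span of the eigenvectors $v_1,\dots,v_m$), and $$Z\big(P(z),P(\Lambda z),\ldots,P(\Lambda^Nz)\big)=0\qquad\text{for all }z\in D_\rho .$$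
   Context: $B_i=\partial_iZ(0)$ is the derivative with respect to the $i$-th block variable; $T(\lambda)=\sum_{i=0}^N\lambda^iB_i$; $\mathcal{F}(\lambda)=\det T(\lambda)$. $\boldsymbol\lambda^\alpha=\prod\lambda_i^{\alpha_i}$. A vector $\boldsymbol\lambda$ is a stable non-resonant vector of eigenvalues if $|\lambda_i|<1$, $\mathcal{F}(\lambda_i)=0$ for all $i$, and $\mathcal{F}(\boldsymbol\lambda^\alpha)\ne0$ for all $\alpha\in\mathbb{Z}_+^m$ with $|\alpha|\ge2$. Norms: sup norm $\|\cdot\|_\infty$ on $\mathbb{R}^m,\mathbb{R}^d$ and the induced operator norms on matrices. *)

theory Defs
  imports "HOL-Analysis.Analysis"
begin

text \<open>C^k regularity on a set S (Frechet sense, relative to S). D j x hs is the j-th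
  Frechet derivative of f at x applied to the directions in the list hs (length j).
  In finite dimensions, pointwise continuity of x \<mapsto> D j x hs for every fixed hs is
  equivalent to continuity of the multilinear-map valued derivative.\<close>
definition Ck_on :: "nat \<Rightarrow> 'a::euclidean_space set \<Rightarrow> ('a \<Rightarrow> 'b::real_normed_vector) \<Rightarrow> bool" where
  "Ck_on k S f \<longleftrightarrow>
     (\<exists>D :: nat \<Rightarrow> 'a \<Rightarrow> 'a list \<Rightarrow> 'b.
        (\<forall>x\<in>S. D 0 x [] = f x) \<and>
        (\<forall>j<k. \<forall>hs. length hs = j \<longrightarrow>
            (\<forall>x\<in>S. ((\<lambda>y. D j y hs) has_derivative (\<lambda>h. D (Suc j) x (h # hs))) (at x within S))) \<and>
        (\<forall>j\<le>k. \<forall>hs. length hs = j \<longrightarrow> continuous_on S (\<lambda>x. D j x hs)))"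

definition supnorm :: "real^'n \<Rightarrow> real" where
  "supnorm x = Max (range (\<lambda>i. \<bar>x $ i\<bar>))"

definition opnorm_inf :: "real^'n^'m \<Rightarrow> real" where
  "opnorm_inf A = (SUP x\<in>{x. supnorm x \<le> 1}. supnorm (A *v x))"

fun matpow :: "real^'n^'n \<Rightarrow> nat \<Rightarrow> real^'n^'n" where
  "matpow A 0 = mat 1"
| "matpow A (Suc n) = A ** matpow A n"

text \<open>Block derivative B_i = \<partial>_i Z(0); the block index i \<in> {0..N} is mapped to the
  index type 'k via blk.\<close>
definition blockDeriv :: "((real^'d)^'k \<Rightarrow> real^'d) \<Rightarrow> (nat \<Rightarrow> 'k) \<Rightarrow> nat \<Rightarrow> real^'d^'d" where
  "blockDeriv Z blk i = matrix (\<lambda>h. frechet_derivative Z (at 0) (\<chi> k. if k = blk i then h else 0))"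

definition Tmat :: "((real^'d)^'k \<Rightarrow> real^'d) \<Rightarrow> (nat \<Rightarrow> 'k) \<Rightarrow> nat \<Rightarrow> real \<Rightarrow> real^'d^'d" where
  "Tmat Z blk N t = (\<Sum>i=0..N. (t ^ i) *\<^sub>R blockDeriv Z blk i)"

definition charF :: "((real^'d)^'k \<Rightarrow> real^'d) \<Rightarrow> (nat \<Rightarrow> 'k) \<Rightarrow> nat \<Rightarrow> real \<Rightarrow> real" where
  "charF Z blk N t = det (Tmat Z blk N t)"

definition multipow :: "real^'m \<Rightarrow> ('m \<Rightarrow> nat) \<Rightarrow> real" where
  "multipow lam \<alpha> = (\<Prod>i\<in>UNIV. (lam $ i) ^ (\<alpha> i))"

definition stable_nonresonant :: "((real^'d)^'k \<Rightarrow> real^'d) \<Rightarrow> (nat \<Rightarrow> 'k) \<Rightarrow> nat \<Rightarrow> real^'m \<Rightarrow> bool" where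
  "stable_nonresonant Z blk N lam \<longleftrightarrow>
     (\<forall>i. \<bar>lam $ i\<bar> < 1 \<and> charF Z blk N (lam $ i) = 0) \<and>
     (\<forall>\<alpha>::'m \<Rightarrow> nat. sum \<alpha> UNIV \<ge> 2 \<longrightarrow> charF Z blk N (multipow lam \<alpha>) \<noteq> 0)"

definition diagm :: "real^'m \<Rightarrow> real^'m^'m" where
  "diagm lam = (\<chi> i j. if i = j then lam $ i else 0)"

end

(*
With G(x) = x_0 - B_0^{-1} Z(x) the equation reads P(z) = G(P(z), P(\<Lambda> z), ..., P(\<Lambda>^N z)), and near 0 the partial
derivative of G in block i has norm close to 0 for i = 0 and to ||B_0^{-1} B_i|| for i \<ge> 1. Non-resonance allows the
homogeneous parts of a polynomial p to be chosen degree by degree so that the residual G(p(z), ...) - p(z) is flat of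
order r, starting from p(z) = V z. On functions O(|z|^r) the right-hand side is then a contraction with factor
sum_i ||B_0^{-1} B_i|| ||\<Lambda>||^(ir) < 1, so iteration from p converges to p + u. Since \<Lambda> is diagonal, a partial derivative of
the iterates obeys a linear recursion of the same type: flatness drops by one order, but a factor \<lambda>_k^i appears, so the
contraction factor is unchanged. Induction on the order of differentiation gives convergence in C^r.
*)
theory Submission
  imports Defs
begin

section \<open>Families of flat functions\<close>

text \<open>The contraction is available only on functions that vanish to order \<open>r\<close> at
  0, and only in the sup norm, in which the hypotheses measure B_0^{-1} B_i. Contraction estimates
  are therefore made with \<open>infnorm\<close>; the change to the Euclidean norm, which costs a
  dimensional factor, is made only after the iteration in \<open>n\<close>. Convergence in C^r needs
  two passes over the iterates. The derivative of the difference of consecutive iterates contains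
  the increment of DG between their orbits, multiplied by derivatives of the older iterate; so
  bounds uniform in \<open>n\<close> come first and geometric decay of the differences second. Both
  passes are instances of one linear recursion with a free rate, 1 in the first and a number below 1
  in the second. The increment of DG in C^(r-1) is estimated by the mean value theorem, and this
  spends the derivative that \<open>Z\<close> has beyond those of the solution. To avoid norms of
  multilinear maps, smoothness is carried by iterated partial derivatives of families of
  functions.\<close>

definition pdiff :: "'m \<Rightarrow> (real^'m \<Rightarrow> 'b::real_normed_vector) \<Rightarrow> real^'m \<Rightarrow> 'b" where
  "pdiff k f z = frechet_derivative f (at z) (axis k 1)"

lemma vec_axis_expansion: "(\<Sum>k\<in>UNIV. h$k *\<^sub>R axis k (1::real)) = h"
  by (metis basis_expansion scalar_mult_eq_scaleR)

lemma linear_axis_expansion: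
  assumes "linear f"
  shows "f h = (\<Sum>k\<in>UNIV. h$k *\<^sub>R f (axis k (1::real)))"
proof -
  have "f h = f (\<Sum>k\<in>UNIV. h$k *\<^sub>R axis k (1::real))" by (simp add: vec_axis_expansion)
  also have "\<dots> = (\<Sum>k\<in>UNIV. h$k *\<^sub>R f (axis k (1::real)))"
    by (simp add: linear_sum[OF assms] linear_cmul[OF assms])
  finally show ?thesis .
qed

lemma linear_Basis_expansion:
  fixes f :: "'a::euclidean_space \<Rightarrow> 'b::real_vector"
  assumes "linear f"
  shows "f h = (\<Sum>e\<in>Basis. (h \<bullet> e) *\<^sub>R f e)"
proof -
  have "f h = f (\<Sum>e\<in>Basis. (h \<bullet> e) *\<^sub>R e)" by (simp add: euclidean_representation)
  also have "\<dots> = (\<Sum>e\<in>Basis. (h \<bullet> e) *\<^sub>R f e)"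
    by (simp add: linear_sum[OF assms] linear_cmul[OF assms])
  finally show ?thesis .
qed

lemma sum_axis_scaleR:
  fixes F :: "'m::finite \<Rightarrow> 'b::real_normed_vector"
  shows "(\<Sum>i\<in>UNIV. axis k (1::real) $ i *\<^sub>R F i) = F k"
proof -
  have "(\<Sum>i\<in>UNIV. axis k (1::real) $ i *\<^sub>R F i) = (\<Sum>i\<in>UNIV. if i = k then F i else 0)"
    by (intro sum.cong) (auto simp: axis_def)
  then show ?thesis by simp
qed

lemma pdiff_eq:
  assumes "(f has_derivative f') (at z)"
  shows "pdiff k f z = f' (axis k 1)"
  using frechet_derivative_at[OF assms] by (simp add: pdiff_def)

lemma has_derivative_pdiff:
  assumes "f differentiable at z"
  shows "(f has_derivative (\<lambda>h. \<Sum>k\<in>UNIV. h$k *\<^sub>R pdiff k f z)) (at z)"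
proof -
  have D: "(f has_derivative frechet_derivative f (at z)) (at z)"
    using assms by (simp add: frechet_derivative_works)
  have "frechet_derivative f (at z) = (\<lambda>h. \<Sum>k\<in>UNIV. h$k *\<^sub>R pdiff k f z)"
    unfolding pdiff_def using linear_axis_expansion has_derivative_linear[OF D] by blast
  with D show ?thesis by simp
qed

lemma pdiff_diff:
  assumes "f differentiable at z" "g differentiable at z"
  shows "pdiff k (\<lambda>z. f z - g z) z = pdiff k f z - pdiff k g z"
  using pdiff_eq[OF has_derivative_diff[OF has_derivative_pdiff[OF assms(1)] has_derivative_pdiff[OF assms(2)]]]
  by (simp add: sum_axis_scaleR)

lemma pdiff_add:
  assumes "f differentiable at z" "g differentiable at z"
  shows "pdiff k (\<lambda>z. f z + g z) z = pdiff k f z + pdiff k g z"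
  using pdiff_eq[OF has_derivative_add[OF has_derivative_pdiff[OF assms(1)] has_derivative_pdiff[OF assms(2)]]]
  by (simp add: sum_axis_scaleR)

lemma pdiff_cong:
  assumes "open S" "z \<in> S" "\<And>y. y \<in> S \<Longrightarrow> f y = g y"
  shows "pdiff k f z = pdiff k g z"
proof -
  have "(f has_derivative f') (at z) \<longleftrightarrow> (g has_derivative f') (at z)" for f'
    using assms has_derivative_transform_within_open by metis
  then show ?thesis by (simp add: pdiff_def frechet_derivative_def)
qed

definition flat0 :: "real \<Rightarrow> real \<Rightarrow> nat \<Rightarrow> (nat \<Rightarrow> real^'m \<Rightarrow> 'b::real_normed_vector) \<Rightarrow> bool" where
  "flat0 R \<kappa> s f \<longleftrightarrow> (\<forall>n. continuous_on (ball 0 R) (f n)) \<and>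
     (\<exists>C\<ge>0. \<forall>n. \<forall>z\<in>ball 0 R. norm (f n z) \<le> C * \<kappa> ^ n * norm z ^ s)"

text \<open>In \<open>flatC R \<kappa> j s f\<close>, the partial derivatives of \<open>f n\<close> of order \<open>i \<le> j\<close> are \<open>O(\<kappa> ^ n * norm z ^ (s - i))\<close>
  uniformly in \<open>n\<close>, with truncated subtraction: beyond order \<open>s\<close> they are merely bounded. With \<open>\<kappa> < 1\<close> such a
  family can be summed in \<open>C\<^sup>j\<close>; \<open>\<kappa> = 1\<close> and a constant family describe a single function.\<close>

fun flatC :: "real \<Rightarrow> real \<Rightarrow> nat \<Rightarrow> nat \<Rightarrow> (nat \<Rightarrow> real^'m \<Rightarrow> 'b::real_normed_vector) \<Rightarrow> bool" where
  "flatC R \<kappa> 0 s f \<longleftrightarrow> flat0 R \<kappa> s f"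
| "flatC R \<kappa> (Suc j) s f \<longleftrightarrow> flat0 R \<kappa> s f \<and> (\<forall>n. \<forall>z\<in>ball 0 R. f n differentiable at z) \<and>
     (\<forall>k. flatC R \<kappa> j (s - 1) (\<lambda>n. pdiff k (f n)))"

lemma flatC_imp_flat0: "flatC R \<kappa> j s f \<Longrightarrow> flat0 R \<kappa> s f"
  by (cases j) auto

lemma flatC_continuous: "flatC R \<kappa> j s f \<Longrightarrow> continuous_on (ball 0 R) (f n)"
  using flatC_imp_flat0 flat0_def by blast

lemma flatC_bound:
  assumes "flatC R \<kappa> j s f"
  obtains C where "C \<ge> 0" "\<And>n z. z \<in> ball 0 R \<Longrightarrow> norm (f n z) \<le> C * \<kappa> ^ n * norm z ^ s"
  using flatC_imp_flat0[OF assms] unfolding flat0_def by blast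

lemma flat0_cong:
  assumes "\<And>n z. z \<in> ball 0 R \<Longrightarrow> f n z = g n z"
  shows "flat0 R \<kappa> s f \<longleftrightarrow> flat0 R \<kappa> s g"
proof -
  have "continuous_on (ball 0 R) (f n) \<longleftrightarrow> continuous_on (ball 0 R) (g n)" for n
    using assms by (intro continuous_on_cong) auto
  then show ?thesis unfolding flat0_def using assms by simp
qed

text \<open>Derivatives at a point of the open ball see only values in the ball. This permits
  derivative formulas that are valid only there to be substituted inside
  \<open>flatC\<close>.\<close>

lemma flatC_cong:
  assumes "\<And>n z. z \<in> ball 0 R \<Longrightarrow> f n z = g n z"
  shows "flatC R \<kappa> j s f \<longleftrightarrow> flatC R \<kappa> j s g"
  using assms
proof (induction j arbitrary: s f g)
  case 0
  then show ?case using flat0_cong by simp blast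
next
  case (Suc j)
  have 1: "flat0 R \<kappa> s f \<longleftrightarrow> flat0 R \<kappa> s g" using Suc.prems flat0_cong by blast
  have 2: "f n differentiable at z \<longleftrightarrow> g n differentiable at z" if "z \<in> ball 0 R" for n z
  proof -
    have "(f n has_derivative D) (at z) \<longleftrightarrow> (g n has_derivative D) (at z)" for D
      using has_derivative_transform_within_open[OF _ open_ball that, of "f n" D UNIV "g n"]
        has_derivative_transform_within_open[OF _ open_ball that, of "g n" D UNIV "f n"] Suc.prems by auto
    then show ?thesis unfolding differentiable_def by simp
  qed
  have 3: "flatC R \<kappa> j (s - 1) (\<lambda>n. pdiff k (f n)) \<longleftrightarrow> flatC R \<kappa> j (s - 1) (\<lambda>n. pdiff k (g n))" for k
    by (rule Suc.IH) (use Suc.prems pdiff_cong[OF open_ball] in blast)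
  show ?case using 1 2 3 by simp
qed

text \<open>Lets the rules of differential calculus supply an explicit derivative \<open>f'\<close>,
  in place of \<open>pdiff\<close>, which rests on a choice of derivative.\<close>

lemma flatC_SucI:
  assumes "flat0 R \<kappa> s f"
    and "\<And>n z. z \<in> ball 0 R \<Longrightarrow> (f n has_derivative f' n z) (at z)"
    and "\<And>k. flatC R \<kappa> j (s - 1) (\<lambda>n z. f' n z (axis k 1))"
  shows "flatC R \<kappa> (Suc j) s f"
proof -
  have "flatC R \<kappa> j (s - 1) (\<lambda>n. pdiff k (f n))" for k
    using assms(3)[of k] flatC_cong[of R "\<lambda>n. pdiff k (f n)" "\<lambda>n z. f' n z (axis k 1)"] pdiff_eq[OF assms(2)] by simp
  moreover have "f n differentiable at z" if "z \<in> ball 0 R" for n z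
    using assms(2)[OF that] differentiable_def by blast
  ultimately show ?thesis using assms(1) by simp
qed

lemma flatC_differentiable:
  "flatC R \<kappa> (Suc j) s f \<Longrightarrow> z \<in> ball 0 R \<Longrightarrow> f n differentiable at z"
  by simp

lemma flatC_has_derivative:
  "flatC R \<kappa> (Suc j) s f \<Longrightarrow> z \<in> ball 0 R \<Longrightarrow>
    (f n has_derivative (\<lambda>h. \<Sum>k\<in>UNIV. h$k *\<^sub>R pdiff k (f n) z)) (at z)"
  by (intro has_derivative_pdiff flatC_differentiable)

lemma flatC_pdiff: "flatC R \<kappa> (Suc j) s f \<Longrightarrow> flatC R \<kappa> j (s - 1) (\<lambda>n. pdiff k (f n))"
  by simp

text \<open>Powers of \<open>norm z\<close> decrease in the exponent because the ball lies in the
  unit ball; this is the reason for the hypothesis \<open>R \<le> 1\<close> that recurs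
  below.\<close>

lemma flat0_mono_order:
  assumes "flat0 R \<kappa> s f" "s' \<le> s" "R \<le> 1" "\<kappa> \<ge> 0"
  shows "flat0 R \<kappa> s' f"
proof -
  obtain C where C: "C \<ge> 0" "\<And>n z. z \<in> ball 0 R \<Longrightarrow> norm (f n z) \<le> C * \<kappa> ^ n * norm z ^ s"
    using assms(1) unfolding flat0_def by blast
  have "norm (f n z) \<le> C * \<kappa> ^ n * norm z ^ s'" if "z \<in> ball 0 R" for n z
  proof -
    have "norm z ^ s \<le> norm z ^ s'"
      using that assms by (intro power_decreasing) auto
    then have "C * \<kappa> ^ n * norm z ^ s \<le> C * \<kappa> ^ n * norm z ^ s'"
      using C assms by (intro mult_left_mono) auto
    then show ?thesis using C(2)[OF that, of n] by linarith
  qed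
  then show ?thesis using assms(1) C(1) unfolding flat0_def by blast
qed

lemma flatC_mono_order:
  assumes "flatC R \<kappa> j s f" "s' \<le> s" "R \<le> 1" "\<kappa> \<ge> 0"
  shows "flatC R \<kappa> j s' f"
  using assms
proof (induction j arbitrary: s s' f)
  case 0
  then show ?case using flat0_mono_order by auto
next
  case (Suc j)
  have "flatC R \<kappa> j (s' - 1) (\<lambda>n. pdiff k (f n))" for k
    using Suc.IH[of "s - 1" "\<lambda>n. pdiff k (f n)" "s' - 1"] Suc.prems by auto
  then show ?case using Suc.prems flat0_mono_order by auto
qed

lemma flatC_mono_rate:
  assumes "flatC R \<kappa> j s f" "\<kappa> \<ge> 0" "\<kappa> \<le> \<kappa>'"
  shows "flatC R \<kappa>' j s f"
proof -
  have base: "flat0 R \<kappa>' s f" if ff: "flat0 R \<kappa> s f" for s and f :: "nat \<Rightarrow> real^'a \<Rightarrow> 'b"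
  proof -
    obtain C where C: "C \<ge> 0" "\<And>n z. z \<in> ball 0 R \<Longrightarrow> norm (f n z) \<le> C * \<kappa> ^ n * norm z ^ s"
      using ff unfolding flat0_def by blast
    have "norm (f n z) \<le> C * \<kappa>' ^ n * norm z ^ s" if "z \<in> ball 0 R" for n z
    proof -
      have "C * \<kappa> ^ n * norm z ^ s \<le> C * \<kappa>' ^ n * norm z ^ s"
        using C(1) assms(2,3) by (intro mult_right_mono mult_left_mono power_mono) auto
      then show ?thesis using C(2)[OF that, of n] by linarith
    qed
    then show ?thesis using ff C(1) unfolding flat0_def by blast
  qed
  from assms(1) show ?thesis
  proof (induction j arbitrary: s f)
    case (Suc j)
    then show ?case using base by simp
  qed (use base in simp)
qed

lemma flatC_mono_radius:
  assumes "flatC R \<kappa> j s f" "R' \<le> R"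
  shows "flatC R' \<kappa> j s f"
proof -
  have sub: "ball 0 R' \<subseteq> (ball 0 R :: (real^'a) set)" using assms(2) by auto
  have base: "flat0 R' \<kappa> s f" if ff: "flat0 R \<kappa> s f" for s and f :: "nat \<Rightarrow> real^'a \<Rightarrow> 'b"
    using ff sub continuous_on_subset[OF _ sub] unfolding flat0_def by blast
  from assms(1) show ?thesis
  proof (induction j arbitrary: s f)
    case (Suc j)
    then show ?case using base sub by (simp add: subset_iff)
  qed (use base in simp)
qed

lemma flatC_Suc_imp: "flatC R \<kappa> (Suc j) s f \<Longrightarrow> flatC R \<kappa> j s f"
  by (induction j arbitrary: s f) auto

lemma flatC_mono_level:
  assumes "flatC R \<kappa> j s f" "j' \<le> j"
  shows "flatC R \<kappa> j' s f"
  using assms(2,1) by (induction rule: inc_induct) (blast dest: flatC_Suc_imp)+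

lemma flat0_add:
  assumes "flat0 R \<kappa> s f" "flat0 R \<kappa> s g"
  shows "flat0 R \<kappa> s (\<lambda>n z. f n z + g n z)"
proof -
  obtain C where C: "C \<ge> 0" "\<And>n z. z \<in> ball 0 R \<Longrightarrow> norm (f n z) \<le> C * \<kappa> ^ n * norm z ^ s"
    using assms(1) unfolding flat0_def by blast
  obtain C' where C': "C' \<ge> 0" "\<And>n z. z \<in> ball 0 R \<Longrightarrow> norm (g n z) \<le> C' * \<kappa> ^ n * norm z ^ s"
    using assms(2) unfolding flat0_def by blast
  have "norm (f n z + g n z) \<le> (C + C') * \<kappa> ^ n * norm z ^ s" if "z \<in> ball 0 R" for n z
    using C(2)[OF that, of n] C'(2)[OF that, of n] norm_triangle_ineq[of "f n z" "g n z"]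
    by (simp add: algebra_simps)
  then show ?thesis using assms C C' unfolding flat0_def
    by (auto intro!: continuous_intros exI[of _ "C + C'"])
qed

lemma flatC_add:
  assumes "flatC R \<kappa> j s f" "flatC R \<kappa> j s g"
  shows "flatC R \<kappa> j s (\<lambda>n z. f n z + g n z)"
  using assms
proof (induction j arbitrary: s f g)
  case 0
  then show ?case using flat0_add by auto
next
  case (Suc j)
  show ?case
  proof (rule flatC_SucI)
    show "flat0 R \<kappa> s (\<lambda>n z. f n z + g n z)" using Suc.prems flat0_add by auto
    show "((\<lambda>z. f n z + g n z) has_derivative
        (\<lambda>h. (\<Sum>k\<in>UNIV. h$k *\<^sub>R pdiff k (f n) z) + (\<Sum>k\<in>UNIV. h$k *\<^sub>R pdiff k (g n) z))) (at z)"
      if "z \<in> ball 0 R" for n z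
      by (rule has_derivative_add[OF flatC_has_derivative[OF Suc.prems(1) that] flatC_has_derivative[OF Suc.prems(2) that]])
    show "flatC R \<kappa> j (s - 1) (\<lambda>n z. (\<Sum>i\<in>UNIV. axis k 1 $ i *\<^sub>R pdiff i (f n) z) +
              (\<Sum>i\<in>UNIV. axis k 1 $ i *\<^sub>R pdiff i (g n) z))" for k
    proof -
      show ?thesis unfolding sum_axis_scaleR using Suc.prems by (intro Suc.IH flatC_pdiff)
    qed
  qed
qed

lemma flatC_linear:
  fixes f :: "nat \<Rightarrow> real^'m \<Rightarrow> 'a::real_normed_vector"
  assumes "bounded_linear T" "flatC R \<kappa> j s f" "\<kappa> \<ge> 0"
  shows "flatC R \<kappa> j s (\<lambda>n z. T (f n z))"
proof -
  interpret T: bounded_linear T by fact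
  have base: "flat0 R \<kappa> s (\<lambda>n z. T (f n z))" if ff: "flat0 R \<kappa> s f" for s and f :: "nat \<Rightarrow> real^'m \<Rightarrow> 'a"
  proof -
    obtain C where C: "C \<ge> 0" "\<And>n z. z \<in> ball 0 R \<Longrightarrow> norm (f n z) \<le> C * \<kappa> ^ n * norm z ^ s"
      using ff unfolding flat0_def by blast
    obtain K where K: "K \<ge> 0" "\<And>x. norm (T x) \<le> norm x * K" using T.nonneg_bounded by blast
    have "norm (T (f n z)) \<le> (C * K) * \<kappa> ^ n * norm z ^ s" if "z \<in> ball 0 R" for n z
    proof -
      have "norm (T (f n z)) \<le> norm (f n z) * K" by (rule K)
      also have "\<dots> \<le> (C * \<kappa> ^ n * norm z ^ s) * K" by (rule mult_right_mono[OF C(2)[OF that] K(1)])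
      finally show ?thesis by (simp add: mult_ac)
    qed
    moreover have "continuous_on (ball 0 R) (\<lambda>z. T (f n z))" for n
      using ff T.continuous_on unfolding flat0_def by blast
    ultimately show ?thesis using C(1) K(1) unfolding flat0_def
      by (metis mult_nonneg_nonneg)
  qed
  from assms(2) show ?thesis
  proof (induction j arbitrary: s f)
    case 0
    then show ?case using base by simp
  next
    case (Suc j)
    show ?case
    proof (rule flatC_SucI)
      show "flat0 R \<kappa> s (\<lambda>n z. T (f n z))" using base Suc.prems by simp
      show "((\<lambda>z. T (f n z)) has_derivative (\<lambda>h. T (\<Sum>k\<in>UNIV. h$k *\<^sub>R pdiff k (f n) z))) (at z)"
        if "z \<in> ball 0 R" for n z
        using flatC_has_derivative[OF Suc.prems that] by (rule T.has_derivative)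
      show "flatC R \<kappa> j (s - 1) (\<lambda>n z. T (\<Sum>i\<in>UNIV. axis k 1 $ i *\<^sub>R pdiff i (f n) z))" for k
        using Suc.IH[OF flatC_pdiff[OF Suc.prems]] by (simp add: sum_axis_scaleR)
    qed
  qed
qed

lemma flat0_zero: "flat0 R \<kappa> s (\<lambda>n z. 0)"
  unfolding flat0_def by (auto intro!: exI[of _ 0])

lemma flatC_zero: "flatC R \<kappa> j s (\<lambda>n z. 0 :: 'b::real_normed_vector)"
proof (induction j arbitrary: s)
  case (Suc j)
  show ?case
    by (rule flatC_SucI[where f' = "\<lambda>n z h. 0"]) (auto simp: flat0_zero Suc)
qed (simp add: flat0_zero)

lemma flatC_sum:
  assumes "\<And>i. i \<in> I \<Longrightarrow> flatC R \<kappa> j s (f i)"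
  shows "flatC R \<kappa> j s (\<lambda>n z. \<Sum>i\<in>I. f i n z)"
  using assms by (induction I rule: infinite_finite_induct) (auto simp: flatC_zero intro!: flatC_add)

lemma flatC_scaleR: "flatC R \<kappa> j s f \<Longrightarrow> \<kappa> \<ge> 0 \<Longrightarrow> flatC R \<kappa> j s (\<lambda>n z. c *\<^sub>R f n z)"
  by (rule flatC_linear[OF bounded_linear_scaleR_right])

lemma flatC_const: "flatC R 1 j 0 (\<lambda>n z. c)"
proof (cases j)
  case (Suc i)
  have "flat0 R 1 0 (\<lambda>n z. c)" unfolding flat0_def by (auto intro!: exI[of _ "norm c"])
  then show ?thesis unfolding Suc
    by (intro flatC_SucI[where f' = "\<lambda>n z h. 0"]) (auto simp: flatC_zero)
qed (auto simp: flat0_def intro!: exI[of _ "norm c"])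

lemma flat0_mult:
  assumes "flat0 R a s \<phi>" "flat0 R b t f" "a \<ge> 0"
  shows "flat0 R (a * b) (s + t) (\<lambda>n z. \<phi> n z *\<^sub>R f n z)"
proof -
  obtain C where C: "C \<ge> 0" "\<And>n z. z \<in> ball 0 R \<Longrightarrow> norm (\<phi> n z) \<le> C * a ^ n * norm z ^ s"
    using assms(1) unfolding flat0_def by blast
  obtain C' where C': "C' \<ge> 0" "\<And>n z. z \<in> ball 0 R \<Longrightarrow> norm (f n z) \<le> C' * b ^ n * norm z ^ t"
    using assms(2) unfolding flat0_def by blast
  have "norm (\<phi> n z *\<^sub>R f n z) \<le> (C * C') * (a * b) ^ n * norm z ^ (s + t)" if "z \<in> ball 0 R" for n z
  proof -
    have "norm (\<phi> n z *\<^sub>R f n z) \<le> (C * a ^ n * norm z ^ s) * (C' * b ^ n * norm z ^ t)"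
      unfolding norm_scaleR real_norm_def[symmetric] using C C' that assms(3)
      by (intro mult_mono) auto
    then show ?thesis by (simp add: power_add power_mult_distrib mult_ac)
  qed
  then show ?thesis using assms C C' unfolding flat0_def
    by (auto intro!: continuous_intros exI[of _ "C * C'"])
qed

text \<open>Leibniz rule: rates multiply and orders of vanishing add. The factor left
  undifferentiated is taken one level lower to match the other.\<close>

lemma flatC_mult:
  assumes "flatC R a j s \<phi>" "flatC R b j t f" "a \<ge> 0" "b \<ge> 0" "R \<le> 1"
  shows "flatC R (a * b) j (s + t) (\<lambda>n z. \<phi> n z *\<^sub>R f n z)"
  using assms
proof (induction j arbitrary: s t \<phi> f)
  case 0
  then show ?case using flat0_mult by auto
next
  case (Suc j)
  show ?case
  proof (rule flatC_SucI)
    show "flat0 R (a * b) (s + t) (\<lambda>n z. \<phi> n z *\<^sub>R f n z)" using Suc.prems flat0_mult by auto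
    show "((\<lambda>z. \<phi> n z *\<^sub>R f n z) has_derivative
        (\<lambda>h. \<phi> n z *\<^sub>R (\<Sum>k\<in>UNIV. h$k *\<^sub>R pdiff k (f n) z) + (\<Sum>k\<in>UNIV. h$k *\<^sub>R pdiff k (\<phi> n) z) *\<^sub>R f n z)) (at z)"
      if "z \<in> ball 0 R" for n z
      by (rule has_derivative_scaleR[OF flatC_has_derivative[OF Suc.prems(1) that] flatC_has_derivative[OF Suc.prems(2) that]])
    show "flatC R (a * b) j (s + t - 1) (\<lambda>n z. \<phi> n z *\<^sub>R (\<Sum>i\<in>UNIV. axis k 1 $ i *\<^sub>R pdiff i (f n) z) +
              (\<Sum>i\<in>UNIV. axis k 1 $ i *\<^sub>R pdiff i (\<phi> n) z) *\<^sub>R f n z)" for k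
      unfolding sum_axis_scaleR
    proof (rule flatC_add)
      \<comment> \<open>For \<open>t = 0\<close> truncated subtraction makes
        \<open>s + (t - 1)\<close> larger than \<open>s + t - 1\<close>; lowering the order
        afterwards covers both cases.\<close>
      have "flatC R (a * b) j (s + (t - 1)) (\<lambda>n z. \<phi> n z *\<^sub>R pdiff k (f n) z)"
        using Suc.prems by (intro Suc.IH flatC_pdiff flatC_Suc_imp[of R a j s \<phi>])
      then show "flatC R (a * b) j (s + t - 1) (\<lambda>n z. \<phi> n z *\<^sub>R pdiff k (f n) z)"
        by (rule flatC_mono_order) (use Suc.prems in auto)
      have "flatC R (a * b) j (s - 1 + t) (\<lambda>n z. pdiff k (\<phi> n) z *\<^sub>R f n z)"
        using Suc.prems by (intro Suc.IH flatC_pdiff flatC_Suc_imp[of R b j t f])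
      then show "flatC R (a * b) j (s + t - 1) (\<lambda>n z. pdiff k (\<phi> n) z *\<^sub>R f n z)"
        by (rule flatC_mono_order) (use Suc.prems in auto)
    qed
  qed
qed

text \<open>A converse of \<open>flatC_pdiff\<close>: by the mean value inequality from 0, where
  \<open>f n\<close> vanishes, the order that differentiation loses is regained.
  \<open>flatC_taylor\<close> and \<open>flat_residual_step\<close> obtain their extra order from
  it.\<close>

lemma flatC_Suc_mvt:
  fixes f :: "nat \<Rightarrow> real^'m \<Rightarrow> 'b::real_normed_vector"
  assumes zero: "\<And>n. f n 0 = 0" and R: "R > 0" "R \<le> 1" and \<kappa>: "\<kappa> \<ge> 0"
    and diff: "\<And>n z. z \<in> ball 0 R \<Longrightarrow> f n differentiable at z"
    and pd: "\<And>k. flatC R \<kappa> j s (\<lambda>n. pdiff k (f n))"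
  shows "flatC R \<kappa> (Suc j) (Suc s) f"
proof -
  have "\<exists>C\<ge>0. \<forall>n. \<forall>z\<in>ball 0 R. norm (pdiff k (f n) z) \<le> C * \<kappa> ^ n * norm z ^ s" for k
    using flatC_imp_flat0[OF pd[of k]] unfolding flat0_def by blast
  then obtain C where C: "\<And>k. C k \<ge> 0"
     "\<And>k n z. z \<in> ball 0 R \<Longrightarrow> norm (pdiff k (f n) z) \<le> C k * \<kappa> ^ n * norm z ^ s" by metis
  have bd: "norm (f n z) \<le> (\<Sum>k\<in>UNIV. C k) * \<kappa> ^ n * norm z ^ Suc s" if z: "z \<in> ball 0 R" for n z
  proof -
    \<comment> \<open>The closed ball of radius \<open>norm z\<close> is convex and contains both 0
      and \<open>z\<close>; on it the derivative bound is at most its value for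
      \<open>norm z\<close>.\<close>
    let ?B = "(\<Sum>k\<in>UNIV. C k) * \<kappa> ^ n * norm z ^ s"
    have on: "onorm (\<lambda>h. \<Sum>k\<in>UNIV. h$k *\<^sub>R pdiff k (f n) y) \<le> ?B" if y: "y \<in> cball 0 (norm z)" for y
    proof (rule onorm_le)
      fix h :: "real^'m"
      have yR: "y \<in> ball 0 R" using y z by auto
      have "norm (\<Sum>k\<in>UNIV. h$k *\<^sub>R pdiff k (f n) y) \<le> (\<Sum>k\<in>UNIV. norm h * (C k * \<kappa> ^ n * norm z ^ s))"
      proof (rule sum_norm_le)
        fix k
        have "norm (pdiff k (f n) y) \<le> C k * \<kappa> ^ n * norm y ^ s" using C(2) yR by blast
        also have "\<dots> \<le> C k * \<kappa> ^ n * norm z ^ s"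
          using y C(1) \<kappa> by (intro mult_left_mono power_mono) auto
        finally show "norm (h$k *\<^sub>R pdiff k (f n) y) \<le> norm h * (C k * \<kappa> ^ n * norm z ^ s)"
          unfolding norm_scaleR using component_le_norm_cart[of h k]
          by (intro mult_mono) auto
      qed
      then show "norm (\<Sum>k\<in>UNIV. h$k *\<^sub>R pdiff k (f n) y) \<le> ?B * norm h"
        by (simp add: sum_distrib_left sum_distrib_right mult_ac)
    qed
    have "norm (f n z - f n 0) \<le> ?B * norm (z - 0)"
    proof (rule differentiable_bound)
      show "convex (cball (0::real^'m) (norm z))" by simp
      show "(f n has_derivative (\<lambda>h. \<Sum>k\<in>UNIV. h$k *\<^sub>R pdiff k (f n) y)) (at y within cball 0 (norm z))"
        if "y \<in> cball 0 (norm z)" for y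
      proof -
        have "y \<in> ball 0 R" using that z by auto
        then show ?thesis using has_derivative_pdiff[OF diff] has_derivative_at_withinI by blast
      qed
      show "onorm (\<lambda>h. \<Sum>k\<in>UNIV. h$k *\<^sub>R pdiff k (f n) y) \<le> ?B" if "y \<in> cball 0 (norm z)" for y
        using on that by blast
      show "z \<in> cball 0 (norm z)" "0 \<in> cball 0 (norm z)" by auto
    qed
    then show ?thesis by (simp add: zero mult_ac)
  qed
  have "continuous_on (ball 0 R) (f n)" for n
    using diff differentiable_imp_continuous_within by (intro continuous_at_imp_continuous_on) blast
  moreover have "(\<Sum>k\<in>UNIV. C k) \<ge> 0" using C(1) by (intro sum_nonneg)
  ultimately have "flat0 R \<kappa> (Suc s) f"
    unfolding flat0_def using bd by blast
  then show ?thesis using diff pd by simp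
qed

section \<open>The powers of the diagonal matrix as coordinate dilations\<close>

definition dil :: "real^'m \<Rightarrow> nat \<Rightarrow> real^'m \<Rightarrow> real^'m" where
  "dil lam i z = (\<chi> k. lam$k ^ i * z$k)"

lemma linear_dil: "linear (dil lam i)"
  by (rule linearI) (auto simp: dil_def vec_eq_iff algebra_simps)

lemma bounded_linear_dil: "bounded_linear (dil lam i)"
  using linear_dil linear_conv_bounded_linear by blast

lemma dil_0 [simp]: "dil lam i 0 = 0"
  by (simp add: dil_def vec_eq_iff)

lemma dil_axis: "dil lam i (axis k 1) = (lam$k ^ i) *\<^sub>R axis k 1"
  by (auto simp: dil_def vec_eq_iff axis_def)

lemma norm_dil_le:
  assumes "\<And>k. \<bar>lam$k\<bar> \<le> L"
  shows "norm (dil lam i z) \<le> L ^ i * norm z"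
proof -
  have L: "L \<ge> 0" using assms abs_ge_zero order_trans by blast
  have "norm (dil lam i z) \<le> norm ((L ^ i) *\<^sub>R z)"
  proof (rule norm_le_componentwise_cart)
    fix k
    have "\<bar>lam$k\<bar> ^ i \<le> L ^ i" using assms by (intro power_mono) auto
    then show "norm (dil lam i z $ k) \<le> norm (((L ^ i) *\<^sub>R z) $ k)"
      using L by (simp add: dil_def abs_mult power_abs mult_right_mono)
  qed
  then show ?thesis using L by simp
qed

lemma dil_ball:
  assumes "\<And>k. \<bar>lam$k\<bar> \<le> 1" "z \<in> ball 0 R"
  shows "dil lam i z \<in> ball 0 R"
  using norm_dil_le[of lam 1 i z] assms by auto

text \<open>Dilations map the ball into itself without increasing norms, so the constants survive.
  The gain \<open>L ^ (i * s)\<close> on flat functions is not recorded here; it enters in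
  \<open>weighted_contraction_bound\<close>.\<close>

lemma flatC_dil:
  assumes lam: "\<And>k. \<bar>lam$k\<bar> \<le> 1" and "\<kappa> \<ge> 0" and "flatC R \<kappa> j s f"
  shows "flatC R \<kappa> j s (\<lambda>n z. f n (dil lam i z))"
proof -
  have base: "flat0 R \<kappa> s (\<lambda>n z. f n (dil lam i z))" if f: "flat0 R \<kappa> s f" for s and f :: "nat \<Rightarrow> real^'a \<Rightarrow> 'b"
  proof -
    obtain C where C: "C \<ge> 0" "\<And>n z. z \<in> ball 0 R \<Longrightarrow> norm (f n z) \<le> C * \<kappa> ^ n * norm z ^ s"
      using f unfolding flat0_def by blast
    have "norm (f n (dil lam i z)) \<le> C * \<kappa> ^ n * norm z ^ s" if "z \<in> ball 0 R" for n z
    proof -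
      have "norm (dil lam i z) ^ s \<le> norm z ^ s"
        using norm_dil_le[of lam 1 i z] lam by (intro power_mono) auto
      then show ?thesis using C(2)[OF dil_ball[OF lam that], of n i] C(1) assms(2)
        by (meson mult_left_mono mult_nonneg_nonneg order_trans zero_le_power)
    qed
    moreover have "continuous_on (ball 0 R) (\<lambda>z. f n (dil lam i z))" for n
    proof (rule continuous_on_compose2[of "ball 0 R" "f n"])
      show "continuous_on (ball 0 R) (f n)" using f unfolding flat0_def by blast
      show "continuous_on (ball 0 R) (dil lam i)" by (simp add: bounded_linear_dil linear_continuous_on)
    qed (use dil_ball[OF lam] in blast)
    ultimately show ?thesis using C(1) unfolding flat0_def by blast
  qed
  from assms(3) show ?thesis
  proof (induction j arbitrary: s f)
    case 0
    then show ?case using base by simp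
  next
    case (Suc j)
    show ?case
    proof (rule flatC_SucI)
      show "flat0 R \<kappa> s (\<lambda>n z. f n (dil lam i z))" using base Suc.prems by simp
      show "((\<lambda>z. f n (dil lam i z)) has_derivative
          (\<lambda>h. \<Sum>k\<in>UNIV. (dil lam i h)$k *\<^sub>R pdiff k (f n) (dil lam i z))) (at z)"
        if "z \<in> ball 0 R" for n z
        using has_derivative_compose[OF bounded_linear_imp_has_derivative[OF bounded_linear_dil]
            flatC_has_derivative[OF Suc.prems dil_ball[OF lam that]]] by simp
      show "flatC R \<kappa> j (s - 1) (\<lambda>n z. \<Sum>l\<in>UNIV. (dil lam i (axis k 1))$l *\<^sub>R pdiff l (f n) (dil lam i z))" for k
        using flatC_scaleR[OF Suc.IH[OF flatC_pdiff[OF Suc.prems]] assms(2), where c = "lam$k ^ i"]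
        by (simp add: sum_axis_scaleR dil_axis flip: scaleR_scaleR scaleR_sum_right)
    qed
  qed
qed

section \<open>Composition with smooth maps\<close>

text \<open>The data of \<open>Ck_on\<close> on an open set, with the order of differentiation read off the list of directions.\<close>

definition tower :: "nat \<Rightarrow> 'x::euclidean_space set \<Rightarrow> ('x list \<Rightarrow> 'x \<Rightarrow> 'b::real_normed_vector) \<Rightarrow> bool" where
  "tower k U D \<longleftrightarrow>
     (\<forall>hs. length hs < k \<longrightarrow> (\<forall>x\<in>U. (D hs has_derivative (\<lambda>h. D (h # hs) x)) (at x))) \<and>
     (\<forall>hs. length hs \<le> k \<longrightarrow> continuous_on U (D hs))"

lemma tower_has_derivative:
  "tower k U D \<Longrightarrow> length hs < k \<Longrightarrow> x \<in> U \<Longrightarrow> (D hs has_derivative (\<lambda>h. D (h # hs) x)) (at x)"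
  by (simp add: tower_def)

lemma tower_continuous: "tower k U D \<Longrightarrow> length hs \<le> k \<Longrightarrow> continuous_on U (D hs)"
  by (simp add: tower_def)

lemma tower_linear:
  "tower k U D \<Longrightarrow> length hs < k \<Longrightarrow> x \<in> U \<Longrightarrow> linear (\<lambda>h. D (h # hs) x)"
  using tower_has_derivative has_derivative_linear by blast

lemma tower_Cons_expansion:
  "tower k U D \<Longrightarrow> length hs < k \<Longrightarrow> x \<in> U \<Longrightarrow> D (h # hs) x = (\<Sum>e\<in>Basis. (h \<bullet> e) *\<^sub>R D (e # hs) x)"
  using linear_Basis_expansion[OF tower_linear] .

lemma tower_bounded:
  assumes "tower k U D" "compact K" "K \<subseteq> U" "length hs \<le> k"
  obtains B where "B \<ge> 0" "\<And>x. x \<in> K \<Longrightarrow> norm (D hs x) \<le> B"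
proof -
  have "continuous_on K (D hs)"
    using tower_continuous[OF assms(1,4)] assms(3) continuous_on_subset by blast
  then have "bounded (D hs ` K)" using assms(2) compact_continuous_image compact_imp_bounded by blast
  then obtain B where "B > 0" "\<forall>y\<in>D hs ` K. norm y \<le> B" using bounded_pos by blast
  then show ?thesis using that[of B] by auto
qed

text \<open>Mean value inequality on a compact convex set, where the next derivatives are bounded.
  The strict inequality on the length of \<open>hs\<close> is the extra derivative that
  \<open>G\<close> must have beyond the solution.\<close>

lemma tower_lipschitz:
  assumes "tower k U D" "compact K" "convex K" "K \<subseteq> U" "length hs < k"
  obtains B where "B \<ge> 0" "\<And>x y. x \<in> K \<Longrightarrow> y \<in> K \<Longrightarrow> norm (D hs y - D hs x) \<le> B * norm (y - x)"
proof -
  have "\<exists>b\<ge>0. \<forall>x\<in>K. norm (D (e # hs) x) \<le> b" for e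
    using tower_bounded[OF assms(1,2,4), of "e # hs"] assms(5) by (metis Suc_leI length_Cons)
  then obtain b where b: "\<And>e. b e \<ge> 0" "\<And>e x. x \<in> K \<Longrightarrow> norm (D (e # hs) x) \<le> b e" by metis
  let ?B = "\<Sum>e\<in>Basis. b e"
  have "norm (D hs y - D hs x) \<le> ?B * norm (y - x)" if "x \<in> K" "y \<in> K" for x y
  proof (rule differentiable_bound[OF assms(3)])
    show "(D hs has_derivative (\<lambda>h. D (h # hs) w)) (at w within K)" if "w \<in> K" for w
      using tower_has_derivative[OF assms(1,5)] that assms(4) has_derivative_at_withinI by blast
    show "onorm (\<lambda>h. D (h # hs) w) \<le> ?B" if w: "w \<in> K" for w
    proof (rule onorm_le)
      fix h
      have "norm (D (h # hs) w) \<le> (\<Sum>e\<in>Basis. norm ((h \<bullet> e) *\<^sub>R D (e # hs) w))"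
        unfolding tower_Cons_expansion[OF assms(1,5) subsetD[OF assms(4) w], of h] by (rule norm_sum)
      also have "\<dots> \<le> (\<Sum>e\<in>Basis. norm h * b e)"
        unfolding norm_scaleR using Basis_le_norm b w by (intro sum_mono mult_mono) auto
      finally show "norm (D (h # hs) w) \<le> ?B * norm h" by (simp add: sum_distrib_left mult_ac)
    qed
  qed (use that in auto)
  moreover have "?B \<ge> 0" using b(1) by (intro sum_nonneg)
  ultimately show ?thesis using that by blast
qed

lemma flatC_inner:
  fixes f :: "nat \<Rightarrow> real^'m \<Rightarrow> 'b::real_inner"
  shows "flatC R \<kappa> j s f \<Longrightarrow> \<kappa> \<ge> 0 \<Longrightarrow> flatC R \<kappa> j s (\<lambda>n z. f n z \<bullet> e)"
  by (rule flatC_linear[OF bounded_linear_inner_left])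

lemma flatC_mult1:
  assumes "flatC R \<kappa> j s \<phi>" "flatC R 1 j 0 f" "\<kappa> \<ge> 0" "R \<le> 1"
  shows "flatC R \<kappa> j s (\<lambda>n z. \<phi> n z *\<^sub>R f n z)"
  using flatC_mult[OF assms(1,2)] assms(3,4) by simp

lemma flatC_1mult:
  assumes "flatC R 1 j 0 \<phi>" "flatC R \<kappa> j s f" "\<kappa> \<ge> 0" "R \<le> 1"
  shows "flatC R \<kappa> j s (\<lambda>n z. \<phi> n z *\<^sub>R f n z)"
  using flatC_mult[OF assms(1,2)] assms(3,4) by simp

lemma tower_comp_has_derivative:
  assumes "tower k U D" "length hs < k" "flatC R \<kappa> (Suc j) s x" "z \<in> ball 0 R" "x n z \<in> U"
  shows "((\<lambda>z. D hs (x n z)) has_derivative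
     (\<lambda>h. D ((\<Sum>l\<in>UNIV. h$l *\<^sub>R pdiff l (x n) z) # hs) (x n z))) (at z)"
  using has_derivative_compose[OF flatC_has_derivative[OF assms(3,4)] tower_has_derivative[OF assms(1,2,5)]] .

text \<open>Only boundedness is claimed (order 0), since \<open>D hs\<close> need not vanish at 0.
  Each use of the chain rule prefixes a direction to \<open>hs\<close> and multiplies by a component
  of a derivative of \<open>x\<close>, so the induction runs over all \<open>hs\<close>.\<close>

lemma flatC_comp:
  fixes x :: "nat \<Rightarrow> real^'m \<Rightarrow> 'x::euclidean_space"
  assumes D: "tower k U D" and K: "compact K" "K \<subseteq> U" and R: "R \<le> 1"
    and x: "flatC R 1 j 0 x" "\<And>n z. z \<in> ball 0 R \<Longrightarrow> x n z \<in> K"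
    and hs: "length hs + j \<le> k"
  shows "flatC R 1 j 0 (\<lambda>n z. D hs (x n z))"
  using x(1) hs
proof (induction j arbitrary: hs)
  have flat0: "flat0 R 1 0 (\<lambda>n z. D hs (x n z))" if cont: "\<And>n. continuous_on (ball 0 R) (x n)" and hs: "length hs \<le> k" for hs
  proof -
    obtain B where "B \<ge> 0" "\<And>x. x \<in> K \<Longrightarrow> norm (D hs x) \<le> B" using tower_bounded[OF D K hs] by blast
    moreover have "continuous_on (ball 0 R) (\<lambda>z. D hs (x n z))" for n
      using continuous_on_compose2[OF tower_continuous[OF D hs] cont] x(2) K(2) by blast
    ultimately show ?thesis unfolding flat0_def using x(2) by auto
  qed
  {
    case 0
    then show ?case using flat0 flatC_continuous[OF 0(1)] by simp
  next
    case (Suc j)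
    show ?case
    proof (rule flatC_SucI)
      show "flat0 R 1 0 (\<lambda>n z. D hs (x n z))" using flat0 flatC_continuous[OF Suc.prems(1)] Suc.prems(2) by simp
      show "((\<lambda>z. D hs (x n z)) has_derivative (\<lambda>h. D ((\<Sum>l\<in>UNIV. h$l *\<^sub>R pdiff l (x n) z) # hs) (x n z))) (at z)"
        if "z \<in> ball 0 R" for n z
        by (rule tower_comp_has_derivative[OF D _ Suc.prems(1) that]) (use Suc.prems(2) x(2)[OF that] K(2) in auto)
      fix i
      have "flatC R 1 j 0 (\<lambda>n z. \<Sum>e\<in>Basis. (pdiff i (x n) z \<bullet> e) *\<^sub>R D (e # hs) (x n z))"
        using Suc.prems R flatC_pdiff[OF Suc.prems(1), of i]
        by (intro flatC_sum flatC_mult1 flatC_inner Suc.IH flatC_Suc_imp[of R 1 j 0 x]) auto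
      moreover have "D (pdiff i (x n) z # hs) (x n z) = (\<Sum>e\<in>Basis. (pdiff i (x n) z \<bullet> e) *\<^sub>R D (e # hs) (x n z))"
        if "z \<in> ball 0 R" for n z
        using tower_Cons_expansion[OF D] Suc.prems(2) x(2)[OF that] K(2) by (simp add: subset_iff)
      ultimately show "flatC R 1 j (0 - 1) (\<lambda>n z. D ((\<Sum>l\<in>UNIV. axis i 1 $ l *\<^sub>R pdiff l (x n) z) # hs) (x n z))"
        unfolding sum_axis_scaleR by (subst flatC_cong) auto
    qed
  }
qed

text \<open>The increment inherits order and rate from \<open>y\<close>. Its derivative
  D'(x+y)(x'+y') - D'(x)x' is regrouped as [D'(x+y) - D'(x)]x' + D'(x+y)y': the bracket falls under
  the induction hypothesis for a longer list of directions, and the last term is flat times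
  bounded.\<close>

lemma flatC_comp_diff:
  fixes x y :: "nat \<Rightarrow> real^'m \<Rightarrow> 'x::euclidean_space"
  assumes D: "tower k U D" and K: "compact K" "convex K" "K \<subseteq> U" and R: "R \<le> 1" and \<kappa>: "0 \<le> \<kappa>" "\<kappa> \<le> 1"
    and x: "flatC R 1 j 0 x" "\<And>n z. z \<in> ball 0 R \<Longrightarrow> x n z \<in> K"
    and y: "flatC R \<kappa> j s y" "\<And>n z. z \<in> ball 0 R \<Longrightarrow> x n z + y n z \<in> K"
    and hs: "length hs + j < k"
  shows "flatC R \<kappa> j s (\<lambda>n z. D hs (x n z + y n z) - D hs (x n z))"
  using x(1) y(1) hs
proof (induction j arbitrary: hs s)
  have flat0: "flat0 R \<kappa> s (\<lambda>n z. D hs (x n z + y n z) - D hs (x n z))"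
    if cont: "\<And>n. continuous_on (ball 0 R) (x n)" and f: "flat0 R \<kappa> s y" and hs: "length hs < k" for hs s
  proof -
    obtain B where B: "B \<ge> 0" "\<And>x y. x \<in> K \<Longrightarrow> y \<in> K \<Longrightarrow> norm (D hs y - D hs x) \<le> B * norm (y - x)"
      using tower_lipschitz[OF D K hs] by blast
    obtain C where C: "C \<ge> 0" "\<And>n z. z \<in> ball 0 R \<Longrightarrow> norm (y n z) \<le> C * \<kappa> ^ n * norm z ^ s"
      using f unfolding flat0_def by blast
    have "norm (D hs (x n z + y n z) - D hs (x n z)) \<le> (B * C) * \<kappa> ^ n * norm z ^ s" if "z \<in> ball 0 R" for n z
    proof -
      have "norm (D hs (x n z + y n z) - D hs (x n z)) \<le> B * norm (y n z)"
        using B(2)[OF x(2)[OF that, of n] y(2)[OF that, of n]] by simp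
      also have "\<dots> \<le> B * (C * \<kappa> ^ n * norm z ^ s)" using C(2)[OF that] B(1) by (intro mult_left_mono)
      finally show ?thesis by (simp add: mult_ac)
    qed
    moreover have "continuous_on (ball 0 R) (\<lambda>z. D hs (x n z + y n z) - D hs (x n z))" for n
    proof -
      have cy: "continuous_on (ball 0 R) (y n)" using f unfolding flat0_def by blast
      have h: "length hs \<le> k" using hs by simp
      show ?thesis
        using continuous_on_compose2[OF tower_continuous[OF D h] cont[of n]]
          continuous_on_compose2[OF tower_continuous[OF D h] continuous_on_add[OF cont[of n] cy]]
          x(2) y(2) K(3) by (intro continuous_on_diff) blast+
    qed
    ultimately show ?thesis unfolding flat0_def using mult_nonneg_nonneg[OF B(1) C(1)] by blast
  qed
  {
    case 0
    then show ?case using flat0 flatC_continuous[OF 0(1)] by simp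
  next
    case (Suc j)
    have xy: "flatC R 1 (Suc j) 0 (\<lambda>n z. x n z + y n z)"
      by (rule flatC_add[OF Suc.prems(1) flatC_mono_order[OF flatC_mono_rate[OF Suc.prems(2) \<kappa>]]]) (use R in auto)
    show ?case
    proof (rule flatC_SucI)
      show "flat0 R \<kappa> s (\<lambda>n z. D hs (x n z + y n z) - D hs (x n z))"
        using flat0 flatC_continuous[OF Suc.prems(1)] flatC_imp_flat0[OF Suc.prems(2)] Suc.prems(3) by simp
      show "((\<lambda>z. D hs (x n z + y n z) - D hs (x n z)) has_derivative
          (\<lambda>h. D ((\<Sum>l\<in>UNIV. h$l *\<^sub>R pdiff l (\<lambda>z. x n z + y n z) z) # hs) (x n z + y n z)
               - D ((\<Sum>l\<in>UNIV. h$l *\<^sub>R pdiff l (x n) z) # hs) (x n z))) (at z)"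
        if z: "z \<in> ball 0 R" for n z
        by (intro has_derivative_diff tower_comp_has_derivative[OF D _ Suc.prems(1) z]
            tower_comp_has_derivative[OF D _ xy z]) (use Suc.prems(3) x(2)[OF z] y(2)[OF z] K(3) in auto)
      fix i
      have sum: "pdiff i (\<lambda>z. x n z + y n z) z = pdiff i (x n) z + pdiff i (y n) z" if "z \<in> ball 0 R" for n z
      proof -
        have "pdiff i (\<lambda>z. x n z + y n z) z = (\<Sum>k\<in>UNIV. axis i 1 $ k *\<^sub>R pdiff k (x n) z) + (\<Sum>k\<in>UNIV. axis i 1 $ k *\<^sub>R pdiff k (y n) z)"
          using has_derivative_add[OF flatC_has_derivative[OF Suc.prems(1) that] flatC_has_derivative[OF Suc.prems(2) that]]
          by (rule pdiff_eq)
        then show ?thesis by (simp add: sum_axis_scaleR)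
      qed
      let ?d = "\<lambda>n z. (\<Sum>e\<in>Basis. (pdiff i (x n) z \<bullet> e) *\<^sub>R (D (e # hs) (x n z + y n z) - D (e # hs) (x n z)))
                  + (\<Sum>e\<in>Basis. (pdiff i (y n) z \<bullet> e) *\<^sub>R D (e # hs) (x n z + y n z))"
      have "flatC R \<kappa> j (s - 1) ?d"
      proof (intro flatC_add flatC_sum)
        fix e :: 'x
        have "flatC R \<kappa> j s (\<lambda>n z. D (e # hs) (x n z + y n z) - D (e # hs) (x n z))"
          using Suc.prems by (intro Suc.IH flatC_Suc_imp[of R _ j]) auto
        then have "flatC R \<kappa> j (s - 1) (\<lambda>n z. D (e # hs) (x n z + y n z) - D (e # hs) (x n z))"
          by (rule flatC_mono_order) (use R \<kappa> in auto)
        then show "flatC R \<kappa> j (s - 1) (\<lambda>n z. (pdiff i (x n) z \<bullet> e) *\<^sub>R (D (e # hs) (x n z + y n z) - D (e # hs) (x n z)))"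
          using \<kappa> R flatC_pdiff[OF Suc.prems(1)] by (intro flatC_1mult flatC_inner) auto
        have "flatC R 1 j 0 (\<lambda>n z. D (e # hs) (x n z + y n z))"
          by (rule flatC_comp[OF D K(1,3) R flatC_Suc_imp[OF xy]]) (use Suc.prems(3) y(2) in auto)
        then show "flatC R \<kappa> j (s - 1) (\<lambda>n z. (pdiff i (y n) z \<bullet> e) *\<^sub>R D (e # hs) (x n z + y n z))"
          using \<kappa> R flatC_pdiff[OF Suc.prems(2)] by (intro flatC_mult1 flatC_inner) auto
      qed
      moreover have "D (pdiff i (\<lambda>z. x n z + y n z) z # hs) (x n z + y n z) - D (pdiff i (x n) z # hs) (x n z) = ?d n z"
        if z: "z \<in> ball 0 R" for n z
      proof -
        have "D (pdiff i (\<lambda>z. x n z + y n z) z # hs) (x n z + y n z)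
            = (\<Sum>e\<in>Basis. (pdiff i (x n) z \<bullet> e + pdiff i (y n) z \<bullet> e) *\<^sub>R D (e # hs) (x n z + y n z))"
          unfolding sum[OF z] using tower_Cons_expansion[OF D] Suc.prems(3) y(2)[OF z] K(3)
          by (simp add: subset_iff inner_add_left)
        moreover have "D (pdiff i (x n) z # hs) (x n z) = (\<Sum>e\<in>Basis. (pdiff i (x n) z \<bullet> e) *\<^sub>R D (e # hs) (x n z))"
          using tower_Cons_expansion[OF D] Suc.prems(3) x(2)[OF z] K(3) by (simp add: subset_iff)
        ultimately show ?thesis by (simp add: algebra_simps sum.distrib sum_subtractf)
      qed
      ultimately show "flatC R \<kappa> j (s - 1) (\<lambda>n z. D ((\<Sum>l\<in>UNIV. axis i 1 $ l *\<^sub>R pdiff l (\<lambda>z. x n z + y n z) z) # hs) (x n z + y n z)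
           - D ((\<Sum>l\<in>UNIV. axis i 1 $ l *\<^sub>R pdiff l (x n) z) # hs) (x n z))"
        unfolding sum_axis_scaleR by (subst flatC_cong) auto
    qed
  }
qed

section \<open>Linear recursions and series\<close>

text \<open>Let \<theta> be the sum in the hypothesis on \<open>M\<close>. A bound with constant
  \<open>M\<close> at stage \<open>n\<close> becomes one with \<theta> M + K at the next, because
  \<open>dil lam i\<close> gains the factor \<open>L ^ (i * s)\<close>; the hypothesis says that
  this reproduces \<open>M\<close> with one more factor \<kappa>. The recursive inequality is
  assumed only under the bound for stage \<open>n\<close>, because an iterate must be known to be
  small before \<open>G\<close> can be estimated along its orbit.\<close>

lemma weighted_contraction_bound:
  fixes g :: "nat \<Rightarrow> real^'m \<Rightarrow> real"
  assumes rec: "\<And>n z. (\<And>y. y \<in> ball 0 R \<Longrightarrow> g n y \<le> M * \<kappa> ^ n * norm y ^ s) \<Longrightarrow> z \<in> ball 0 R \<Longrightarrow>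
      g (Suc n) z \<le> (\<Sum>i\<le>N. b i * g n (dil lam i z)) + K * \<kappa> ^ n * norm z ^ s"
    and init: "\<And>z. z \<in> ball 0 R \<Longrightarrow> g 0 z \<le> M * norm z ^ s"
    and b: "\<And>i. b i \<ge> 0" and M: "(\<Sum>i\<le>N. b i * L ^ (i * s)) * M + K \<le> M * \<kappa>" "M \<ge> 0" and \<kappa>: "\<kappa> \<ge> 0"
    and lam: "\<And>k. \<bar>lam$k\<bar> \<le> L" "L \<le> 1" and z: "z \<in> ball 0 R"
  shows "g n z \<le> M * \<kappa> ^ n * norm z ^ s"
  using z
proof (induction n arbitrary: z)
  case 0
  then show ?case using init by simp
next
  case (Suc n)
  let ?\<theta> = "\<Sum>i\<le>N. b i * L ^ (i * s)"
  have dz: "dil lam i z \<in> ball 0 R" for i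
    using dil_ball[of lam z R i] lam Suc.prems by (meson order_trans)
  have "b i * g n (dil lam i z) \<le> (b i * L ^ (i * s)) * (M * \<kappa> ^ n * norm z ^ s)" for i
  proof -
    have "norm (dil lam i z) ^ s \<le> (L ^ i * norm z) ^ s"
      using norm_dil_le[OF lam(1), of i z] by (intro power_mono) auto
    then have "norm (dil lam i z) ^ s \<le> L ^ (i * s) * norm z ^ s"
      by (simp add: power_mult_distrib power_mult)
    then have "M * \<kappa> ^ n * norm (dil lam i z) ^ s \<le> M * \<kappa> ^ n * (L ^ (i * s) * norm z ^ s)"
      using M \<kappa> by (intro mult_left_mono) auto
    then have "g n (dil lam i z) \<le> M * \<kappa> ^ n * (L ^ (i * s) * norm z ^ s)"
      using Suc.IH[OF dz] order_trans by blast
    then have "b i * g n (dil lam i z) \<le> b i * (M * \<kappa> ^ n * (L ^ (i * s) * norm z ^ s))"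
      by (rule mult_left_mono[OF _ b])
    then show ?thesis by (simp only: mult_ac)
  qed
  then have "(\<Sum>i\<le>N. b i * g n (dil lam i z)) \<le> ?\<theta> * (M * \<kappa> ^ n * norm z ^ s)"
    unfolding sum_distrib_right by (rule sum_mono)
  then have "g (Suc n) z \<le> (?\<theta> * M + K) * (\<kappa> ^ n * norm z ^ s)"
    using rec[OF Suc.IH Suc.prems] by (simp add: algebra_simps)
  also have "\<dots> \<le> (M * \<kappa>) * (\<kappa> ^ n * norm z ^ s)"
    using M(1) \<kappa> by (intro mult_right_mono) auto
  finally show ?case by (simp add: mult_ac)
qed

lemma infnorm_sum_le:
  fixes f :: "'i \<Rightarrow> 'b::euclidean_space"
  shows "infnorm (sum f A) \<le> (\<Sum>i\<in>A. infnorm (f i))"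
proof (induction A rule: infinite_finite_induct)
  case (insert x F)
  then show ?case using infnorm_triangle[of "f x" "sum f F"] by simp
qed (auto simp: infnorm_0)

text \<open>Contraction is measured by \<open>infnorm\<close>; this carries the outcome over to the
  norm in \<open>flat0\<close>, at the price of a constant independent of the stage.\<close>

lemma norm_le_of_infnorm_le:
  fixes x :: "'b::euclidean_space"
  assumes "infnorm x \<le> C * k * w"
  shows "norm x \<le> (sqrt DIM('b) * C) * k * w"
  using order_trans[OF norm_le_infnorm mult_left_mono[OF assms, of "sqrt DIM('b)"]] by (simp add: mult.assoc)

text \<open>Differentiation along axis \<open>k\<close> reproduces the recursion with
  \<open>c * lam$k\<close> for \<open>c\<close> and \<open>s - 1\<close> for \<open>s\<close>, while
  the terms with derivatives of \<open>m\<close> are moved into \<open>F\<close>. The invariant on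
  \<open>c\<close> gives |c|^i L^(i*s) \<le> L^(i*r), so the single assumption on the sum of
  \<open>a i * L ^ (i * r)\<close> serves every level.\<close>

lemma flatC_linear_recursion:
  fixes v F :: "nat \<Rightarrow> real^'m \<Rightarrow> 'b::euclidean_space"
    and m :: "nat \<Rightarrow> 'b \<Rightarrow> nat \<Rightarrow> real^'m \<Rightarrow> 'b"
  assumes R: "R \<le> 1" and lam: "\<And>k. \<bar>lam$k\<bar> \<le> L" "L \<le> 1"
    and a: "\<And>i. a i \<ge> 0" "(\<Sum>i\<le>N. a i * L ^ (i * r)) < \<kappa>" and \<kappa>: "\<kappa> \<le> 1"
    and mbound: "\<And>n i z y. i \<le> N \<Longrightarrow> z \<in> ball 0 R \<Longrightarrow>
        infnorm (\<Sum>e\<in>Basis. (y \<bullet> e) *\<^sub>R m i e n z) \<le> a i * infnorm y"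
    and m: "\<And>i e. i \<le> N \<Longrightarrow> flatC R 1 j 0 (m i e)"
    and F: "flatC R \<kappa> j s F" and v0: "flatC R 1 j s (\<lambda>_. v 0)"
    and rec: "\<And>n z. z \<in> ball 0 R \<Longrightarrow>
        v (Suc n) z = (\<Sum>i\<le>N. c ^ i *\<^sub>R (\<Sum>e\<in>Basis. (v n (dil lam i z) \<bullet> e) *\<^sub>R m i e n z)) + F n z"
    and c: "\<bar>c\<bar> \<le> L ^ (r - s)" "s \<le> r"
  shows "flatC R \<kappa> j s v"
  using m F v0 rec c
proof (induction j arbitrary: v F c s)
  have L0: "L \<ge> 0" using lam(1) abs_ge_zero order_trans by blast
  have \<kappa>0: "\<kappa> > 0" using a L0 by (smt (verit) mult_nonneg_nonneg sum_nonneg zero_le_power)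
  have lam1: "\<bar>lam$k\<bar> \<le> 1" for k using lam order_trans by blast
  have cont_dil: "continuous_on (ball 0 R) (\<lambda>z. f (dil lam i z))"
    if "continuous_on (ball 0 R) f" for f :: "real^'m \<Rightarrow> 'b" and i
    using continuous_on_compose2[OF that linear_continuous_on[OF bounded_linear_dil]] dil_ball[OF lam1] by blast
  {
    case 0
    have cont: "continuous_on (ball 0 R) (v n)" for n
    proof (induction n)
      case (Suc n)
      have "continuous_on (ball 0 R) (\<lambda>z. (\<Sum>i\<le>N. c ^ i *\<^sub>R (\<Sum>e\<in>Basis. (v n (dil lam i z) \<bullet> e) *\<^sub>R m i e n z)) + F n z)"
        using flatC_continuous[OF 0(1)] flatC_continuous[OF 0(2)] cont_dil[OF Suc]
        by (auto intro!: continuous_intros)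
      then show ?case using 0(4) by (subst continuous_on_cong) auto
    qed (use flatC_continuous[OF 0(3)] in blast)
    obtain CF where CF: "CF \<ge> 0" "\<And>n z. z \<in> ball 0 R \<Longrightarrow> norm (F n z) \<le> CF * \<kappa> ^ n * norm z ^ s"
      using flatC_bound[OF 0(2)] by blast
    obtain C0 where C0: "C0 \<ge> 0" "\<And>z. z \<in> ball 0 R \<Longrightarrow> norm (v 0 z) \<le> C0 * norm z ^ s"
      using flatC_bound[OF 0(3)] by (metis (no_types, lifting) mult.right_neutral power_one)
    let ?b = "\<lambda>i. \<bar>c\<bar> ^ i * a i"
    have b: "?b i * L ^ (i * s) \<le> a i * L ^ (i * r)" for i
    proof -
      have "\<bar>c\<bar> ^ i * L ^ (i * s) \<le> (L ^ (r - s)) ^ i * L ^ (i * s)"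
        using 0(5) L0 by (intro mult_right_mono power_mono) auto
      also have "\<dots> = L ^ ((r - s) * i + i * s)" by (simp add: power_add power_mult)
      also have "(r - s) * i + i * s = i * r" using 0(6) by (metis add_mult_distrib2 le_add_diff_inverse2 mult.commute)
      finally have "a i * (\<bar>c\<bar> ^ i * L ^ (i * s)) \<le> a i * L ^ (i * r)" by (rule mult_left_mono[OF _ a(1)])
      then show ?thesis by (simp add: mult_ac)
    qed
    have \<theta>: "(\<Sum>i\<le>N. ?b i * L ^ (i * s)) < \<kappa>"
      by (rule le_less_trans[OF sum_mono a(2)]) (rule b)
    have step: "infnorm (v (Suc n) z) \<le> (\<Sum>i\<le>N. ?b i * infnorm (v n (dil lam i z))) + CF * \<kappa> ^ n * norm z ^ s"
      if z: "z \<in> ball 0 R" for n z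
    proof -
      let ?S = "\<lambda>i. c ^ i *\<^sub>R (\<Sum>e\<in>Basis. (v n (dil lam i z) \<bullet> e) *\<^sub>R m i e n z)"
      have "infnorm (?S i) \<le> ?b i * infnorm (v n (dil lam i z))" if "i \<le> N" for i
        using mult_left_mono[OF mbound[OF that z, of "v n (dil lam i z)" n], of "\<bar>c\<bar> ^ i"]
        by (simp add: infnorm_mul power_abs mult_ac)
      then have "infnorm (sum ?S {..N}) \<le> (\<Sum>i\<le>N. ?b i * infnorm (v n (dil lam i z)))"
        by (intro order_trans[OF infnorm_sum_le] sum_mono) simp
      moreover have "infnorm (F n z) \<le> CF * \<kappa> ^ n * norm z ^ s"
        using infnorm_le_norm CF(2)[OF z] order_trans by blast
      ultimately show ?thesis unfolding 0(4)[OF z] using infnorm_triangle[of "sum ?S {..N}" "F n z"] by linarith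
    qed
    \<comment> \<open>The bound must satisfy \<theta> M + CF \<le> M \<kappa>, that is M \<ge> CF /
      (\<kappa> - \<theta>) with \<theta> the sum below, and must also dominate the initial constant
      \<open>C0\<close>.\<close>
    let ?M = "C0 + CF / (\<kappa> - (\<Sum>i\<le>N. ?b i * L ^ (i * s)))"
    have M: "(\<Sum>i\<le>N. ?b i * L ^ (i * s)) * ?M + CF \<le> ?M * \<kappa>"
    proof -
      let ?\<theta> = "\<Sum>i\<le>N. ?b i * L ^ (i * s)"
      have "?M * (\<kappa> - ?\<theta>) = C0 * (\<kappa> - ?\<theta>) + CF"
        unfolding distrib_right using \<theta> by simp
      moreover have "C0 * (\<kappa> - ?\<theta>) \<ge> 0" using C0(1) \<theta> by simp
      moreover have "?M * (\<kappa> - ?\<theta>) = ?M * \<kappa> - ?\<theta> * ?M"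
        by (simp only: right_diff_distrib mult.commute[of ?\<theta>])
      ultimately show ?thesis by linarith
    qed
    have "infnorm (v n z) \<le> ?M * \<kappa> ^ n * norm z ^ s" if "z \<in> ball 0 R" for n z
      using step _ _ M _ _ lam that
    proof (rule weighted_contraction_bound)
      show "infnorm (v 0 z) \<le> ?M * norm z ^ s" if "z \<in> ball 0 R" for z
      proof -
        have "infnorm (v 0 z) \<le> C0 * norm z ^ s" using infnorm_le_norm C0(2)[OF that] order_trans by blast
        also have "\<dots> \<le> ?M * norm z ^ s" using CF(1) \<theta> by (intro mult_right_mono) auto
        finally show ?thesis .
      qed
    qed (use a C0(1) CF(1) \<theta> \<kappa>0 in auto)
    then have "norm (v n z) \<le> (sqrt DIM('b) * ?M) * \<kappa> ^ n * norm z ^ s" if "z \<in> ball 0 R" for n z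
      using that norm_le_of_infnorm_le by blast
    moreover have "sqrt DIM('b) * ?M \<ge> 0" using C0(1) CF(1) \<theta> by simp
    ultimately show ?case unfolding flatC.simps flat0_def using cont by blast
  next
    case (Suc j)
    note m' = flatC_Suc_imp[OF Suc.prems(1)]
    note c5 = Suc.prems(5) and c6 = Suc.prems(6)
    \<comment> \<open>The product rule leaves terms in which \<open>m\<close> is differentiated and
      \<open>v\<close> is not. They force the recursion for the derivative, and this lower level of
      \<open>v\<close> itself is what makes them flat.\<close>
    have IH: "flatC R \<kappa> j s v"
      by (rule Suc.IH[OF m' flatC_Suc_imp[OF Suc.prems(2)] flatC_Suc_imp[OF Suc.prems(3)] Suc.prems(4-6)])
    define dv where "dv n z h = (\<Sum>i\<le>N. c ^ i *\<^sub>R (\<Sum>e\<in>Basis.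
          (v n (dil lam i z) \<bullet> e) *\<^sub>R (\<Sum>k\<in>UNIV. h$k *\<^sub>R pdiff k (m i e n) z) +
          ((\<Sum>k\<in>UNIV. (dil lam i h)$k *\<^sub>R pdiff k (v n) (dil lam i z)) \<bullet> e) *\<^sub>R m i e n z)) +
          (\<Sum>k\<in>UNIV. h$k *\<^sub>R pdiff k (F n) z)" for n z h
    have deriv: "(v (Suc n) has_derivative dv n z) (at z)"
      if z: "z \<in> ball 0 R" and v: "\<And>z. z \<in> ball 0 R \<Longrightarrow> v n differentiable at z" for n z
    proof -
      have "((\<lambda>z. v n (dil lam i z)) has_derivative
          (\<lambda>h. \<Sum>k\<in>UNIV. (dil lam i h)$k *\<^sub>R pdiff k (v n) (dil lam i z))) (at z)" for i
        using has_derivative_compose[OF bounded_linear_imp_has_derivative[OF bounded_linear_dil]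
            has_derivative_pdiff[OF v[OF dil_ball[OF lam1 z]]]] .
      then have "((\<lambda>z. (\<Sum>i\<le>N. c ^ i *\<^sub>R (\<Sum>e\<in>Basis. (v n (dil lam i z) \<bullet> e) *\<^sub>R m i e n z)) + F n z)
          has_derivative dv n z) (at z)"
        unfolding dv_def
        using flatC_has_derivative[OF Suc.prems(1) z] flatC_has_derivative[OF Suc.prems(2) z]
        by (intro has_derivative_add has_derivative_sum has_derivative_scaleR_right has_derivative_scaleR
            has_derivative_inner_left) auto
      then show ?thesis
        using has_derivative_transform_within_open[OF _ open_ball z] Suc.prems(4) by fastforce
    qed
    have v0: "flatC R 1 (Suc j) s (\<lambda>_. v 0)" by (rule Suc.prems(3))
    have diff: "v n differentiable at z" if "z \<in> ball 0 R" for n z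
      using that
    proof (induction n arbitrary: z)
      case 0
      then show ?case using flatC_differentiable[OF v0] by blast
    next
      case (Suc n)
      then show ?case using deriv differentiable_def by blast
    qed
    have pd: "flatC R \<kappa> j (s - 1) (\<lambda>n. pdiff k (v n))" for k
    proof (rule Suc.IH[where c = "c * lam$k"])
      let ?F = "\<lambda>n z. (\<Sum>i\<le>N. c ^ i *\<^sub>R (\<Sum>e\<in>Basis. (v n (dil lam i z) \<bullet> e) *\<^sub>R pdiff k (m i e n) z)) + pdiff k (F n) z"
      show "flatC R 1 j 0 (m i e)" if "i \<le> N" for i e by (rule m'[OF that])
      show "flatC R 1 j (s - 1) (\<lambda>_. pdiff k (v 0))" by (rule flatC_pdiff[OF v0])
      have "flatC R \<kappa> j (s - 1) (\<lambda>n z. v n (dil lam i z))" for i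
        by (rule flatC_dil[OF lam1]) (use \<kappa>0 R flatC_mono_order[OF IH] in auto)
      then show "flatC R \<kappa> j (s - 1) ?F"
        using flatC_pdiff[OF Suc.prems(2)] flatC_pdiff[OF Suc.prems(1)] \<kappa>0 R
        by (intro flatC_add flatC_sum flatC_scaleR flatC_mult1 flatC_inner) auto
      show "pdiff k (v (Suc n)) z = (\<Sum>i\<le>N. (c * lam$k) ^ i *\<^sub>R
          (\<Sum>e\<in>Basis. (pdiff k (v n) (dil lam i z) \<bullet> e) *\<^sub>R m i e n z)) + ?F n z"
        if z: "z \<in> ball 0 R" for n z
      proof -
        have "pdiff k (v (Suc n)) z = dv n z (axis k 1)" using deriv[OF z diff] by (rule pdiff_eq)
        also have "\<dots> = (\<Sum>i\<le>N. c ^ i *\<^sub>R (\<Sum>e\<in>Basis. (v n (dil lam i z) \<bullet> e) *\<^sub>R pdiff k (m i e n) z +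
            ((lam$k ^ i *\<^sub>R pdiff k (v n) (dil lam i z)) \<bullet> e) *\<^sub>R m i e n z)) + pdiff k (F n) z"
          unfolding dv_def dil_axis by (simp add: sum_axis_scaleR flip: scaleR_scaleR scaleR_sum_right)
        also have "\<dots> = (\<Sum>i\<le>N. (c * lam$k) ^ i *\<^sub>R
          (\<Sum>e\<in>Basis. (pdiff k (v n) (dil lam i z) \<bullet> e) *\<^sub>R m i e n z)) + ?F n z"
          by (simp add: sum.distrib scaleR_add_right power_mult_distrib scaleR_sum_right mult_ac)
        finally show ?thesis .
      qed
      show "\<bar>c * lam$k\<bar> \<le> L ^ (r - (s - 1))"
      proof (cases s)
        case 0
        \<comment> \<open>Here \<open>s - 1\<close> is truncated to 0, so the exponent stays
          \<open>r\<close> and \<bar>lam$k\<bar> \<le> 1 is enough.\<close>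
        have "\<bar>c\<bar> * \<bar>lam$k\<bar> \<le> L ^ r * 1" using c5 0 lam1 by (intro mult_mono) auto
        then show ?thesis using 0 by (simp add: abs_mult)
      next
        case (Suc t)
        have "\<bar>c\<bar> * \<bar>lam$k\<bar> \<le> L ^ (r - s) * L" using c5 lam(1) L0 by (intro mult_mono) auto
        also have "\<dots> = L ^ (r - (s - 1))" using Suc c6 by (metis Suc_diff_Suc Suc_le_lessD diff_Suc_1 power_Suc2)
        finally show ?thesis by (simp add: abs_mult)
      qed
    qed (use Suc.prems in auto)
    show ?case using flatC_imp_flat0[OF IH] diff pd by simp
  }
qed


section \<open>Summing geometric families term by term\<close>

lemma geometric_tail:
  fixes f :: "nat \<Rightarrow> 'b::banach"
  assumes "\<And>n. norm (f n) \<le> C * \<kappa> ^ n" "0 \<le> \<kappa>" "\<kappa> < 1"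
  shows "summable f" "norm (sum f {..<n} - suminf f) \<le> C / (1 - \<kappa>) * \<kappa> ^ n" "norm (suminf f) \<le> C / (1 - \<kappa>)"
proof -
  have g: "summable (\<lambda>i. C * \<kappa> ^ (i + n))" for n
    using assms(2,3) by (simp add: power_add summable_mult summable_mult2 mult.assoc[symmetric])
  show s: "summable f" using summable_comparison_test[OF _ g[of 0]] assms(1) by auto
  have tail: "norm (suminf f - sum f {..<n}) \<le> C / (1 - \<kappa>) * \<kappa> ^ n" for n
  proof -
    have "norm (\<Sum>i. f (i + n)) \<le> (\<Sum>i. C * \<kappa> ^ (i + n))"
      using assms(1) g by (intro norm_suminf_le) auto
    also have "\<dots> = C * \<kappa> ^ n * (\<Sum>i. \<kappa> ^ i)"
      using assms(2,3) by (subst suminf_mult[symmetric]) (auto simp: power_add mult_ac)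
    also have "\<dots> = C / (1 - \<kappa>) * \<kappa> ^ n" using assms(2,3) by (simp add: suminf_geometric)
    finally show ?thesis using suminf_minus_initial_segment[OF s, of n] by simp
  qed
  then show "norm (sum f {..<n} - suminf f) \<le> C / (1 - \<kappa>) * \<kappa> ^ n" by (simp add: norm_minus_commute)
  show "norm (suminf f) \<le> C / (1 - \<kappa>)" using tail[of 0] by simp
qed

text \<open>The rate makes the series of first partial derivatives converge uniformly, so the sum
  may be differentiated term by term; the differentiated series is of the same kind, one level
  lower.\<close>

lemma flatC_suminf:
  fixes d :: "nat \<Rightarrow> real^'m \<Rightarrow> 'b::banach"
  assumes \<kappa>: "0 \<le> \<kappa>" "\<kappa> < 1" and R: "R \<le> 1" and "flatC R \<kappa> j s d"
  shows "flatC R 1 j s (\<lambda>_ z. \<Sum>n. d n z)"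
  using assms(4)
proof (induction j arbitrary: s d)
  have geom: "\<exists>C\<ge>0. \<forall>z\<in>ball 0 R. summable (\<lambda>n. d n z) \<and> norm (\<Sum>n. d n z) \<le> C * norm z ^ s \<and>
      (\<forall>n. norm ((\<Sum>i<n. d i z) - (\<Sum>n. d n z)) \<le> C * \<kappa> ^ n)"
    if d: "flat0 R \<kappa> s d" for d :: "nat \<Rightarrow> real^'m \<Rightarrow> 'b" and s
  proof -
    obtain C where C: "C \<ge> 0" "\<And>n z. z \<in> ball 0 R \<Longrightarrow> norm (d n z) \<le> C * \<kappa> ^ n * norm z ^ s"
      using d unfolding flat0_def by blast
    have "summable (\<lambda>n. d n z) \<and> norm (\<Sum>n. d n z) \<le> C / (1 - \<kappa>) * norm z ^ s \<and>
        (\<forall>n. norm ((\<Sum>i<n. d i z) - (\<Sum>n. d n z)) \<le> C / (1 - \<kappa>) * \<kappa> ^ n)" if z: "z \<in> ball 0 R" for z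
    proof -
      have b: "norm (d n z) \<le> (C * norm z ^ s) * \<kappa> ^ n" for n using C(2)[OF z, of n] by (simp add: mult_ac)
      \<comment> \<open>The factor \<open>norm z ^ s\<close> is at most 1 and is dropped, since
        uniform convergence needs a tail bound free of \<open>z\<close>.\<close>
      have "(C * norm z ^ s) / (1 - \<kappa>) * \<kappa> ^ n \<le> C / (1 - \<kappa>) * \<kappa> ^ n" for n
        using z R \<kappa> C(1) by (intro mult_right_mono divide_right_mono mult_left_le power_le_one) auto
      then show ?thesis using geometric_tail[OF b \<kappa>] order_trans by fastforce
    qed
    moreover have "C / (1 - \<kappa>) \<ge> 0" using C(1) \<kappa> by simp
    ultimately show ?thesis by blast
  qed
  have unif: "\<forall>\<^sub>F n in sequentially. \<forall>z\<in>ball 0 R. norm ((\<Sum>i<n. d i z) - (\<Sum>n. d n z)) < e"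
    if d: "flat0 R \<kappa> s d" and e: "e > 0" for d :: "nat \<Rightarrow> real^'m \<Rightarrow> 'b" and s e
  proof -
    obtain C where C: "C \<ge> 0" "\<And>z n. z\<in>ball 0 R \<Longrightarrow> norm ((\<Sum>i<n. d i z) - (\<Sum>n. d n z)) \<le> C * \<kappa> ^ n"
      using geom[OF d] by blast
    have "(\<lambda>n. C * \<kappa> ^ n) \<longlonglongrightarrow> C * 0" using \<kappa> by (intro tendsto_mult_left LIMSEQ_power_zero) simp
    then have "\<forall>\<^sub>F n in sequentially. C * \<kappa> ^ n < e" using e order_tendstoD(2) by fastforce
    then show ?thesis
    proof eventually_elim
      case (elim n)
      then show ?case using C(2) by (meson le_less_trans)
    qed
  qed
  have flat0: "flat0 R 1 s (\<lambda>_ z. \<Sum>n. d n z)" if d: "flat0 R \<kappa> s d" for d :: "nat \<Rightarrow> real^'m \<Rightarrow> 'b" and s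
  proof -
    have "uniform_limit (ball 0 R) (\<lambda>n z. \<Sum>i<n. d i z) (\<lambda>z. \<Sum>n. d n z) sequentially"
      unfolding uniform_limit_iff dist_norm using unif[OF d] by blast
    moreover have "continuous_on (ball 0 R) (\<lambda>z. \<Sum>i<n. d i z)" for n
      using d unfolding flat0_def by (intro continuous_on_sum) blast
    ultimately have "continuous_on (ball 0 R) (\<lambda>z. \<Sum>n. d n z)"
      by (intro uniform_limit_theorem[where F = sequentially]) auto
    then show ?thesis unfolding flat0_def using geom[OF d] by auto
  qed
  {
    case 0
    then show ?case using flat0 by simp
  next
    case (Suc j)
    note pd = flatC_imp_flat0[OF flatC_pdiff[OF Suc.prems]]
    have deriv: "((\<lambda>z. \<Sum>n. d n z) has_derivative (\<lambda>h. \<Sum>k\<in>UNIV. h$k *\<^sub>R (\<Sum>n. pdiff k (d n) z))) (at z)"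
      if z: "z \<in> ball 0 R" for z
    proof -
      have "\<exists>g. \<forall>x\<in>ball 0 R. (\<lambda>n. d n x) sums g x \<and>
          (g has_derivative (\<lambda>h. \<Sum>k\<in>UNIV. h$k *\<^sub>R (\<Sum>n. pdiff k (d n) x))) (at x within ball 0 R)"
      proof (rule has_derivative_series)
        show "(d n has_derivative (\<lambda>h. \<Sum>k\<in>UNIV. h$k *\<^sub>R pdiff k (d n) x)) (at x within ball 0 R)"
          if "x \<in> ball 0 R" for n x
          using flatC_has_derivative[OF Suc.prems that] by (rule has_derivative_at_withinI)
        show "\<forall>\<^sub>F n in sequentially. \<forall>x\<in>ball 0 R. \<forall>h. norm ((\<Sum>i<n. \<Sum>k\<in>UNIV. h$k *\<^sub>R pdiff k (d i) x)
            - (\<Sum>k\<in>UNIV. h$k *\<^sub>R (\<Sum>n. pdiff k (d n) x))) \<le> e * norm h" if e: "e > 0" for e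
        proof -
          let ?e = "e / CARD('m)"
          have "\<forall>\<^sub>F n in sequentially. \<forall>k. \<forall>x\<in>ball 0 R. norm ((\<Sum>i<n. pdiff k (d i) x) - (\<Sum>n. pdiff k (d n) x)) < ?e"
            using unif[OF pd, of ?e] e by (intro eventually_all_finite) simp
          then show ?thesis
          proof eventually_elim
            case (elim n)
            show ?case
            proof (intro ballI allI)
              fix x h :: "real^'m" assume x: "x \<in> ball 0 R"
              have "(\<Sum>i<n. \<Sum>k\<in>UNIV. h$k *\<^sub>R pdiff k (d i) x) - (\<Sum>k\<in>UNIV. h$k *\<^sub>R (\<Sum>n. pdiff k (d n) x))
                = (\<Sum>k\<in>UNIV. h$k *\<^sub>R ((\<Sum>i<n. pdiff k (d i) x) - (\<Sum>n. pdiff k (d n) x)))"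
                by (subst sum.swap) (simp add: sum_subtractf scaleR_diff_right scaleR_sum_right)
              also have "norm \<dots> \<le> (\<Sum>k\<in>(UNIV::'m set). norm h * ?e)"
              proof (rule sum_norm_le)
                fix k
                show "norm (h$k *\<^sub>R ((\<Sum>i<n. pdiff k (d i) x) - (\<Sum>n. pdiff k (d n) x))) \<le> norm h * ?e"
                  unfolding norm_scaleR using elim x component_le_norm_cart[of h k]
                  by (intro mult_mono) (auto simp: less_imp_le)
              qed
              also have "\<dots> = e * norm h" by simp
              finally show "norm ((\<Sum>i<n. \<Sum>k\<in>UNIV. h$k *\<^sub>R pdiff k (d i) x)
                - (\<Sum>k\<in>UNIV. h$k *\<^sub>R (\<Sum>n. pdiff k (d n) x))) \<le> e * norm h" .
            qed
          qed
        qed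
        show "(\<lambda>n. d n z) sums (\<Sum>n. d n z)"
          using geom[OF flatC_imp_flat0[OF Suc.prems]] z summable_sums by blast
      qed (use z in auto)
      then obtain g where g: "\<And>x. x \<in> ball 0 R \<Longrightarrow> (\<lambda>n. d n x) sums g x"
        "(g has_derivative (\<lambda>h. \<Sum>k\<in>UNIV. h$k *\<^sub>R (\<Sum>n. pdiff k (d n) z))) (at z within ball 0 R)" using z by blast
      have "(g has_derivative (\<lambda>h. \<Sum>k\<in>UNIV. h$k *\<^sub>R (\<Sum>n. pdiff k (d n) z))) (at z)"
        using g(2) at_within_open[OF z open_ball] by simp
      then show ?thesis
        by (rule has_derivative_transform_within_open[OF _ open_ball z]) (rule sums_unique[OF g(1)])
    qed
    show ?case
    proof (rule flatC_SucI)
      show "flat0 R 1 s (\<lambda>_ z. \<Sum>n. d n z)" using flat0[OF flatC_imp_flat0[OF Suc.prems]] .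
      show "flatC R 1 j (s - 1) (\<lambda>n z. \<Sum>k\<in>UNIV. axis i 1 $ k *\<^sub>R (\<Sum>n. pdiff k (d n) z))" for i
        unfolding sum_axis_scaleR by (rule Suc.IH[OF flatC_pdiff[OF Suc.prems]])
    qed (rule deriv)
  }
qed

section \<open>From partial derivatives along the axes to the arbitrary directions of
  \<open>Ck_on\<close>\<close>

definition dird :: "'a::real_normed_vector \<Rightarrow> ('a \<Rightarrow> 'b::real_normed_vector) \<Rightarrow> 'a \<Rightarrow> 'b" where
  "dird h f x = frechet_derivative f (at x) h"

lemma flatC_dird:
  assumes "flatC R \<kappa> (Suc j) s f" "\<kappa> \<ge> 0"
  shows "flatC R \<kappa> j (s - 1) (\<lambda>n. dird h (f n))"
proof -
  have "dird h (f n) z = (\<Sum>k\<in>UNIV. h$k *\<^sub>R pdiff k (f n) z)" if "z \<in> ball 0 R" for n z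
    unfolding dird_def frechet_derivative_at[OF flatC_has_derivative[OF assms(1) that], symmetric] ..
  moreover have "flatC R \<kappa> j (s - 1) (\<lambda>n z. \<Sum>k\<in>UNIV. h$k *\<^sub>R pdiff k (f n) z)"
    using flatC_pdiff[OF assms(1)] assms(2) by (intro flatC_sum flatC_scaleR)
  ultimately show ?thesis by (subst flatC_cong) auto
qed

text \<open>\<open>foldr\<close> keeps the latest direction at the head of the list, the convention
  of \<open>D (h # hs)\<close> in \<open>Ck_on\<close>.\<close>

lemma flatC_foldr_dird:
  assumes "flatC R 1 k s (\<lambda>_. F)" "length hs \<le> k"
  shows "flatC R 1 (k - length hs) (s - length hs) (\<lambda>_. foldr dird hs F)"
  using assms(2)
proof (induction hs)
  case Nil
  then show ?case using assms(1) by simp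
next
  case (Cons h hs)
  then have "flatC R 1 (Suc (k - length (h # hs))) (s - length hs) (\<lambda>_. foldr dird hs F)"
    by (simp add: Suc_diff_le[symmetric] del: flatC.simps)
  from flatC_dird[OF this, of h] show ?case by simp
qed

text \<open>Besides leading to \<open>Ck_on\<close>, this makes the symmetry of second derivatives,
  proved for towers, available for flat functions.\<close>

lemma flatC_tower:
  assumes "flatC R 1 k s (\<lambda>_. F)"
  shows "tower k (ball 0 R) (\<lambda>hs. foldr dird hs F)"
proof -
  have "(foldr dird hs F has_derivative (\<lambda>h. foldr dird (h # hs) F x)) (at x)"
    if hs: "length hs < k" and x: "x \<in> ball 0 R" for hs x
  proof -
    have "flatC R 1 (Suc (k - length hs - 1)) (s - length hs) (\<lambda>_. foldr dird hs F)"
      using flatC_foldr_dird[OF assms, of hs] hs by (simp add: Suc_diff_Suc del: flatC.simps)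
    then have "foldr dird hs F differentiable at x" using x by simp
    then show ?thesis by (simp add: dird_def[abs_def] frechet_derivative_works)
  qed
  moreover have "continuous_on (ball 0 R) (foldr dird hs F)" if "length hs \<le> k" for hs
    using flatC_continuous[OF flatC_foldr_dird[OF assms that]] .
  ultimately show ?thesis unfolding tower_def by blast
qed

lemma flatC_imp_Ck_on:
  assumes "flatC R 1 k s (\<lambda>_. F)" "S \<subseteq> ball 0 R"
  shows "Ck_on k S F"
  unfolding Ck_on_def
proof (intro exI[of _ "\<lambda>_ x hs. foldr dird hs F x"] conjI allI impI ballI)
  note T = flatC_tower[OF assms(1)]
  fix j hs
  show "((\<lambda>y. foldr dird hs F y) has_derivative (\<lambda>h. foldr dird (h # hs) F x)) (at x within S)"
    if "j < k" "length hs = j" "x \<in> S" for x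
    using tower_has_derivative[OF T, of hs x] that assms(2) has_derivative_at_withinI by blast
  show "continuous_on S (\<lambda>x. foldr dird hs F x)" if "j \<le> k" "length hs = j"
    using tower_continuous[OF T, of hs] that assms(2) continuous_on_subset by blast
qed simp

section \<open>The functional equation\<close>

lemma infnorm_attained: "\<exists>e\<in>Basis. infnorm (x::'b::euclidean_space) = \<bar>x \<bullet> e\<bar>"
proof -
  have "infnorm x \<in> (\<lambda>i. \<bar>x \<bullet> i\<bar>) ` Basis" unfolding infnorm_Max by (intro Max_in) auto
  then show ?thesis by auto
qed

text \<open>The problem without matrices: \<open>'x\<close> is the space of (N+1)-tuples,
  \<open>\<iota> i\<close> inserts a vector as block i, and \<open>a i\<close> bounds the i-th block
  derivative of \<open>G\<close> in the sup norm on a whole ball around 0, in which the orbits of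
  all iterates will be kept.\<close>

locale functional_equation =
  fixes U :: "'x::euclidean_space set" and G :: "'x list \<Rightarrow> 'x \<Rightarrow> 'b::euclidean_space"
    and \<iota> :: "nat \<Rightarrow> 'b \<Rightarrow> 'x" and lam :: "real^'m" and L :: real and N r :: nat
    and a :: "nat \<Rightarrow> real" and \<delta> :: real
  assumes G: "tower (Suc r) U G" and U: "open U"
    and \<iota>: "\<And>i. linear (\<iota> i)"
    and lam: "\<And>k. \<bar>lam$k\<bar> \<le> L" and L: "L \<le> 1" and r: "r \<ge> 1"
    and \<delta>: "\<delta> > 0" "cball 0 \<delta> \<subseteq> U"
    and a: "\<And>i. a i \<ge> 0" "(\<Sum>i\<le>N. a i * L ^ (i * r)) < 1"
    and Gbound: "\<And>i x y. i \<le> N \<Longrightarrow> x \<in> cball 0 \<delta> \<Longrightarrow> infnorm (G [\<iota> i y] x) \<le> a i * infnorm y"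
begin

abbreviation "K \<equiv> cball (0::'x) \<delta>"

text \<open>The tuple (f z, f (\<Lambda> z), ..., f (\<Lambda>^N z)), written as a sum of block
  insertions so that linearity in \<open>f\<close> is immediate.\<close>

definition orbit :: "(real^'m \<Rightarrow> 'b) \<Rightarrow> real^'m \<Rightarrow> 'x" where
  "orbit f z = (\<Sum>i\<le>N. \<iota> i (f (dil lam i z)))"

definition residual :: "(real^'m \<Rightarrow> 'b) \<Rightarrow> real^'m \<Rightarrow> 'b" where
  "residual p z = G [] (orbit p z) - p z"

lemma L_nonneg: "L \<ge> 0"
  using lam abs_ge_zero order_trans by blast

lemma lam_le_1: "\<bar>lam$k\<bar> \<le> 1"
  using lam L order_trans by blast

lemma bounded_linear_\<iota>: "bounded_linear (\<iota> i)"
  using \<iota> linear_conv_bounded_linear by blast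

lemma orbit_add: "orbit (\<lambda>z. f z + g z) z = orbit f z + orbit g z"
  by (simp add: orbit_def linear_add[OF \<iota>] sum.distrib)

lemma orbit_zero [simp]: "orbit (\<lambda>z. 0) z = 0"
  by (simp add: orbit_def linear_0[OF \<iota>])

lemma flatC_orbit: "flatC R \<kappa> j s f \<Longrightarrow> \<kappa> \<ge> 0 \<Longrightarrow> flatC R \<kappa> j s (\<lambda>n. orbit (f n))"
  unfolding orbit_def[abs_def]
  by (intro flatC_sum flatC_linear[OF bounded_linear_\<iota>] flatC_dil) (auto simp: lam_le_1)

text \<open>\<open>B\<close> does not depend on the radius, so the radius can be chosen in terms of
  \<open>B\<close> afterwards.\<close>

lemma orbit_bound:
  obtains B where "B > 0" "\<And>R c f z. z \<in> ball 0 R \<Longrightarrow> (\<And>y. y \<in> ball 0 R \<Longrightarrow> norm (f y) \<le> c) \<Longrightarrow> norm (orbit f z) \<le> B * c"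
proof -
  have "\<exists>b>0. \<forall>y. norm (\<iota> i y) \<le> b * norm y" for i
    using bounded_linear.pos_bounded[OF bounded_linear_\<iota>[of i]] by (metis mult.commute)
  then obtain b where b: "\<And>i. b i > 0" "\<And>i y. norm (\<iota> i y) \<le> b i * norm y" by metis
  have "norm (orbit f z) \<le> (\<Sum>i\<le>N. b i) * c"
    if z: "z \<in> ball 0 R" and c: "\<And>y. y \<in> ball 0 R \<Longrightarrow> norm (f y) \<le> c" for R c f z
    unfolding orbit_def sum_distrib_right
  proof (rule sum_norm_le)
    fix i
    show "norm (\<iota> i (f (dil lam i z))) \<le> b i * c"
      using b(2)[of i "f (dil lam i z)"] mult_left_mono[OF c[OF dil_ball[OF lam_le_1 z]], of "b i" i] b(1)[of i] by linarith
  qed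
  moreover have "(\<Sum>i\<le>N. b i) > 0" using b(1) by (intro sum_pos) auto
  ultimately show ?thesis using that by blast
qed

text \<open>To keep the constants \<open>a i\<close> free of dimensional factors, the mean value
  theorem is applied along the segment to the one coordinate in which the sup norm of the increment
  is attained.\<close>

lemma G_increment_bound:
  assumes "x \<in> K" "x + (\<Sum>i\<le>N. \<iota> i (y i)) \<in> K"
  shows "infnorm (G [] (x + (\<Sum>i\<le>N. \<iota> i (y i))) - G [] x) \<le> (\<Sum>i\<le>N. a i * infnorm (y i))"
proof -
  let ?h = "\<Sum>i\<le>N. \<iota> i (y i)"
  obtain e where e: "e \<in> Basis" "infnorm (G [] (x + ?h) - G [] x) = \<bar>(G [] (x + ?h) - G [] x) \<bullet> e\<bar>"
    using infnorm_attained by blast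
  have seg: "x + t *\<^sub>R ?h \<in> K" if "0 \<le> t" "t \<le> 1" for t
  proof -
    have "(1 - t) *\<^sub>R x + t *\<^sub>R (x + ?h) \<in> K" using assms that by (intro convexD[OF convex_cball]) auto
    then show ?thesis by (simp add: algebra_simps)
  qed
  have deriv: "((\<lambda>t. G [] (x + t *\<^sub>R ?h) \<bullet> e) has_derivative (\<lambda>s. G [s *\<^sub>R ?h] (x + t *\<^sub>R ?h) \<bullet> e)) (at t within {0..1})"
    if "0 \<le> t" "t \<le> 1" for t
  proof (rule has_derivative_at_withinI, rule has_derivative_inner_left)
    have "((\<lambda>t. x + t *\<^sub>R ?h) has_derivative (\<lambda>s. s *\<^sub>R ?h)) (at t)" by (auto intro!: derivative_eq_intros)
    then show "((\<lambda>t. G [] (x + t *\<^sub>R ?h)) has_derivative (\<lambda>s. G [s *\<^sub>R ?h] (x + t *\<^sub>R ?h))) (at t)"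
      by (rule has_derivative_compose) (use tower_has_derivative[OF G, of "[]"] seg[OF that] \<delta>(2) in auto)
  qed
  obtain t where t: "0 < t" "t < 1" "(G [] (x + ?h) - G [] x) \<bullet> e = G [?h] (x + t *\<^sub>R ?h) \<bullet> e"
    using mvt_simple[of 0 1 "\<lambda>t. G [] (x + t *\<^sub>R ?h) \<bullet> e" "\<lambda>t s. G [s *\<^sub>R ?h] (x + t *\<^sub>R ?h) \<bullet> e", OF _ deriv]
    by (auto simp: inner_diff_left)
  let ?\<xi> = "x + t *\<^sub>R ?h"
  have \<xi>: "?\<xi> \<in> K" using seg t by simp
  have lin: "linear (\<lambda>h. G [h] ?\<xi>)" by (rule tower_linear[OF G]) (use \<xi> \<delta>(2) in auto)
  have "G [?h] ?\<xi> = (\<Sum>i\<le>N. G [\<iota> i (y i)] ?\<xi>)" by (rule linear_sum[OF lin])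
  then have "infnorm (G [?h] ?\<xi>) \<le> (\<Sum>i\<le>N. a i * infnorm (y i))"
    using Gbound[OF _ \<xi>] by (auto intro!: order_trans[OF infnorm_sum_le] sum_mono)
  moreover have "\<bar>G [?h] ?\<xi> \<bullet> e\<bar> \<le> infnorm (G [?h] ?\<xi>)" using Basis_le_infnorm[OF e(1)] .
  ultimately show ?thesis using e(2) t(3) by simp
qed

lemma G_orbit_increment_bound:
  assumes "orbit f z \<in> K" "orbit (\<lambda>z. f z + g z) z \<in> K"
  shows "infnorm (G [] (orbit (\<lambda>z. f z + g z) z) - G [] (orbit f z)) \<le> (\<Sum>i\<le>N. a i * infnorm (g (dil lam i z)))"
  using G_increment_bound[of "orbit f z" "\<lambda>i. g (dil lam i z)"] assms
  unfolding orbit_add orbit_def[of g] by simp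

text \<open>For \<open>w = pdiff k f\<close> this is the k-th partial derivative of \<open>G\<close>
  along the orbit of \<open>f\<close>. Separating \<open>f\<close> from \<open>w\<close> lets the
  coefficients and the argument vary independently.\<close>

definition lin_op :: "(real^'m \<Rightarrow> 'b) \<Rightarrow> 'm \<Rightarrow> (real^'m \<Rightarrow> 'b) \<Rightarrow> real^'m \<Rightarrow> 'b" where
  "lin_op f k w z = (\<Sum>i\<le>N. lam$k ^ i *\<^sub>R (\<Sum>e\<in>Basis. (w (dil lam i z) \<bullet> e) *\<^sub>R G [\<iota> i e] (orbit f z)))"

lemma lin_op_add: "lin_op f k (\<lambda>z. v z + w z) z = lin_op f k v z + lin_op f k w z"
  by (simp add: lin_op_def inner_add_left scaleR_add_left scaleR_add_right sum.distrib)

lemma G_\<iota>_expansion: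
  assumes "x \<in> U"
  shows "G [\<iota> i y] x = (\<Sum>e\<in>Basis. (y \<bullet> e) *\<^sub>R G [\<iota> i e] x)"
proof -
  have "linear (\<lambda>h. G [h] x)" by (rule tower_linear[OF G]) (use assms in auto)
  then have "linear (\<lambda>y. G [\<iota> i y] x)" using linear_compose[OF \<iota>, of "\<lambda>h. G [h] x"] by (simp add: o_def)
  then show ?thesis by (rule linear_Basis_expansion)
qed

text \<open>A dilation maps an axis to a multiple of itself, so only the k-th partial derivative of
  \<open>f\<close> appears and different \<open>k\<close> do not couple.\<close>

lemma G_orbit_deriv:
  assumes f: "\<And>z. z \<in> ball 0 R \<Longrightarrow> f differentiable at z" and z: "z \<in> ball 0 R" and U: "orbit f z \<in> U"
  shows "(\<lambda>z. G [] (orbit f z)) differentiable at z"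
    "pdiff k (\<lambda>z. G [] (orbit f z)) z = lin_op f k (pdiff k f) z"
proof -
  define D where "D h = (\<Sum>i\<le>N. \<iota> i (\<Sum>k\<in>UNIV. (dil lam i h)$k *\<^sub>R pdiff k f (dil lam i z)))" for h
  have "(orbit f has_derivative D) (at z)"
    unfolding orbit_def[abs_def] D_def[abs_def]
  proof (intro has_derivative_sum bounded_linear.has_derivative[OF bounded_linear_\<iota>])
    fix i
    show "((\<lambda>z. f (dil lam i z)) has_derivative (\<lambda>h. \<Sum>k\<in>UNIV. (dil lam i h)$k *\<^sub>R pdiff k f (dil lam i z))) (at z)"
      using has_derivative_compose[OF bounded_linear_imp_has_derivative[OF bounded_linear_dil]
          has_derivative_pdiff[OF f[OF dil_ball[OF lam_le_1 z]]]] .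
  qed
  then have d: "((\<lambda>z. G [] (orbit f z)) has_derivative (\<lambda>h. G [D h] (orbit f z))) (at z)"
    by (rule has_derivative_compose) (use tower_has_derivative[OF G, of "[]"] U in auto)
  then show "(\<lambda>z. G [] (orbit f z)) differentiable at z" by (auto simp: differentiable_def)
  have lin: "linear (\<lambda>h. G [h] (orbit f z))" by (rule tower_linear[OF G]) (use U in auto)
  have "D (axis k 1) = (\<Sum>i\<le>N. \<iota> i (lam$k ^ i *\<^sub>R pdiff k f (dil lam i z)))"
    unfolding D_def dil_axis by (simp add: sum_axis_scaleR flip: scaleR_scaleR scaleR_sum_right)
  then have "G [D (axis k 1)] (orbit f z) = lin_op f k (pdiff k f) z"
    unfolding lin_op_def
    by (simp add: linear_sum[OF lin] linear_cmul[OF \<iota>] linear_cmul[OF lin] G_\<iota>_expansion[OF U, of _ "pdiff k f _"])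
  then show "pdiff k (\<lambda>z. G [] (orbit f z)) z = lin_op f k (pdiff k f) z"
    using pdiff_eq[OF d] by simp
qed

lemma residual_deriv:
  assumes f: "\<And>z. z \<in> ball 0 R \<Longrightarrow> f differentiable at z" and z: "z \<in> ball 0 R" and U: "orbit f z \<in> U"
  shows "residual f differentiable at z" "pdiff k (residual f) z = lin_op f k (pdiff k f) z - pdiff k f z"
  unfolding residual_def[abs_def]
  using G_orbit_deriv[OF assms] f[OF z] by (auto simp: pdiff_diff)

text \<open>The contraction factor is \<open>\<Sum>i\<le>N. a i * L ^ (i * r)\<close> at every level of differentiation: each
  derivative trades one order of flatness for one factor \<open>lam$k\<close>.\<close>

lemma flatC_lin_recursion:
  assumes R: "R \<le> 1" and \<kappa>: "(\<Sum>i\<le>N. a i * L ^ (i * r)) < \<kappa>" "\<kappa> \<le> 1"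
    and P: "flatC R 1 j 0 P" "\<And>n z. z \<in> ball 0 R \<Longrightarrow> orbit (P n) z \<in> K"
    and j: "Suc j \<le> r"
    and F: "flatC R \<kappa> j (r - 1) F" and v0: "flatC R 1 j (r - 1) (\<lambda>_. v 0)"
    and rec: "\<And>n z. z \<in> ball 0 R \<Longrightarrow> v (Suc n) z = lin_op (P n) k (v n) z + F n z"
  shows "flatC R \<kappa> j (r - 1) v"
proof (rule flatC_linear_recursion[OF R lam L a(1) \<kappa>, where m = "\<lambda>i e n z. G [\<iota> i e] (orbit (P n) z)" and c = "lam$k"])
  show "flatC R 1 j 0 (\<lambda>n z. G [\<iota> i e] (orbit (P n) z))" for i e
    using P j by (intro flatC_comp[OF G compact_cball \<delta>(2) R] flatC_orbit) auto
  show "infnorm (\<Sum>e\<in>Basis. (y \<bullet> e) *\<^sub>R G [\<iota> i e] (orbit (P n) z)) \<le> a i * infnorm y"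
    if "i \<le> N" "z \<in> ball 0 R" for n i z y
    using Gbound[OF that(1) P(2)[OF that(2)], of y n]
    unfolding G_\<iota>_expansion[OF subsetD[OF \<delta>(2) P(2)[OF that(2)]], of i y n] .
  show "v (Suc n) z = (\<Sum>i\<le>N. lam$k ^ i *\<^sub>R (\<Sum>e\<in>Basis. (v n (dil lam i z) \<bullet> e) *\<^sub>R G [\<iota> i e] (orbit (P n) z))) + F n z"
    if "z \<in> ball 0 R" for n z using rec[OF that] by (simp add: lin_op_def)
  show "\<bar>lam$k\<bar> \<le> L ^ (r - (r - 1))" using lam r by simp
qed (use F v0 in auto)

text \<open>\<open>flatC_comp_diff\<close> applied to the coefficients of \<open>lin_op\<close>.
  These are already first derivatives of \<open>G\<close> and their increment costs another one,
  hence \<open>Suc j \<le> r\<close> for a tower of height \<open>Suc r\<close>. The orders of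
  \<open>w\<close> and \<open>g\<close> add by \<open>flatC_mult\<close>.\<close>

lemma flatC_lin_op_diff:
  assumes R: "R \<le> 1" and \<kappa>: "0 \<le> \<kappa>" "\<kappa> \<le> 1" and j: "Suc j \<le> r"
    and f: "flatC R 1 j 0 f" "\<And>n z. z \<in> ball 0 R \<Longrightarrow> orbit (f n) z \<in> K"
    and g: "flatC R \<kappa> j s g" "\<And>n z. z \<in> ball 0 R \<Longrightarrow> orbit (\<lambda>z. f n z + g n z) z \<in> K"
    and w: "flatC R 1 j t w"
  shows "flatC R \<kappa> j (t + s) (\<lambda>n z. lin_op (\<lambda>z. f n z + g n z) k (w n) z - lin_op (f n) k (w n) z)"
proof -
  have G_diff: "flatC R \<kappa> j s (\<lambda>n z. G [\<iota> i e] (orbit (f n) z + orbit (g n) z) - G [\<iota> i e] (orbit (f n) z))" for i e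
    using f g j \<kappa> by (intro flatC_comp_diff[OF G compact_cball convex_cball \<delta>(2) R] flatC_orbit) (auto simp: orbit_add)
  have w_dil: "flatC R 1 j t (\<lambda>n z. w n (dil lam i z) \<bullet> e)" for i e
    using w by (intro flatC_inner flatC_dil) (auto simp: lam_le_1)
  have "flatC R \<kappa> j (t + s) (\<lambda>n z. \<Sum>i\<le>N. lam$k ^ i *\<^sub>R (\<Sum>e\<in>Basis. (w n (dil lam i z) \<bullet> e) *\<^sub>R
      (G [\<iota> i e] (orbit (f n) z + orbit (g n) z) - G [\<iota> i e] (orbit (f n) z))))"
    using flatC_mult[OF w_dil G_diff] \<kappa>(1) R by (intro flatC_sum flatC_scaleR) simp_all
  then show ?thesis
    by (simp add: lin_op_def orbit_add sum_subtractf scaleR_diff_right)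
qed

text \<open>Iterates the correction \<open>u\<close> to \<open>p\<close>. First the corrections are
  bounded in C^r uniformly in \<open>n\<close> (\<open>flat_u\<close>), then their differences decay
  geometrically in C^r (\<open>flat_d\<close>), and the sum of the differences is the limit
  correction.\<close>

theorem solution_from_flat_residual:
  assumes R0: "0 < R0" "R0 \<le> 1"
    and p: "flatC R0 1 (Suc r) 1 (\<lambda>_. p)"
    and res: "flatC R0 1 r r (\<lambda>_. residual p)"
  obtains R u where "0 < R" "R \<le> R0" "flatC R 1 r r (\<lambda>_. u)"
    "\<And>z. z \<in> ball 0 R \<Longrightarrow> orbit (\<lambda>z. p z + u z) z \<in> U \<and> residual (\<lambda>z. p z + u z) z = 0"
proof -
  define \<theta> where "\<theta> = (\<Sum>i\<le>N. a i * L ^ (i * r))"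
  \<comment> \<open>Any number strictly between \<theta> and 1 would do: the gap above \<theta>
    absorbs the forcing terms, the gap below 1 makes the series converge.\<close>
  define \<kappa> where "\<kappa> = (1 + \<theta>) / 2"
  have \<theta>: "0 \<le> \<theta>" "\<theta> < 1" using a L_nonneg by (auto simp: \<theta>_def intro!: sum_nonneg)
  have \<kappa>: "\<theta> < \<kappa>" "\<kappa> < 1" "0 \<le> \<kappa>" using \<theta> by (auto simp: \<kappa>_def)
  obtain CE where CE: "CE \<ge> 0" "\<And>z. z \<in> ball 0 R0 \<Longrightarrow> norm (residual p z) \<le> CE * norm z ^ r"
    using flatC_bound[OF res] by (metis (no_types, lifting) mult.right_neutral power_one)
  obtain Cp where Cp: "Cp \<ge> 0" "\<And>z. z \<in> ball 0 R0 \<Longrightarrow> norm (p z) \<le> Cp * norm z ^ 1"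
    using flatC_bound[OF p] by (metis (no_types, lifting) mult.right_neutral power_one)
  obtain B where B: "B > 0" "\<And>R c f z. z \<in> ball 0 R \<Longrightarrow> (\<And>y. y \<in> ball 0 R \<Longrightarrow> norm (f y) \<le> c) \<Longrightarrow> norm (orbit f z) \<le> B * c"
    using orbit_bound by blast
  \<comment> \<open>The fixed point of M = \<theta> M + CE: a correction bounded by M |z|^r is
    mapped to one with the same bound. \<open>C\<close> then bounds \<open>p\<close> plus correction
    by a multiple of |z|, as |z|^r \<le> |z|.\<close>
  define M where "M = CE / (1 - \<theta>)"
  define C where "C = Cp + sqrt DIM('b) * M"
  have M: "M \<ge> 0" "\<theta> * M + CE = M" using CE(1) \<theta> by (auto simp: M_def field_simps)
  have C: "C \<ge> 0" using Cp(1) M(1) by (simp add: C_def)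
  \<comment> \<open>Small enough that every function bounded by \<open>C * R\<close> on the ball has
    its orbit in \<open>K\<close>; the added 1 avoids a zero denominator.\<close>
  define R where "R = min R0 (\<delta> / (B * (C + 1)))"
  have R: "0 < R" "R \<le> R0" "R \<le> 1" using R0 \<delta>(1) B(1) C by (auto simp: R_def)
  have BCR: "B * (C * R) \<le> \<delta>"
  proof -
    have "B * (C * R) \<le> B * ((C + 1) * (\<delta> / (B * (C + 1))))"
      using B(1) C R(1) by (intro mult_left_mono mult_mono) (auto simp: R_def)
    then show ?thesis using B(1) C by simp
  qed
  have inR0: "z \<in> ball 0 R0" if "z \<in> ball 0 R" for z :: "real^'m" using that R(2) by auto
  have orbit_K: "orbit (\<lambda>z. p z + w z) z \<in> K"
    if w: "\<And>z. z \<in> ball 0 R \<Longrightarrow> infnorm (w z) \<le> M * norm z ^ r" and z: "z \<in> ball 0 R" for w z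
  proof -
    have "norm (p y + w y) \<le> C * R" if y: "y \<in> ball 0 R" for y
    proof -
      have y1: "norm y \<le> R" "norm y ^ r \<le> norm y"
        using y R(3) r power_decreasing[of 1 r "norm y"] by auto
      have "norm (w y) \<le> sqrt DIM('b) * infnorm (w y)" by (rule norm_le_infnorm)
      also have "\<dots> \<le> sqrt DIM('b) * (M * norm y ^ r)" using w[OF y] by (intro mult_left_mono) auto
      also have "\<dots> \<le> sqrt DIM('b) * (M * norm y)" using y1 M(1) by (intro mult_left_mono) auto
      finally have "norm (p y + w y) \<le> C * norm y"
        using Cp(2)[OF inR0[OF y]] norm_triangle_ineq[of "p y" "w y"] by (simp add: C_def algebra_simps)
      also have "\<dots> \<le> C * R" using y1 C by (intro mult_left_mono)
      finally show ?thesis .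
    qed
    then have "norm (orbit (\<lambda>z. p z + w z) z) \<le> B * (C * R)" by (rule B(2)[OF z])
    then show ?thesis using BCR by simp
  qed
  define u where "u n = rec_nat (\<lambda>z. 0) (\<lambda>_ w z. G [] (orbit (\<lambda>z. p z + w z) z) - p z) n" for n
  have u0: "u 0 = (\<lambda>z. 0)" and uS: "u (Suc n) = (\<lambda>z. G [] (orbit (\<lambda>z. p z + u n z) z) - p z)" for n
    by (simp_all add: u_def)
  define P where "P n z = p z + u n z" for n z
  have orbit_p: "orbit p z \<in> K" if "z \<in> ball 0 R" for z
    using orbit_K[of "\<lambda>_. 0" z] that M(1) by (simp add: infnorm_0)
  \<comment> \<open>Rate 1 with the residual of \<open>p\<close> as constant forcing. The bound at
    stage \<open>n\<close> puts the orbit of p + u n into \<open>K\<close>, which is what licenses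
    the increment bound for stage n + 1.\<close>
  have infu: "infnorm (u n z) \<le> M * norm z ^ r" if "z \<in> ball 0 R" for n z
  proof -
    have "infnorm (u n z) \<le> M * 1 ^ n * norm z ^ r"
    proof (rule weighted_contraction_bound[where b = a and N = N and K = CE and R = R and g = "\<lambda>n z. infnorm (u n z)"])
      fix n and z :: "real^'m" assume IH: "\<And>y. y \<in> ball 0 R \<Longrightarrow> infnorm (u n y) \<le> M * 1 ^ n * norm y ^ r" and z: "z \<in> ball 0 R"
      have uE: "u (Suc n) z = (G [] (orbit (\<lambda>z. p z + u n z) z) - G [] (orbit p z)) + residual p z"
        by (simp add: uS residual_def)
      have "infnorm (residual p z) \<le> CE * 1 ^ n * norm z ^ r"
        using CE(2)[OF inR0[OF z]] infnorm_le_norm[of "residual p z"] by simp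
      moreover have "infnorm (G [] (orbit (\<lambda>z. p z + u n z) z) - G [] (orbit p z)) \<le> (\<Sum>i\<le>N. a i * infnorm (u n (dil lam i z)))"
        using IH by (intro G_orbit_increment_bound orbit_p orbit_K z) simp
      ultimately show "infnorm (u (Suc n) z) \<le> (\<Sum>i\<le>N. a i * infnorm (u n (dil lam i z))) + CE * 1 ^ n * norm z ^ r"
        unfolding uE
        using infnorm_triangle[of "G [] (orbit (\<lambda>z. p z + u n z) z) - G [] (orbit p z)" "residual p z"] by linarith
    next
      show "(\<Sum>i\<le>N. a i * L ^ (i * r)) * M + CE \<le> M * 1" using M(2) by (simp add: \<theta>_def)
    qed (use M(1) a lam L that in \<open>auto simp: u0 infnorm_0\<close>)
    then show ?thesis by simp
  qed
  have orbit_P: "orbit (P n) z \<in> K" if "z \<in> ball 0 R" for n z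
    unfolding P_def[abs_def] using orbit_K[OF infu that] .
  have orbit_P': "orbit (P n) z \<in> U" if "z \<in> ball 0 R" for n z
    using orbit_P[OF that] \<delta>(2) by blast
  have pR: "flatC R 1 (Suc r) 1 (\<lambda>_. p)" by (rule flatC_mono_radius[OF p R(2)])
  have pdp: "flatC R 1 r 0 (\<lambda>_. pdiff k p)" for k using flatC_pdiff[OF pR, of k] by simp
  have p0: "flatC R 1 j 0 (\<lambda>_. p)" if "j \<le> Suc r" for j
    by (rule flatC_mono_order[OF flatC_mono_level[OF pR that]]) (use R in auto)
  have pd: "p differentiable at z" if "z \<in> ball 0 R" for z by (rule flatC_differentiable[OF pR that])
  have resR: "flatC R 1 r r (\<lambda>_. residual p)" by (rule flatC_mono_radius[OF res R(2)])
  have ud: "u n differentiable at z" if "z \<in> ball 0 R" for n z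
    using that
  proof (induction n arbitrary: z)
    case (Suc n)
    have "P n differentiable at z" if "z \<in> ball 0 R" for z
      unfolding P_def[abs_def] using pd[OF that] Suc.IH[OF that] by simp
    then have "(\<lambda>z. G [] (orbit (P n) z)) differentiable at z"
      by (rule G_orbit_deriv(1)[OF _ Suc.prems orbit_P'[OF Suc.prems]])
    then show ?case using pd[OF Suc.prems] by (simp add: uS P_def[abs_def])
  qed (simp add: u0)
  have Pd: "P n differentiable at z" if "z \<in> ball 0 R" for n z
    unfolding P_def[abs_def] using pd[OF that] ud[OF that] by simp
  have pdu: "pdiff k (u (Suc n)) z = lin_op (P n) k (pdiff k (P n)) z - pdiff k p z" if z: "z \<in> ball 0 R" for n k z
    unfolding uS using pdiff_diff[OF G_orbit_deriv(1)[OF Pd z orbit_P'[OF z]] pd[OF z]]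
      G_orbit_deriv(2)[OF Pd z orbit_P'[OF z]] by (simp add: P_def[abs_def])
  have pdP: "pdiff k (P n) z = pdiff k p z + pdiff k (u n) z" if "z \<in> ball 0 R" for n k z
    unfolding P_def[abs_def] using pd[OF that] ud[OF that] by (rule pdiff_add)
  have lin_op_cong: "lin_op f k w z = lin_op f k w' z"
    if "\<And>z. z \<in> ball 0 R \<Longrightarrow> w z = w' z" "z \<in> ball 0 R" for f k w w' z
    unfolding lin_op_def using that(1)[OF dil_ball[OF lam_le_1 that(2)]] by simp
  have flat_P: "flatC R 1 j 0 P" if "flatC R 1 j r u" "j \<le> r" for j
    unfolding P_def[abs_def] by (rule flatC_add[OF p0 flatC_mono_order[OF that(1)]]) (use R that in auto)
  have flat_u: "flatC R 1 j r u" if "j \<le> r" for j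
    using that
  proof (induction j)
    case 0
    have "norm (u n z) \<le> (sqrt DIM('b) * M) * 1 ^ n * norm z ^ r" if "z \<in> ball 0 R" for n z
      by (rule norm_le_of_infnorm_le) (use infu[OF that, of n] in simp)
    moreover have "continuous_on (ball 0 R) (u n)" for n
      using ud differentiable_imp_continuous_within by (intro continuous_at_imp_continuous_on) blast
    moreover have "sqrt DIM('b) * M \<ge> 0" using M(1) by simp
    ultimately show ?case unfolding flatC.simps flat0_def by blast
  next
    case (Suc j)
    then have IH: "flatC R 1 j r u" by simp
    have "flatC R 1 j (r - 1) (\<lambda>n. pdiff k (u n))" for k
    proof (rule flatC_lin_recursion[OF R(3), where P = P])
      \<comment> \<open>Adding and subtracting \<open>lin_op p k (pdiff k p)\<close> turns what does
        not involve \<open>pdiff k (u n)\<close> into an increment of coefficients across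
        \<open>u n\<close> plus a derivative of the residual, and both are flat of order r -
        1.\<close>
      let ?F = "\<lambda>n z. (lin_op (P n) k (pdiff k p) z - lin_op p k (pdiff k p) z) + pdiff k (residual p) z"
      show "flatC R 1 j (r - 1) ?F"
      proof (rule flatC_add)
        have "flatC R 1 j (0 + r) (\<lambda>n z. lin_op (\<lambda>z. p z + u n z) k (pdiff k p) z - lin_op p k (pdiff k p) z)"
          using Suc.prems orbit_P p0[of j] orbit_p IH flatC_mono_level[OF pdp]
          by (intro flatC_lin_op_diff[OF R(3)]) (auto simp: P_def[abs_def])
        then show "flatC R 1 j (r - 1) (\<lambda>n z. lin_op (P n) k (pdiff k p) z - lin_op p k (pdiff k p) z)"
          unfolding P_def[abs_def] by (rule flatC_mono_order) (use R in auto)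
        have "flatC R 1 (Suc j) r (\<lambda>_. residual p)" by (rule flatC_mono_level[OF resR Suc.prems])
        then show "flatC R 1 j (r - 1) (\<lambda>_. pdiff k (residual p))" by (rule flatC_pdiff)
      qed
      show "flatC R 1 j (r - 1) (\<lambda>_. pdiff k (u 0))"
      proof -
        have "pdiff k (u 0) = (\<lambda>z. 0)" by (rule ext) (simp add: u0 pdiff_eq[OF has_derivative_const])
        then show ?thesis by (simp add: flatC_zero)
      qed
      show "pdiff k (u (Suc n)) z = lin_op (P n) k (pdiff k (u n)) z + ?F n z" if z: "z \<in> ball 0 R" for n z
      proof -
        have "lin_op (P n) k (pdiff k (P n)) z = lin_op (P n) k (\<lambda>z. pdiff k p z + pdiff k (u n) z) z"
          by (rule lin_op_cong[OF pdP z])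
        moreover have "pdiff k (residual p) z = lin_op p k (pdiff k p) z - pdiff k p z"
          by (rule residual_deriv(2)[OF pd z]) (use orbit_p[OF z] \<delta>(2) in auto)
        ultimately show ?thesis unfolding pdu[OF z] by (simp add: lin_op_add)
      qed
      show "flatC R 1 j 0 P" using flat_P[OF IH] Suc.prems by simp
    qed (use orbit_P Suc.prems \<theta> in \<open>auto simp: \<theta>_def\<close>)
    then show ?case using flatC_imp_flat0[OF IH] ud by simp
  qed
  define d where "d n z = u (Suc n) z - u n z" for n z
  have Pd_eq: "P (Suc n) = (\<lambda>z. P n z + d n z)" for n by (simp add: P_def d_def fun_eq_iff)
  have d_Suc: "d (Suc n) z = G [] (orbit (P (Suc n)) z) - G [] (orbit (P n) z)" for n z
    by (simp add: d_def uS P_def[abs_def])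
  have dd: "d n differentiable at z" if "z \<in> ball 0 R" for n z
    unfolding d_def[abs_def] using ud[OF that] by simp
  have d0: "d 0 = residual p" by (simp add: d_def uS u0 residual_def fun_eq_iff)
  have flat_d: "flatC R \<kappa> j r d" if "j \<le> r" for j
    using that
  proof (induction j)
    case 0
    \<comment> \<open>The differences obey the increment bound without forcing and start from the
      residual of \<open>p\<close>, so \<open>CE\<close> itself serves as the constant.\<close>
    have "infnorm (d n z) \<le> CE * \<kappa> ^ n * norm z ^ r" if "z \<in> ball 0 R" for n z
    proof (rule weighted_contraction_bound[where b = a and N = N and K = 0 and R = R and g = "\<lambda>n z. infnorm (d n z)"])
      show "infnorm (d (Suc n) z) \<le> (\<Sum>i\<le>N. a i * infnorm (d n (dil lam i z))) + 0 * \<kappa> ^ n * norm z ^ r"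
        if "z \<in> ball 0 R" for n z
        using G_orbit_increment_bound[of "P n" z "d n"] orbit_P[OF that, of n] orbit_P[OF that, of "Suc n"]
        unfolding d_Suc Pd_eq by simp
      show "infnorm (d 0 z) \<le> CE * norm z ^ r" if "z \<in> ball 0 R" for z
        unfolding d0 using CE(2)[OF inR0[OF that]] infnorm_le_norm order_trans by blast
      have "\<theta> * CE \<le> CE * \<kappa>" using CE(1) \<kappa>(1) by (simp add: mult.commute mult_left_mono)
      then show "(\<Sum>i\<le>N. a i * L ^ (i * r)) * CE + 0 \<le> CE * \<kappa>" by (simp add: \<theta>_def)
    qed (use CE(1) a lam L \<kappa> that in auto)
    then have "norm (d n z) \<le> (sqrt DIM('b) * CE) * \<kappa> ^ n * norm z ^ r" if "z \<in> ball 0 R" for n z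
      using that norm_le_of_infnorm_le by blast
    moreover have "continuous_on (ball 0 R) (d n)" for n
      using dd differentiable_imp_continuous_within by (intro continuous_at_imp_continuous_on) blast
    moreover have "sqrt DIM('b) * CE \<ge> 0" using CE(1) by simp
    ultimately show ?case unfolding flatC.simps flat0_def by blast
  next
    case (Suc j)
    then have IH: "flatC R \<kappa> j r d" by simp
    have PSj: "flatC R 1 (Suc j) 0 P" by (rule flat_P[OF flat_u[OF Suc.prems] Suc.prems])
    then have Pj: "flatC R 1 j 0 P" by (rule flatC_Suc_imp)
    have "flatC R \<kappa> j (r - 1) (\<lambda>n. pdiff k (d n))" for k
    proof (rule flatC_lin_recursion[OF R(3), where P = "\<lambda>n. P (Suc n)"])
      \<comment> \<open>The coefficients of the newer iterate act on \<open>pdiff k (d n)\<close>;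
        what is left is their increment across \<open>d n\<close>, of rate \<kappa> by the induction
        hypothesis, applied to \<open>pdiff k (P n)\<close>, which the first pass has bounded
        uniformly.\<close>
      let ?F = "\<lambda>n z. lin_op (P (Suc n)) k (pdiff k (P n)) z - lin_op (P n) k (pdiff k (P n)) z"
      have "flatC R \<kappa> j (0 + r) (\<lambda>n z. lin_op (\<lambda>z. P n z + d n z) k (pdiff k (P n)) z - lin_op (P n) k (pdiff k (P n)) z)"
      proof (rule flatC_lin_op_diff[OF R(3) _ _ Suc.prems Pj orbit_P IH])
        show "orbit (\<lambda>z. P n z + d n z) z \<in> K" if "z \<in> ball 0 R" for n z
          using orbit_P[OF that, of "Suc n"] unfolding Pd_eq .
        show "flatC R 1 j 0 (\<lambda>n. pdiff k (P n))" using flatC_pdiff[OF PSj, of k] by simp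
      qed (use \<kappa> in auto)
      then show "flatC R \<kappa> j (r - 1) ?F"
        unfolding Pd_eq by (rule flatC_mono_order) (use R \<kappa> in auto)
      have "flatC R 1 (Suc j) r (\<lambda>_. residual p)" by (rule flatC_mono_level[OF resR Suc.prems])
      then show "flatC R 1 j (r - 1) (\<lambda>_. pdiff k (d 0))" unfolding d0 by (rule flatC_pdiff)
      show "pdiff k (d (Suc n)) z = lin_op (P (Suc n)) k (pdiff k (d n)) z + ?F n z" if z: "z \<in> ball 0 R" for n z
      proof -
        have "pdiff k (d (Suc n)) z = pdiff k (u (Suc (Suc n))) z - pdiff k (u (Suc n)) z"
          unfolding d_def[abs_def] by (rule pdiff_diff[OF ud[OF z] ud[OF z]])
        moreover have "lin_op (P (Suc n)) k (pdiff k (P (Suc n))) z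
            = lin_op (P (Suc n)) k (\<lambda>z. pdiff k (P n) z + pdiff k (d n) z) z"
          unfolding Pd_eq by (rule lin_op_cong[OF pdiff_add[OF Pd dd] z])
        ultimately show ?thesis unfolding pdu[OF z] by (simp add: lin_op_add)
      qed
      have "flatC R 1 j 0 (\<lambda>n z. P n z + d n z)"
        by (rule flatC_add[OF Pj flatC_mono_order[OF flatC_mono_rate[OF IH]]]) (use \<kappa> R in auto)
      then show "flatC R 1 j 0 (\<lambda>n. P (Suc n))" unfolding Pd_eq .
    qed (use orbit_P Suc.prems \<kappa> in \<open>auto simp: \<theta>_def\<close>)
    then show ?case using flatC_imp_flat0[OF IH] dd by simp
  qed
  define w where "w z = (\<Sum>n. d n z)" for z
  have flat_w: "flatC R 1 r r (\<lambda>_. w)"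
    unfolding w_def[abs_def] by (rule flatC_suminf[OF \<kappa>(3,2) R(3) flat_d]) simp
  have u_lim: "(\<lambda>n. u n z) \<longlonglongrightarrow> w z" if "z \<in> ball 0 R" for z
  proof -
    obtain D where D: "D \<ge> 0" "\<And>n z. z \<in> ball 0 R \<Longrightarrow> norm (d n z) \<le> D * \<kappa> ^ n * norm z ^ r"
      using flatC_bound[OF flat_d[of 0]] by blast
    have "summable (\<lambda>n. d n z)"
    proof (rule geometric_tail(1))
      show "norm (d n z) \<le> (D * norm z ^ r) * \<kappa> ^ n" for n using D(2)[OF that, of n] by (simp add: mult_ac)
    qed (use \<kappa> in auto)
    then have "(\<lambda>n. \<Sum>i<n. d i z) \<longlonglongrightarrow> w z" unfolding w_def by (rule summable_LIMSEQ)
    moreover have "(\<Sum>i<n. d i z) = u n z" for n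
      unfolding d_def using sum_lessThan_telescope[of "\<lambda>n. u n z" n] by (simp add: u0)
    ultimately show ?thesis by simp
  qed
  have "orbit (\<lambda>z. p z + w z) z \<in> U \<and> residual (\<lambda>z. p z + w z) z = 0" if z: "z \<in> ball 0 R" for z
  proof -
    let ?x = "orbit (\<lambda>z. p z + w z) z"
    have lim: "(\<lambda>n. orbit (P n) z) \<longlonglongrightarrow> ?x"
      unfolding orbit_def P_def
      by (intro tendsto_sum bounded_linear.tendsto[OF bounded_linear_\<iota>] tendsto_add tendsto_const
          u_lim dil_ball[OF lam_le_1 z])
    have "?x \<in> K"
      by (rule closed_sequentially[OF closed_cball _ lim]) (use orbit_P[OF z] in blast)
    then have xU: "?x \<in> U" using \<delta>(2) by blast
    have "isCont (G []) ?x"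
      using has_derivative_continuous[OF tower_has_derivative[OF G _ xU, of "[]"]] by simp
    then have "(\<lambda>n. G [] (orbit (P n) z) - p z) \<longlonglongrightarrow> G [] ?x - p z"
      by (intro tendsto_diff tendsto_const isCont_tendsto_compose[OF _ lim])
    moreover have "(\<lambda>n. u (Suc n) z) \<longlonglongrightarrow> w z" using u_lim[OF z] by (rule LIMSEQ_Suc)
    ultimately have "G [] ?x - p z = w z"
      unfolding uS P_def[abs_def] by (rule LIMSEQ_unique)
    then show ?thesis using xU by (simp add: residual_def algebra_simps)
  qed
  then show ?thesis using that R flat_w by blast
qed

end

section \<open>Symmetry of derivatives and Taylor expansion\<close>

text \<open>Two mean value theorems, first along \<open>u\<close> for the difference across
  \<open>v\<close>, then along \<open>v\<close>. Pairing with \<open>e\<close> makes the functions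
  real-valued, where the theorem is an equality.\<close>

lemma second_difference_mvt:
  fixes D :: "'x::euclidean_space list \<Rightarrow> 'x \<Rightarrow> 'b::euclidean_space"
  assumes D: "tower 2 U D" and t: "t > 0"
    and U: "\<And>a b. 0 \<le> a \<Longrightarrow> a \<le> t \<Longrightarrow> 0 \<le> b \<Longrightarrow> b \<le> t \<Longrightarrow> x + a *\<^sub>R u + b *\<^sub>R v \<in> U"
  obtains a b where "0 \<le> a" "a \<le> t" "0 \<le> b" "b \<le> t"
    "(D [] (x + t *\<^sub>R u + t *\<^sub>R v) - D [] (x + t *\<^sub>R u) - D [] (x + t *\<^sub>R v) + D [] x) \<bullet> e
       = t\<^sup>2 * (D [v, u] (x + a *\<^sub>R u + b *\<^sub>R v) \<bullet> e)"
proof -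
  let ?y = "\<lambda>a b. x + a *\<^sub>R u + b *\<^sub>R v"
  have d1: "((\<lambda>a. D [] (?y a b) \<bullet> e) has_derivative (\<lambda>s. D [s *\<^sub>R u] (?y a b) \<bullet> e)) (at a within {0..t})"
    if "0 \<le> a" "a \<le> t" "0 \<le> b" "b \<le> t" for a b
  proof (rule has_derivative_at_withinI, rule has_derivative_inner_left)
    have "((\<lambda>a. ?y a b) has_derivative (\<lambda>s. s *\<^sub>R u)) (at a)" by (auto intro!: derivative_eq_intros)
    then show "((\<lambda>a. D [] (?y a b)) has_derivative (\<lambda>s. D [s *\<^sub>R u] (?y a b))) (at a)"
      by (rule has_derivative_compose) (use tower_has_derivative[OF D, of "[]"] U[OF that] in auto)
  qed
  have d2: "((\<lambda>b. D [u] (?y a b) \<bullet> e) has_derivative (\<lambda>s. D [s *\<^sub>R v, u] (?y a b) \<bullet> e)) (at b within {0..t})"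
    if "0 \<le> a" "a \<le> t" "0 \<le> b" "b \<le> t" for a b
  proof (rule has_derivative_at_withinI, rule has_derivative_inner_left)
    have "((\<lambda>b. ?y a b) has_derivative (\<lambda>s. s *\<^sub>R v)) (at b)" by (auto intro!: derivative_eq_intros)
    then show "((\<lambda>b. D [u] (?y a b)) has_derivative (\<lambda>s. D [s *\<^sub>R v, u] (?y a b))) (at b)"
      by (rule has_derivative_compose) (use tower_has_derivative[OF D, of "[u]"] U[OF that] in auto)
  qed
  have tt: "0 \<le> t" "t \<le> t" "0 \<le> (0::real)" using t by auto
  obtain a where a: "0 \<le> a" "a \<le> t" "(D [] (?y t t) \<bullet> e - D [] (?y t 0) \<bullet> e) - (D [] (?y 0 t) \<bullet> e - D [] (?y 0 0) \<bullet> e)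
      = D [(t - 0) *\<^sub>R u] (?y a t) \<bullet> e - D [(t - 0) *\<^sub>R u] (?y a 0) \<bullet> e"
    using mvt_very_simple[of 0 t "\<lambda>a. D [] (?y a t) \<bullet> e - D [] (?y a 0) \<bullet> e"
        "\<lambda>a s. D [s *\<^sub>R u] (?y a t) \<bullet> e - D [s *\<^sub>R u] (?y a 0) \<bullet> e", OF tt(1) has_derivative_diff[OF d1 d1]] tt
    by auto
  obtain b where b: "0 \<le> b" "b \<le> t" "D [u] (?y a t) \<bullet> e - D [u] (?y a 0) \<bullet> e = D [(t - 0) *\<^sub>R v, u] (?y a b) \<bullet> e"
    using mvt_very_simple[of 0 t "\<lambda>b. D [u] (?y a b) \<bullet> e" "\<lambda>b s. D [s *\<^sub>R v, u] (?y a b) \<bullet> e", OF tt(1) d2[OF a(1,2)]]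
    by auto
  have "D [t *\<^sub>R u] y = t *\<^sub>R D [u] y" if "y \<in> U" for y
    by (rule linear_cmul[OF tower_linear[OF D]]) (use that in auto)
  moreover have "D [t *\<^sub>R v, u] y = t *\<^sub>R D [v, u] y" if "y \<in> U" for y
    by (rule linear_cmul[OF tower_linear[OF D]]) (use that in auto)
  ultimately have "(D [] (?y t t) \<bullet> e - D [] (?y t 0) \<bullet> e) - (D [] (?y 0 t) \<bullet> e - D [] (?y 0 0) \<bullet> e) = t * (t * (D [v, u] (?y a b) \<bullet> e))"
    using a b U[OF a(1,2) tt(1,2)] U[OF a(1,2) tt(3,1)] U[OF a(1,2) b(1,2)]
    by (simp flip: right_diff_distrib inner_diff_left)
  then show ?thesis using that[OF a(1,2) b(1,2)]
    by (simp add: inner_diff_left inner_add_left power2_eq_square mult.assoc)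
qed

text \<open>The second difference is symmetric in \<open>u\<close> and \<open>v\<close>. It equals
  t^2 times \<open>D [v, u]\<close> at one nearby point and t^2 times \<open>D [u, v]\<close> at
  another; division by t^2 and continuity give equality in the limit.\<close>

lemma tower_symmetric:
  fixes D :: "'x::euclidean_space list \<Rightarrow> 'x \<Rightarrow> 'b::euclidean_space"
  assumes D: "tower 2 U D" and U: "open U" and x: "x \<in> U"
  shows "D [u, v] x = D [v, u] x"
proof -
  obtain \<epsilon> where \<epsilon>: "\<epsilon> > 0" "ball x \<epsilon> \<subseteq> U" using U x open_contains_ball by blast
  \<comment> \<open>Chosen so that the parallelogram with sides \<open>c *\<^sub>R u\<close> and
    \<open>c *\<^sub>R v\<close> at \<open>x\<close> stays in the ball.\<close>
  define c where "c = \<epsilon> / (norm u + norm v + 1)"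
  have c: "c > 0" "c * (norm u + norm v) < \<epsilon>"
    using \<epsilon>(1) by (auto simp: c_def field_simps add_pos_nonneg)
  define t where "t n = c / real (Suc n)" for n
  have t: "t n > 0" "t n \<le> c" for n using c(1) by (auto simp: t_def field_simps)
  have t_lim: "t \<longlonglongrightarrow> 0" unfolding t_def[abs_def]
    using tendsto_mult_left[OF LIMSEQ_inverse_real_of_nat, of c] by (simp add: divide_inverse)
  have dist: "norm (a *\<^sub>R u + b *\<^sub>R v) \<le> t n * (norm u + norm v)"
    if "0 \<le> a" "a \<le> t n" "0 \<le> b" "b \<le> t n" for a b n u and v :: 'x
    using that norm_triangle_ineq[of "a *\<^sub>R u" "b *\<^sub>R v"] mult_right_mono[of a "t n" "norm u"] mult_right_mono[of b "t n" "norm v"]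
    by (simp add: algebra_simps)
  have inU: "x + a *\<^sub>R u + b *\<^sub>R v \<in> U" if "0 \<le> a" "a \<le> t n" "0 \<le> b" "b \<le> t n" for a b n
  proof -
    have "t n * (norm u + norm v) \<le> c * (norm u + norm v)" using t by (intro mult_right_mono) auto
    then have "norm (a *\<^sub>R u + b *\<^sub>R v) < \<epsilon>" using dist[OF that, of u v] c(2) by linarith
    then have "x + (a *\<^sub>R u + b *\<^sub>R v) \<in> ball x \<epsilon>"
      unfolding mem_ball dist_norm by (subst norm_minus_commute) simp
    then show ?thesis using \<epsilon>(2) by (auto simp: add.assoc)
  qed
  have inU': "x + a *\<^sub>R v + b *\<^sub>R u \<in> U" if "0 \<le> a" "a \<le> t n" "0 \<le> b" "b \<le> t n" for a b n
    using inU[OF that(3,4,1,2)] by (simp add: algebra_simps)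
  have lim: "(\<lambda>n. D [v, u] (x + a n *\<^sub>R u + b n *\<^sub>R v)) \<longlonglongrightarrow> D [v, u] x"
    if ab: "\<And>n. 0 \<le> a n \<and> a n \<le> t n \<and> 0 \<le> b n \<and> b n \<le> t n" for a b u v
  proof -
    have "continuous_on U (D [v, u])" by (rule tower_continuous[OF D]) simp
    then have cont: "isCont (D [v, u]) x" using U x continuous_on_interior interior_open by metis
    have lim0: "(\<lambda>n. a n *\<^sub>R u + b n *\<^sub>R v) \<longlonglongrightarrow> 0"
    proof (rule tendsto_0_le)
      show "(\<lambda>n. t n * (norm u + norm v)) \<longlonglongrightarrow> 0" using tendsto_mult_left_zero[OF t_lim] .
      show "\<forall>\<^sub>F n in sequentially. norm (a n *\<^sub>R u + b n *\<^sub>R v) \<le> norm (t n * (norm u + norm v)) * 1"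
      proof (intro always_eventually allI)
        fix n
        have "norm (a n *\<^sub>R u + b n *\<^sub>R v) \<le> t n * (norm u + norm v)" using ab dist by blast
        also have "\<dots> \<le> norm (t n * (norm u + norm v)) * 1" by simp
        finally show "norm (a n *\<^sub>R u + b n *\<^sub>R v) \<le> norm (t n * (norm u + norm v)) * 1" .
      qed
    qed
    have "(\<lambda>n. x + (a n *\<^sub>R u + b n *\<^sub>R v)) \<longlonglongrightarrow> x + 0"
      by (intro tendsto_add tendsto_const lim0)
    then have "(\<lambda>n. x + a n *\<^sub>R u + b n *\<^sub>R v) \<longlonglongrightarrow> x" by (simp add: add.assoc)
    then show ?thesis by (rule isCont_tendsto_compose[OF cont])
  qed
  show ?thesis
  proof (rule euclidean_eqI)
    fix e :: 'b
    let ?\<Delta> = "\<lambda>t. (D [] (x + t *\<^sub>R u + t *\<^sub>R v) - D [] (x + t *\<^sub>R u) - D [] (x + t *\<^sub>R v) + D [] x) \<bullet> e"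
    have "\<exists>a b. (0 \<le> a \<and> a \<le> t n \<and> 0 \<le> b \<and> b \<le> t n) \<and> ?\<Delta> (t n) = (t n)\<^sup>2 * (D [v, u] (x + a *\<^sub>R u + b *\<^sub>R v) \<bullet> e)" for n
      by (rule second_difference_mvt[OF D t(1)[of n] inU[where n = n], where e = e]) blast+
    then obtain a b where ab: "\<And>n. 0 \<le> a n \<and> a n \<le> t n \<and> 0 \<le> b n \<and> b n \<le> t n"
      "\<And>n. ?\<Delta> (t n) = (t n)\<^sup>2 * (D [v, u] (x + a n *\<^sub>R u + b n *\<^sub>R v) \<bullet> e)" by metis
    have sym: "?\<Delta> t = (D [] (x + t *\<^sub>R v + t *\<^sub>R u) - D [] (x + t *\<^sub>R v) - D [] (x + t *\<^sub>R u) + D [] x) \<bullet> e" for t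
      by (simp add: algebra_simps)
    have "\<exists>a b. (0 \<le> a \<and> a \<le> t n \<and> 0 \<le> b \<and> b \<le> t n) \<and> ?\<Delta> (t n) = (t n)\<^sup>2 * (D [u, v] (x + a *\<^sub>R v + b *\<^sub>R u) \<bullet> e)" for n
      unfolding sym by (rule second_difference_mvt[OF D t(1)[of n] inU'[where n = n], where e = e]) blast+
    then obtain a' b' where ab': "\<And>n. 0 \<le> a' n \<and> a' n \<le> t n \<and> 0 \<le> b' n \<and> b' n \<le> t n"
      "\<And>n. ?\<Delta> (t n) = (t n)\<^sup>2 * (D [u, v] (x + a' n *\<^sub>R v + b' n *\<^sub>R u) \<bullet> e)" by metis
    have "D [v, u] (x + a n *\<^sub>R u + b n *\<^sub>R v) \<bullet> e = D [u, v] (x + a' n *\<^sub>R v + b' n *\<^sub>R u) \<bullet> e" for n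
    proof -
      have "(t n)\<^sup>2 \<noteq> 0" using t(1)[of n] by simp
      then show ?thesis using ab(2)[of n] ab'(2)[of n] by (metis mult_left_cancel)
    qed
    then have "(\<lambda>n. D [v, u] (x + a n *\<^sub>R u + b n *\<^sub>R v) \<bullet> e) \<longlonglongrightarrow> D [u, v] x \<bullet> e"
      using tendsto_inner[OF lim[OF ab'(1)] tendsto_const[of e]] by simp
    moreover have "(\<lambda>n. D [v, u] (x + a n *\<^sub>R u + b n *\<^sub>R v) \<bullet> e) \<longlonglongrightarrow> D [v, u] x \<bullet> e"
      by (intro tendsto_inner lim ab(1) tendsto_const)
    ultimately show "D [u, v] x \<bullet> e = D [v, u] x \<bullet> e" by (rule LIMSEQ_unique)
  qed
qed

lemma pdiff_swap:
  fixes F :: "real^'m \<Rightarrow> 'b::euclidean_space"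
  assumes "flatC R 1 2 s (\<lambda>_. F)" "z \<in> ball 0 R"
  shows "pdiff j (pdiff k F) z = pdiff k (pdiff j F) z"
  using tower_symmetric[OF flatC_tower[OF assms(1)] open_ball assms(2), of "axis j 1" "axis k 1"]
  by (simp add: dird_def[abs_def] pdiff_def[abs_def])

section \<open>Iterated partial derivatives, homogeneous polynomials and Taylor expansion\<close>

lemma fold_pdiff_cong:
  assumes "\<And>z. z \<in> ball 0 R \<Longrightarrow> f z = g z" "z \<in> ball 0 R"
  shows "fold pdiff ks f z = fold pdiff ks g z"
  using assms(1)
proof (induction ks arbitrary: f g)
  case (Cons k ks)
  have "fold pdiff ks (pdiff k f) z = fold pdiff ks (pdiff k g) z"
    by (rule Cons.IH) (rule pdiff_cong[OF open_ball _ Cons.prems])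
  then show ?case by simp
qed (use assms(2) in simp)

text \<open>Unlike \<open>foldr dird\<close> above, \<open>fold\<close> differentiates along the
  head of the list first, so an induction can pass from \<open>F\<close> to
  \<open>pdiff k F\<close>; this matches the recursion of \<open>hom_poly\<close>.\<close>

lemma flatC_fold_pdiff:
  assumes "flatC R \<kappa> k s (\<lambda>_. F)" "length ks \<le> k"
  shows "flatC R \<kappa> (k - length ks) (s - length ks) (\<lambda>_. fold pdiff ks F)"
  using assms
proof (induction ks arbitrary: F k s)
  case (Cons l ks)
  then obtain k' where k': "k = Suc k'" by (cases k) auto
  have "flatC R \<kappa> (k' - length ks) (s - 1 - length ks) (\<lambda>_. fold pdiff ks (pdiff l F))"
    by (rule Cons.IH[OF flatC_pdiff]) (use Cons.prems k' in auto)
  then show ?case by (simp add: k')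
qed simp

text \<open>Symmetry of the coefficients under adjacent transpositions, the form in which commuting
  mixed partials give it. It is limited to one length because derivatives exist only up to a finite
  order.\<close>

definition swap_invariant :: "nat \<Rightarrow> ('m list \<Rightarrow> 'b) \<Rightarrow> bool" where
  "swap_invariant s c \<longleftrightarrow> (\<forall>xs j k ys. length xs + length ys + 2 = s \<longrightarrow> c (xs @ j # k # ys) = c (xs @ k # j # ys))"

lemma swap_invariant_Cons:
  fixes c :: "'m list \<Rightarrow> 'b"
  assumes "swap_invariant (Suc s) c"
  shows "swap_invariant s (\<lambda>ks. c (j # ks))"
  unfolding swap_invariant_def
proof (intro allI impI)
  fix xs ys :: "'m list" and i k assume "length xs + length ys + 2 = s"
  then show "c (j # xs @ i # k # ys) = c (j # xs @ k # i # ys)"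
    using assms[unfolded swap_invariant_def, rule_format, of "j # xs" ys i k] by simp
qed

text \<open>After \<open>xs\<close> at least two derivatives remain, so the next two commute. Their
  equality on a whole ball is used, because \<open>ys\<close> differentiates further.\<close>

lemma swap_invariant_fold_pdiff:
  fixes F :: "real^'m \<Rightarrow> 'b::euclidean_space"
  assumes F: "flatC R 1 k t (\<lambda>_. F)" and "s \<le> k" and R: "R > 0"
  shows "swap_invariant s (\<lambda>ks. fold pdiff ks F 0)"
  unfolding swap_invariant_def
proof (intro allI impI)
  fix xs ys :: "'m list" and i j assume len: "length xs + length ys + 2 = s"
  have "flatC R 1 (k - length xs) (t - length xs) (\<lambda>_. fold pdiff xs F)"
    by (rule flatC_fold_pdiff[OF F]) (use assms(2) len in auto)
  then have "flatC R 1 2 (t - length xs) (\<lambda>_. fold pdiff xs F)"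
    by (rule flatC_mono_level) (use assms(2) len in auto)
  then show "fold pdiff (xs @ i # j # ys) F 0 = fold pdiff (xs @ j # i # ys) F 0"
    using R by (auto intro!: fold_pdiff_cong pdiff_swap)
qed

text \<open>Coefficients are indexed by lists of variables, so a monomial occurs once for each ordering of its factors.\<close>

fun hom_poly :: "nat \<Rightarrow> ('m::finite list \<Rightarrow> 'b::real_normed_vector) \<Rightarrow> real^'m \<Rightarrow> 'b" where
  "hom_poly 0 c z = c []"
| "hom_poly (Suc s) c z = (\<Sum>k\<in>UNIV. z$k *\<^sub>R hom_poly s (\<lambda>ks. c (k # ks)) z)"

lemma hom_poly_cong: "(\<And>ks. length ks = s \<Longrightarrow> c ks = d ks) \<Longrightarrow> hom_poly s c z = hom_poly s d z"
proof (induction s arbitrary: c d)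
  case (Suc s)
  have "hom_poly s (\<lambda>ks. c (k # ks)) z = hom_poly s (\<lambda>ks. d (k # ks)) z" for k
    by (rule Suc.IH) (simp add: Suc.prems)
  then show ?case by simp
qed simp

lemma hom_poly_linear: "linear T \<Longrightarrow> T (hom_poly s c z) = hom_poly s (\<lambda>ks. T (c ks)) z"
  by (induction s arbitrary: c) (auto simp: linear_sum linear_cmul)

lemma hom_poly_scaleR: "hom_poly s (\<lambda>ks. a *\<^sub>R c ks) z = a *\<^sub>R hom_poly s c z"
  by (induction s arbitrary: c) (auto simp: scaleR_sum_right mult.commute)

lemma hom_poly_diff: "hom_poly s (\<lambda>ks. c ks - d ks) z = hom_poly s c z - hom_poly s d z"
  by (induction s arbitrary: c d) (auto simp: scaleR_diff_right sum_subtractf)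

lemma hom_poly_sum: "hom_poly s (\<lambda>ks. \<Sum>i\<in>I. c i ks) z = (\<Sum>i\<in>I. hom_poly s (c i) z)"
proof (induction s arbitrary: c)
  case (Suc s)
  show ?case by (simp add: Suc scaleR_sum_right) (rule sum.swap)
qed simp

definition weight :: "real^'m \<Rightarrow> 'm list \<Rightarrow> real" where
  "weight lam ks = prod_list (map (\<lambda>k. lam$k) ks)"

lemma weight_Cons: "weight lam (k # ks) = lam$k * weight lam ks"
  by (simp add: weight_def)

lemma weight_append: "weight lam (xs @ ys) = weight lam xs * weight lam ys"
  by (simp add: weight_def)

text \<open>Monomials are eigenfunctions of dilations; this diagonalizes the linearized equation on
  homogeneous polynomials.\<close>

lemma hom_poly_dil: "hom_poly s c (dil lam i z) = hom_poly s (\<lambda>ks. weight lam ks ^ i *\<^sub>R c ks) z"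
proof (induction s arbitrary: c)
  case 0
  then show ?case by (simp add: weight_def)
next
  case (Suc s)
  have "hom_poly s (\<lambda>ks. weight lam (k # ks) ^ i *\<^sub>R c (k # ks)) z
      = lam$k ^ i *\<^sub>R hom_poly s (\<lambda>ks. weight lam ks ^ i *\<^sub>R c (k # ks)) z" for k
    unfolding hom_poly_scaleR[symmetric] by (simp add: weight_Cons power_mult_distrib)
  moreover have "dil lam i z $ k = z$k * lam$k ^ i" for k by (simp add: dil_def)
  ultimately show ?case by (simp add: Suc)
qed

text \<open>The product rule gives one term for each position of the differentiated factor. Symmetry
  of the coefficients moves that factor to the front, and the equal terms add up to
  \<open>Suc s\<close>.\<close>

lemma has_derivative_hom_poly:
  fixes c :: "'m::finite list \<Rightarrow> 'b::real_normed_vector"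
  assumes "swap_invariant (Suc s) c"
  shows "(hom_poly (Suc s) c has_derivative (\<lambda>h. real (Suc s) *\<^sub>R (\<Sum>k\<in>UNIV. h$k *\<^sub>R hom_poly s (\<lambda>ks. c (k # ks)) z))) (at z)"
  using assms
proof (induction s arbitrary: c)
  case 0
  have "((\<lambda>z. \<Sum>k\<in>UNIV. z$k *\<^sub>R c [k]) has_derivative (\<lambda>h. \<Sum>k\<in>UNIV. h$k *\<^sub>R c [k])) (at z)"
    by (intro bounded_linear_imp_has_derivative bounded_linear_sum bounded_linear_compose[OF bounded_linear_scaleR_left] bounded_linear_vec_nth)
  then show ?case by simp
next
  case (Suc s)
  have nth: "((\<lambda>z. z$k) has_derivative (\<lambda>h. h$k)) (at z)" for k
    by (rule bounded_linear_imp_has_derivative[OF bounded_linear_vec_nth])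
  have swap: "hom_poly s (\<lambda>ks. c (k # l # ks)) z = hom_poly s (\<lambda>ks. c (l # k # ks)) z" for k l
    using Suc.prems[unfolded swap_invariant_def, rule_format, of "[]" _ k l] by (intro hom_poly_cong) simp
  have deriv: "(hom_poly (Suc (Suc s)) c has_derivative
      (\<lambda>h. \<Sum>k\<in>UNIV. z$k *\<^sub>R (real (Suc s) *\<^sub>R (\<Sum>l\<in>UNIV. h$l *\<^sub>R hom_poly s (\<lambda>ks. c (k # l # ks)) z))
        + h$k *\<^sub>R hom_poly (Suc s) (\<lambda>ks. c (k # ks)) z)) (at z)"
    unfolding hom_poly.simps(2)[of "Suc s", abs_def]
    by (intro has_derivative_sum has_derivative_scaleR nth Suc.IH swap_invariant_Cons[OF Suc.prems])
  have "(\<Sum>k\<in>UNIV. z$k *\<^sub>R (real (Suc s) *\<^sub>R (\<Sum>l\<in>UNIV. h$l *\<^sub>R hom_poly s (\<lambda>ks. c (k # l # ks)) z))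
        + h$k *\<^sub>R hom_poly (Suc s) (\<lambda>ks. c (k # ks)) z)
      = real (Suc (Suc s)) *\<^sub>R (\<Sum>k\<in>UNIV. h$k *\<^sub>R hom_poly (Suc s) (\<lambda>ks. c (k # ks)) z)" for h :: "real^'m"
  proof -
    have "(\<Sum>k\<in>UNIV. z$k *\<^sub>R (real (Suc s) *\<^sub>R (\<Sum>l\<in>UNIV. h$l *\<^sub>R hom_poly s (\<lambda>ks. c (k # l # ks)) z)))
        = real (Suc s) *\<^sub>R (\<Sum>k\<in>UNIV. \<Sum>l\<in>UNIV. (z$k * h$l) *\<^sub>R hom_poly s (\<lambda>ks. c (l # k # ks)) z)"
      by (simp add: scaleR_sum_right swap mult_ac)
    also have "\<dots> = real (Suc s) *\<^sub>R (\<Sum>l\<in>UNIV. h$l *\<^sub>R hom_poly (Suc s) (\<lambda>ks. c (l # ks)) z)"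
      by (subst sum.swap) (simp add: scaleR_sum_right mult_ac)
    finally show ?thesis
      by (simp only: sum.distrib of_nat_Suc[of "Suc s"] scaleR_add_left scaleR_one add.commute)
  qed
  with deriv show ?case by (simp only:)
qed

lemma pdiff_hom_poly:
  assumes "swap_invariant (Suc s) c"
  shows "pdiff k (hom_poly (Suc s) c) z = real (Suc s) *\<^sub>R hom_poly s (\<lambda>ks. c (k # ks)) z"
  using pdiff_eq[OF has_derivative_hom_poly[OF assms], of k] by (simp add: sum_axis_scaleR)

lemma flatC_component: "R \<le> 1 \<Longrightarrow> flatC R 1 j 1 (\<lambda>_ z. z$k)"
proof (cases j)
  have flat0: "flat0 R 1 1 (\<lambda>_ z. z$k)"
    unfolding flat0_def using component_le_norm_cart[of _ k]
    by (auto intro!: exI[of _ 1] continuous_intros)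
  {
    case 0
    then show ?thesis using flat0 by simp
  next
    case (Suc i)
    show ?thesis unfolding Suc
    proof (rule flatC_SucI[OF flat0])
      show "((\<lambda>z. z$k) has_derivative (\<lambda>h. h$k)) (at z)" for z
        by (rule bounded_linear_imp_has_derivative[OF bounded_linear_vec_nth])
    qed (simp add: flatC_const)
  }
qed

lemma flatC_hom_poly: "R \<le> 1 \<Longrightarrow> flatC R 1 j s (\<lambda>_. hom_poly s c)"
proof (induction s arbitrary: c)
  case 0
  then show ?case using flatC_const[of R j "c []"] by (simp add: hom_poly.simps(1)[abs_def])
next
  case (Suc s)
  have "flatC R (1 * 1) j (1 + s) (\<lambda>_ z. z$k *\<^sub>R hom_poly s (\<lambda>ks. c (k # ks)) z)" for k
    using Suc by (intro flatC_mult flatC_component) auto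
  then show ?case unfolding hom_poly.simps(2)[abs_def] by (intro flatC_sum) simp
qed

lemma flatC_zero_at_0:
  assumes "flatC R \<kappa> j s f" "s \<ge> 1" "R > 0"
  shows "f n 0 = 0"
proof -
  obtain C where "C \<ge> 0" "\<And>n z. z \<in> ball 0 R \<Longrightarrow> norm (f n z) \<le> C * \<kappa> ^ n * norm z ^ s"
    using flatC_bound[OF assms(1)] by blast
  from this(2)[of 0 n] show ?thesis using assms(2,3) by (simp add: power_0_left)
qed

text \<open>Since \<open>F\<close> is already flat of order \<open>s\<close>, removing its degree-s
  Taylor part gains one order. Each partial derivative of the remainder is the remainder of a
  partial derivative, as (s+1)/(s+1)! = 1/s!, and \<open>flatC_Suc_mvt\<close> integrates
  back.\<close>

lemma flatC_taylor:
  fixes F :: "real^'m \<Rightarrow> 'b::euclidean_space"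
  assumes R: "0 < R" "R \<le> 1"
    and "flatC R 1 k s (\<lambda>_. F)" "s < k" "swap_invariant s (\<lambda>ks. fold pdiff ks F 0)"
  shows "flatC R 1 k (Suc s) (\<lambda>_ z. F z - (1 / fact s) *\<^sub>R hom_poly s (\<lambda>ks. fold pdiff ks F 0) z)"
  using assms(3-)
proof (induction s arbitrary: F k)
  case 0
  then obtain k' where k: "k = Suc k'" by (cases k) auto
  have F: "F differentiable at z" if "z \<in> ball 0 R" for z using 0(1) k that by simp
  have d: "((\<lambda>z. F z - F 0) has_derivative (\<lambda>h. (\<Sum>k\<in>UNIV. h$k *\<^sub>R pdiff k F z) - 0)) (at z)" if "z \<in> ball 0 R" for z
    by (intro has_derivative_diff has_derivative_pdiff F that has_derivative_const)
  have "flatC R 1 (Suc k') (Suc 0) (\<lambda>_ z. F z - F 0)"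
  proof (rule flatC_Suc_mvt[OF _ R])
    show "(\<lambda>z. F z - F 0) differentiable at z" if "z \<in> ball 0 R" for z
      using d[OF that] differentiable_def by blast
    show "flatC R 1 k' 0 (\<lambda>_. pdiff l (\<lambda>z. F z - F 0))" for l
    proof -
      have "flatC R 1 k' 0 (\<lambda>_. pdiff l F)" using 0(1) k by simp
      then show ?thesis
        by (subst flatC_cong[where g = "\<lambda>_. pdiff l F"]) (simp_all add: pdiff_eq[OF d] sum_axis_scaleR)
    qed
  qed auto
  then show ?case by (simp add: k)
next
  case (Suc s)
  then obtain k' where k: "k = Suc k'" by (cases k) auto
  let ?c = "\<lambda>ks. fold pdiff ks F 0"
  have F: "F differentiable at z" if "z \<in> ball 0 R" for z using Suc.prems(1) k that by simp
  have d: "((\<lambda>z. F z - (1 / fact (Suc s)) *\<^sub>R hom_poly (Suc s) ?c z) has_derivative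
      (\<lambda>h. (\<Sum>k\<in>UNIV. h$k *\<^sub>R pdiff k F z) - (1 / fact (Suc s)) *\<^sub>R
        (real (Suc s) *\<^sub>R (\<Sum>k\<in>UNIV. h$k *\<^sub>R hom_poly s (\<lambda>ks. ?c (k # ks)) z)))) (at z)" if "z \<in> ball 0 R" for z
    by (intro has_derivative_diff has_derivative_pdiff F that has_derivative_scaleR_right has_derivative_hom_poly Suc.prems(3))
  have fact: "1 / fact (Suc s) * real (Suc s) = (1 / fact s :: real)"
    by (simp add: fact_Suc del: of_nat_Suc)
  have "flatC R 1 (Suc k') (Suc (Suc s)) (\<lambda>_ z. F z - (1 / fact (Suc s)) *\<^sub>R hom_poly (Suc s) ?c z)"
  proof (rule flatC_Suc_mvt[OF _ R])
    show "F 0 - (1 / fact (Suc s)) *\<^sub>R hom_poly (Suc s) ?c 0 = 0"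
      using flatC_zero_at_0[OF Suc.prems(1) _ R(1)] by simp
    show "(\<lambda>z. F z - (1 / fact (Suc s)) *\<^sub>R hom_poly (Suc s) ?c z) differentiable at z" if "z \<in> ball 0 R" for z
      using d[OF that] differentiable_def by blast
    show "flatC R 1 k' (Suc s) (\<lambda>_. pdiff l (\<lambda>z. F z - (1 / fact (Suc s)) *\<^sub>R hom_poly (Suc s) ?c z))" for l
    proof -
      have "flatC R 1 k' (Suc s) (\<lambda>_ z. pdiff l F z - (1 / fact s) *\<^sub>R hom_poly s (\<lambda>ks. fold pdiff ks (pdiff l F) 0) z)"
        using Suc.prems swap_invariant_Cons[OF Suc.prems(3), of l] by (intro Suc.IH) (auto simp: k)
      moreover have "pdiff l (\<lambda>z. F z - (1 / fact (Suc s)) *\<^sub>R hom_poly (Suc s) ?c z) z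
          = pdiff l F z - (1 / fact s) *\<^sub>R hom_poly s (\<lambda>ks. fold pdiff ks (pdiff l F) 0) z" if "z \<in> ball 0 R" for z
        unfolding pdiff_eq[OF d[OF that]] sum_axis_scaleR scaleR_scaleR fact by simp
      ultimately show ?thesis by (subst flatC_cong) auto
    qed
  qed auto
  then show ?case by (simp add: k)
qed

section \<open>Solving the equation order by order\<close>

context functional_equation
begin

text \<open>How the linearization of \<open>G\<close> at 0 acts on the coefficient of a monomial of
  weight \<open>t\<close>. In the application \<open>lin_at_0 t\<close> minus the identity is
  -B_0^{-1} T(t).\<close>

definition lin_at_0 :: "real \<Rightarrow> 'b \<Rightarrow> 'b" where
  "lin_at_0 t y = (\<Sum>i\<le>N. t ^ i *\<^sub>R G [\<iota> i y] 0)"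

lemma zero_in_U: "0 \<in> U"
  using \<delta> by (simp add: subset_iff)

lemma linear_G_0: "linear (\<lambda>h. G [h] 0)"
  by (rule tower_linear[OF G]) (use zero_in_U in auto)

lemma linear_G_\<iota>: "linear (\<lambda>y. G [\<iota> i y] 0)"
  using linear_compose[OF \<iota> linear_G_0] by (simp add: o_def)

lemma G_0_orbit: "G [orbit f z] 0 = (\<Sum>i\<le>N. G [\<iota> i (f (dil lam i z))] 0)"
  unfolding orbit_def by (rule linear_sum[OF linear_G_0])

lemma G_0_orbit_hom_poly:
  "G [orbit (hom_poly s q) z] 0 = hom_poly s (\<lambda>ks. lin_at_0 (weight lam ks) (q ks)) z"
proof -
  have "G [\<iota> i (hom_poly s q (dil lam i z))] 0 = hom_poly s (\<lambda>ks. weight lam ks ^ i *\<^sub>R G [\<iota> i (q ks)] 0) z" for i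
    unfolding hom_poly_dil hom_poly_linear[OF linear_G_\<iota>] by (simp add: linear_cmul[OF linear_G_\<iota>])
  then show ?thesis unfolding G_0_orbit lin_at_0_def hom_poly_sum by simp
qed

lemma G_0_orbit_deriv:
  assumes f: "\<And>z. z \<in> ball 0 R \<Longrightarrow> f differentiable at z" and z: "z \<in> ball 0 R"
  shows "(\<lambda>z. G [orbit f z] 0) differentiable at z"
    "pdiff k (\<lambda>z. G [orbit f z] 0) z = lin_op (\<lambda>z. 0) k (pdiff k f) z"
proof -
  have "bounded_linear (\<lambda>y. G [\<iota> i y] 0)" for i using linear_G_\<iota> linear_conv_bounded_linear by blast
  then have d: "((\<lambda>z. G [orbit f z] 0) has_derivative (\<lambda>h. \<Sum>i\<le>N. G [\<iota> i (\<Sum>k\<in>UNIV. (dil lam i h)$k *\<^sub>R pdiff k f (dil lam i z))] 0)) (at z)"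
    unfolding G_0_orbit
    by (intro has_derivative_sum bounded_linear.has_derivative[where f = "\<lambda>y. G [\<iota> _ y] 0"]
      has_derivative_compose[OF bounded_linear_imp_has_derivative[OF bounded_linear_dil]
          has_derivative_pdiff[OF f[OF dil_ball[OF lam_le_1 z]]]])
  then show "(\<lambda>z. G [orbit f z] 0) differentiable at z" by (auto simp: differentiable_def)
  have "(\<Sum>l\<in>UNIV. dil lam i (axis k 1) $ l *\<^sub>R pdiff l f (dil lam i z)) = lam$k ^ i *\<^sub>R pdiff k f (dil lam i z)" for i
    unfolding dil_axis by (simp add: sum_axis_scaleR flip: scaleR_scaleR scaleR_sum_right)
  then show "pdiff k (\<lambda>z. G [orbit f z] 0) z = lin_op (\<lambda>z. 0) k (pdiff k f) z"
    unfolding pdiff_eq[OF d] lin_op_def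
    by (simp add: linear_cmul[OF linear_G_\<iota>] G_\<iota>_expansion[OF zero_in_U, of _ "pdiff k f _"])
qed

lemma orbit_small:
  assumes "flatC 1 1 j 1 (\<lambda>_. p)"
  obtains R where "0 < R" "R \<le> 1" "\<And>z. z \<in> ball 0 R \<Longrightarrow> orbit p z \<in> K"
proof -
  obtain C where C: "C \<ge> 0" "\<And>n::nat. \<And>z. z \<in> ball 0 1 \<Longrightarrow> norm (p z) \<le> C * 1 ^ n * norm z ^ 1"
    using flatC_bound[OF assms] by metis
  obtain B where B: "B > 0" "\<And>R c f z. z \<in> ball 0 R \<Longrightarrow> (\<And>y. y \<in> ball 0 R \<Longrightarrow> norm (f y) \<le> c) \<Longrightarrow> norm (orbit f z) \<le> B * c"
    using orbit_bound by blast
  define R where "R = min 1 (\<delta> / (B * (C + 1)))"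
  have R: "0 < R" "R \<le> 1" using \<delta>(1) B(1) C(1) by (auto simp: R_def)
  have "B * (C * R) \<le> B * ((C + 1) * (\<delta> / (B * (C + 1))))"
    using B(1) C(1) R(1) by (intro mult_left_mono mult_mono) (auto simp: R_def)
  then have BCR: "B * (C * R) \<le> \<delta>" using B(1) C by simp
  have "orbit p z \<in> K" if z: "z \<in> ball 0 R" for z
  proof -
    have "norm (p y) \<le> C * R" if y: "y \<in> ball 0 R" for y
    proof -
      have "norm (p y) \<le> C * norm y" using C(2)[of y 0] y R by simp
      also have "\<dots> \<le> C * R" using y C(1) by (intro mult_left_mono) auto
      finally show ?thesis .
    qed
    then have "norm (orbit p z) \<le> B * (C * R)" by (rule B(2)[OF z])
    then show ?thesis using BCR by simp
  qed
  then show ?thesis using that R by blast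
qed

text \<open>Adding a form Q of degree \<open>s\<close> changes the residual by the linear part
  DG(0)(orbit Q) - Q plus a remainder. The remainder is of order s + 1, and \<open>q\<close> is
  chosen so that the linear part cancels the degree-s Taylor part of the old residual.\<close>

lemma flat_residual_step:
  assumes R: "0 < R" "R \<le> 1" and p: "\<And>j. flatC 1 1 j 1 (\<lambda>_. p)"
    and orbit_p: "\<And>z. z \<in> ball 0 R \<Longrightarrow> orbit p z \<in> K"
    and res: "flatC R 1 r s (\<lambda>_. residual p)" and s: "1 \<le> s" "s < r"
    and q: "swap_invariant s q"
      "\<And>ks. length ks = s \<Longrightarrow> lin_at_0 (weight lam ks) (q ks) - q ks = - ((1 / fact s) *\<^sub>R fold pdiff ks (residual p) 0)"
    and G0: "G [] 0 = 0"
  obtains R' where "0 < R'" "R' \<le> R" "\<And>z. z \<in> ball 0 R' \<Longrightarrow> orbit (\<lambda>z. p z + hom_poly s q z) z \<in> K"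
    "flatC R' 1 r (Suc s) (\<lambda>_. residual (\<lambda>z. p z + hom_poly s q z))"
proof -
  let ?Q = "hom_poly s q"
  let ?p' = "\<lambda>z. p z + ?Q z"
  have Q: "flatC R 1 j s (\<lambda>_. ?Q)" if "R \<le> 1" for j R using flatC_hom_poly[OF that] .
  have Q1: "flatC 1 1 j 1 (\<lambda>_. ?Q)" for j by (rule flatC_mono_order[OF Q]) (use s in auto)
  have p': "flatC 1 1 j 1 (\<lambda>_. ?p')" for j by (rule flatC_add[OF p Q1])
  obtain R1 where R1: "0 < R1" "R1 \<le> 1" "\<And>z. z \<in> ball 0 R1 \<Longrightarrow> orbit ?p' z \<in> K"
    using orbit_small[OF p'] by blast
  define R' where "R' = min R R1"
  have R': "0 < R'" "R' \<le> R" "R' \<le> 1" "R' \<le> R1" using R R1 by (auto simp: R'_def)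
  have orbit_p': "orbit ?p' z \<in> K" if "z \<in> ball 0 R'" for z using R1(3) R'(4) that by auto
  have orbit_p: "orbit p z \<in> K" if "z \<in> ball 0 R'" for z using orbit_p R'(2) that by auto
  have KU: "x \<in> U" if "x \<in> K" for x using that \<delta>(2) by blast
  have fl_p: "flatC R' 1 j 1 (\<lambda>_. p)" and fl_p': "flatC R' 1 j 1 (\<lambda>_. ?p')" for j
    using flatC_mono_radius[OF p R'(3)] flatC_mono_radius[OF p' R'(3)] by auto
  have dp: "p differentiable at z" and dQ: "?Q differentiable at z" and dp': "?p' differentiable at z"
    if "z \<in> ball 0 R'" for z
    using flatC_differentiable[OF fl_p that] flatC_differentiable[OF Q[OF R'(3)] that]
      flatC_differentiable[OF fl_p' that] by blast+
  \<comment> \<open>The remainder of the linearization at 0, rather than at the orbit of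
    \<open>p\<close>, because the linear operator at 0 is the one diagonal on monomials.\<close>
  let ?b = "\<lambda>z. G [] (orbit ?p' z) - G [] (orbit p z) - G [orbit ?Q z] 0"
  have b_deriv: "?b differentiable at z"
    "pdiff k ?b z = (lin_op ?p' k (pdiff k p) z - lin_op p k (pdiff k p) z)
       + (lin_op ?p' k (pdiff k ?Q) z - lin_op (\<lambda>z. 0) k (pdiff k ?Q) z)" if z: "z \<in> ball 0 R'" for k z
  proof -
    note d1 = G_orbit_deriv[OF dp' z KU[OF orbit_p'[OF z]]]
      and d2 = G_orbit_deriv[OF dp z KU[OF orbit_p[OF z]]] and d3 = G_0_orbit_deriv[OF dQ z]
    show "?b differentiable at z" by (intro differentiable_diff d1 d2 d3)
    have "pdiff k ?b z = lin_op ?p' k (pdiff k ?p') z - lin_op p k (pdiff k p) z - lin_op (\<lambda>z. 0) k (pdiff k ?Q) z"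
      using pdiff_diff[OF differentiable_diff[OF d1(1) d2(1)] d3(1), of k] pdiff_diff[OF d1(1) d2(1), of k]
        d1(2)[of k] d2(2)[of k] d3(2)[of k] by simp
    moreover have "lin_op ?p' k (pdiff k ?p') z = lin_op ?p' k (\<lambda>z. pdiff k p z + pdiff k ?Q z) z"
      unfolding lin_op_def using pdiff_add[OF dp dQ] dil_ball[OF lam_le_1 z] by simp
    ultimately show "pdiff k ?b z = (lin_op ?p' k (pdiff k p) z - lin_op p k (pdiff k p) z)
       + (lin_op ?p' k (pdiff k ?Q) z - lin_op (\<lambda>z. 0) k (pdiff k ?Q) z)"
      by (simp add: lin_op_add)
  qed
  obtain r' where r': "r = Suc r'" using s by (cases r) auto
  have "flatC R' 1 (Suc r') (Suc s) (\<lambda>_. ?b)"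
  proof (rule flatC_Suc_mvt[OF _ R'(1,3)])
    have "p 0 = 0" "?Q 0 = 0"
      using flatC_zero_at_0[OF fl_p _ R'(1)] flatC_zero_at_0[OF Q[OF R'(3)] s(1) R'(1)] by auto
    then have "orbit ?p' 0 = 0" "orbit p 0 = 0" "orbit ?Q 0 = 0"
      by (auto simp: orbit_def linear_0[OF \<iota>])
    then show "?b 0 = 0" using linear_0[OF linear_G_0] by simp
    show "flatC R' 1 r' s (\<lambda>_. pdiff k ?b)" for k
    proof -
      \<comment> \<open>Bounded derivatives of \<open>p\<close>, times coefficients that change only
        across Q, which is flat of order \<open>s\<close>.\<close>
      have "flatC R' 1 r' (0 + s) (\<lambda>_ z. lin_op ?p' k (pdiff k p) z - lin_op p k (pdiff k p) z)"
      proof (rule flatC_lin_op_diff[OF R'(3)])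
        show "flatC R' 1 r' 0 (\<lambda>_. p)" by (rule flatC_mono_order[OF fl_p]) (use R' in auto)
        show "flatC R' 1 r' 0 (\<lambda>_. pdiff k p)" using flatC_pdiff[OF fl_p, of r' k] by simp
      qed (use R' r' orbit_p orbit_p' Q in auto)
      \<comment> \<open>Derivatives of Q have order s - 1, and moving the base from 0 to the new
        polynomial changes the coefficients by order 1. The form \<open>0 + ?p'\<close> exhibits the
        zero function as base.\<close>
      moreover have "flatC R' 1 r' ((s - 1) + 1) (\<lambda>_ z. lin_op (\<lambda>z. 0 + ?p' z) k (pdiff k ?Q) z - lin_op (\<lambda>z. 0) k (pdiff k ?Q) z)"
      proof (rule flatC_lin_op_diff[OF R'(3)])
        show "flatC R' 1 r' (s - 1) (\<lambda>_. pdiff k ?Q)" by (rule flatC_pdiff[OF Q[OF R'(3)]])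
      qed (use R' r' orbit_p' fl_p' \<delta>(1) in \<open>auto simp: flatC_zero\<close>)
      ultimately have "flatC R' 1 r' s (\<lambda>_ z. (lin_op ?p' k (pdiff k p) z - lin_op p k (pdiff k p) z)
          + (lin_op ?p' k (pdiff k ?Q) z - lin_op (\<lambda>z. 0) k (pdiff k ?Q) z))"
        using s(1) by (intro flatC_add) simp_all
      then show ?thesis using b_deriv(2) by (subst flatC_cong) auto
    qed
  qed (use b_deriv(1) in auto)
  then have b: "flatC R' 1 r (Suc s) (\<lambda>_. ?b)" by (simp only: r')
  let ?c = "\<lambda>ks. fold pdiff ks (residual p) 0"
  have "flatC R' 1 r (Suc s) (\<lambda>_ z. residual p z - (1 / fact s) *\<^sub>R hom_poly s ?c z)"
    using flatC_mono_radius[OF res R'(2)] s R'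
    by (intro flatC_taylor swap_invariant_fold_pdiff[of R' r s]) auto
  from flatC_add[OF b this]
  have "flatC R' 1 r (Suc s) (\<lambda>_ z. ?b z + (residual p z - (1 / fact s) *\<^sub>R hom_poly s ?c z))" .
  moreover have "residual ?p' z = ?b z + (residual p z - (1 / fact s) *\<^sub>R hom_poly s ?c z)" for z
  proof -
    have "G [orbit ?Q z] 0 - ?Q z = hom_poly s (\<lambda>ks. lin_at_0 (weight lam ks) (q ks) - q ks) z"
      by (simp add: G_0_orbit_hom_poly hom_poly_diff)
    also have "\<dots> = hom_poly s (\<lambda>ks. (- (1 / fact s)) *\<^sub>R ?c ks) z"
      by (rule hom_poly_cong) (simp add: q(2))
    also have "\<dots> = - ((1 / fact s) *\<^sub>R hom_poly s ?c z)" unfolding hom_poly_scaleR by simp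
    finally show ?thesis by (simp add: residual_def algebra_simps)
  qed
  ultimately have "flatC R' 1 r (Suc s) (\<lambda>_. residual ?p')" by (subst flatC_cong) auto
  then show ?thesis using that R' orbit_p' by blast
qed

lemma weight_swap: "swap_invariant s (weight lam)"
  unfolding swap_invariant_def by (simp add: weight_append weight_Cons mult_ac)

text \<open>The polynomial is built up to a residual flat of order \<open>r\<close>, raising the
  order by one at each degree from 2 on; \<open>solution_from_flat_residual\<close> supplies the
  rest.\<close>

theorem smooth_solution:
  assumes G0: "G [] 0 = 0" and r2: "r \<ge> 2"
    and eig: "\<And>k. lin_at_0 (lam$k) (v k) = v k"
    and nonres: "\<And>ks y. length ks \<ge> 2 \<Longrightarrow> \<exists>x. lin_at_0 (weight lam ks) x - x = y"
  obtains R P where "0 < R" "flatC R 1 r 0 (\<lambda>_. P)" "P 0 = 0"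
    "(P has_derivative (\<lambda>h. \<Sum>k\<in>UNIV. h$k *\<^sub>R v k)) (at 0)"
    "\<And>z. z \<in> ball 0 R \<Longrightarrow> orbit P z \<in> U \<and> residual P z = 0"
proof -
  have "\<exists>p R. 0 < R \<and> R \<le> 1 \<and> (\<forall>j. flatC 1 1 j 1 (\<lambda>_. p)) \<and> (\<forall>k. pdiff k p 0 = v k) \<and>
      (\<forall>z\<in>ball 0 R. orbit p z \<in> K) \<and> flatC R 1 r s (\<lambda>_. residual p)" if "2 \<le> s" "s \<le> r" for s
    using that
  proof (induction s rule: dec_induct)
    case base
    \<comment> \<open>In degree one the equation for the coefficients is homogeneous, because the
      zero function has zero residual, and eigenvectors solve it.\<close>
    define q where "q ks = v (hd ks)" for ks
    have res0: "residual (\<lambda>z. 0) = (\<lambda>z. 0)" by (simp add: residual_def G0 fun_eq_iff)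
    have "pdiff k (\<lambda>z::real^'m. 0::'b) = (\<lambda>z. 0)" for k
      by (rule ext) (simp add: pdiff_eq[OF has_derivative_const])
    then have fold0: "fold pdiff ks (\<lambda>z::real^'m. 0::'b) = (\<lambda>z. 0)" for ks by (induction ks) auto
    have sw: "swap_invariant 1 q" by (simp add: swap_invariant_def)
    obtain R where R: "0 < R" "R \<le> 1" "\<And>z. z \<in> ball 0 R \<Longrightarrow> orbit (\<lambda>z. 0 + hom_poly 1 q z) z \<in> K"
      "flatC R 1 r (Suc 1) (\<lambda>_. residual (\<lambda>z. 0 + hom_poly 1 q z))"
    proof (rule flat_residual_step[of 1 "\<lambda>z. 0" 1 q])
      show "lin_at_0 (weight lam ks) (q ks) - q ks = - ((1 / fact 1) *\<^sub>R fold pdiff ks (residual (\<lambda>z. 0)) 0)"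
        if len: "length ks = 1" for ks
      proof -
        obtain k where "ks = [k]" using len by (auto simp: length_Suc_conv)
        then show ?thesis using eig[of k] fold0[of "[k]"] by (simp add: q_def weight_def res0)
      qed
    qed (use r2 sw G0 \<delta>(1) in \<open>auto simp: flatC_zero res0\<close>)
    have "pdiff k (hom_poly 1 q) 0 = v k" for k
      using pdiff_hom_poly[of 0 q k 0] sw by (simp add: q_def)
    moreover have "flatC 1 1 j 1 (\<lambda>_. hom_poly 1 q)" for j by (rule flatC_hom_poly) simp
    ultimately show ?case using R by (intro exI[of _ "hom_poly 1 q"] exI[of _ R]) (simp add: numeral_2_eq_2 del: One_nat_def)
  next
    case (step s)
    then obtain p R where pR: "0 < R" "R \<le> 1" "\<And>j. flatC 1 1 j 1 (\<lambda>_. p)" "\<And>k. pdiff k p 0 = v k"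
      "\<And>z. z\<in>ball 0 R \<Longrightarrow> orbit p z \<in> K" "flatC R 1 r s (\<lambda>_. residual p)" by (metis Suc_leD)
    let ?c = "\<lambda>ks. fold pdiff ks (residual p) 0"
    \<comment> \<open>The choice depends on \<open>ks\<close> only through the weight and the Taylor
      coefficient. Both are swap invariant, so the chosen solutions are too.\<close>
    define q where "q ks = (SOME x. lin_at_0 (weight lam ks) x - x = - ((1 / fact s) *\<^sub>R ?c ks))" for ks
    have q: "lin_at_0 (weight lam ks) (q ks) - q ks = - ((1 / fact s) *\<^sub>R ?c ks)" if "length ks = s" for ks
      unfolding q_def by (rule someI_ex, rule nonres) (use that step in simp)
    have "swap_invariant s ?c"
      by (rule swap_invariant_fold_pdiff[OF pR(6)]) (use step pR in auto)
    then have sw: "swap_invariant s q"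
      using weight_swap[of s] unfolding swap_invariant_def q_def by simp
    obtain R' where R': "0 < R'" "R' \<le> R" "\<And>z. z \<in> ball 0 R' \<Longrightarrow> orbit (\<lambda>z. p z + hom_poly s q z) z \<in> K"
      "flatC R' 1 r (Suc s) (\<lambda>_. residual (\<lambda>z. p z + hom_poly s q z))"
      by (rule flat_residual_step[OF pR(1,2,3,5,6) _ _ sw q G0]) (use step in auto)
    have Q: "flatC 1 1 j s (\<lambda>_. hom_poly s q)" for j by (rule flatC_hom_poly) simp
    have Q1: "flatC 1 1 j 1 (\<lambda>_. hom_poly s q)" for j by (rule flatC_mono_order[OF Q]) (use step in auto)
    \<comment> \<open>Corrections have degree at least 2 and leave the derivative at 0
      unchanged.\<close>
    have "pdiff k (\<lambda>z. p z + hom_poly s q z) 0 = v k" for k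
    proof -
      have "pdiff k (hom_poly s q) 0 = 0"
        using flatC_zero_at_0[OF flatC_pdiff[OF Q[of 1, unfolded One_nat_def]]] step by simp
      moreover have "p differentiable at 0" "hom_poly s q differentiable at 0"
        using flatC_differentiable[OF pR(3)] flatC_differentiable[OF Q] by auto
      ultimately show ?thesis using pR(4)[of k] by (simp add: pdiff_add)
    qed
    moreover have "flatC 1 1 j 1 (\<lambda>_ z. p z + hom_poly s q z)" for j by (rule flatC_add[OF pR(3) Q1])
    ultimately show ?case using R' pR(2)
      by (intro exI[of _ "\<lambda>z. p z + hom_poly s q z"] exI[of _ R']) auto
  qed
  from this[OF r2 order_refl] obtain p R0 where p: "0 < R0" "R0 \<le> 1" "\<And>j. flatC 1 1 j 1 (\<lambda>_. p)"
    "\<And>k. pdiff k p 0 = v k" "flatC R0 1 r r (\<lambda>_. residual p)" by blast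
  have pR0: "flatC R0 1 j 1 (\<lambda>_. p)" for j by (rule flatC_mono_radius[OF p(3,2)])
  obtain R u where u: "0 < R" "R \<le> R0" "flatC R 1 r r (\<lambda>_. u)"
    "\<And>z. z \<in> ball 0 R \<Longrightarrow> orbit (\<lambda>z. p z + u z) z \<in> U \<and> residual (\<lambda>z. p z + u z) z = 0"
    using solution_from_flat_residual[OF p(1,2) pR0 p(5)] by blast
  obtain r' where r': "r = Suc r'" using r2 by (cases r) auto
  have R1: "R \<le> 1" using u(2) p(2) by simp
  have pR: "flatC R 1 j 1 (\<lambda>_. p)" for j by (rule flatC_mono_radius[OF pR0 u(2)])
  have pu: "flatC R 1 r 0 (\<lambda>_ z. p z + u z)"
    by (rule flatC_add[OF flatC_mono_order[OF pR] flatC_mono_order[OF u(3)]]) (use R1 in auto)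
  have "p 0 = 0" "u 0 = 0"
    using flatC_zero_at_0[OF pR _ u(1)] flatC_zero_at_0[OF u(3) _ u(1)] r by auto
  moreover have "((\<lambda>z. p z + u z) has_derivative (\<lambda>h. \<Sum>k\<in>UNIV. h$k *\<^sub>R v k)) (at 0)"
  proof -
    \<comment> \<open>\<open>u\<close> is flat of order \<open>r\<close>, so its derivative at 0
      vanishes because \<open>r \<ge> 2\<close>.\<close>
    have "pdiff k u 0 = 0" for k
      using flatC_zero_at_0[OF flatC_pdiff[OF u(3)[unfolded r']]] r2 r' u(1) by simp
    moreover have "p differentiable at 0" "u differentiable at 0"
      using flatC_differentiable[OF pR] flatC_differentiable[OF u(3)[unfolded r']] u(1) by auto
    ultimately show ?thesis
      using has_derivative_pdiff[of "\<lambda>z. p z + u z" 0] by (simp add: pdiff_add p(4))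
  qed
  ultimately show ?thesis using that[OF u(1) pu] u(4) by simp
qed

end

section \<open>Matrices and blocks\<close>

lemma supnorm_eq_infnorm: "supnorm x = infnorm x"
proof -
  have "{\<bar>x$i\<bar> |i. i \<in> UNIV} = range (\<lambda>i. \<bar>x$i\<bar>)" by auto
  then show ?thesis by (simp add: supnorm_def infnorm_cart cSup_eq_Max)
qed

text \<open>The supremum in \<open>opnorm_inf\<close> gives usable estimates only once its set is
  known to be bounded.\<close>

lemma bdd_above_supnorm_matrix_vector:
  fixes A :: "real^'n^'m"
  shows "bdd_above ((\<lambda>x. supnorm (A *v x)) ` {x. supnorm x \<le> 1})"
proof -
  have bl: "bounded_linear ((*v) A)" by simp
  have "supnorm (A *v x) \<le> onorm ((*v) A) * sqrt DIM(real^'n)" if "supnorm x \<le> 1" for x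
  proof -
    have "supnorm (A *v x) \<le> norm (A *v x)" by (simp add: supnorm_eq_infnorm infnorm_le_norm)
    also have "\<dots> \<le> onorm ((*v) A) * norm x" by (rule onorm[OF bl])
    also have "\<dots> \<le> onorm ((*v) A) * (sqrt DIM(real^'n) * 1)"
    proof (rule mult_left_mono)
      have "norm x \<le> sqrt DIM(real^'n) * infnorm x" by (rule norm_le_infnorm)
      also have "\<dots> \<le> sqrt DIM(real^'n) * 1" using that by (intro mult_left_mono) (auto simp: supnorm_eq_infnorm)
      finally show "norm x \<le> sqrt DIM(real^'n) * 1" .
    qed (rule onorm_pos_le[OF bl])
    finally show ?thesis by simp
  qed
  then show ?thesis by (intro bdd_aboveI2) auto
qed

lemma infnorm_matrix_vector_le:
  fixes A :: "real^'n^'m"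
  shows "infnorm (A *v x) \<le> opnorm_inf A * infnorm x"
proof (cases "x = 0")
  case True
  then show ?thesis by (simp add: infnorm_0)
next
  case False
  let ?y = "(1 / infnorm x) *\<^sub>R x"
  have pos: "infnorm x > 0" using False by (simp add: infnorm_pos_lt)
  then have "supnorm ?y \<le> 1" by (simp add: supnorm_eq_infnorm infnorm_mul)
  then have "supnorm (A *v ?y) \<le> opnorm_inf A"
    unfolding opnorm_inf_def by (intro cSUP_upper bdd_above_supnorm_matrix_vector) simp
  then show ?thesis using pos
    by (simp add: supnorm_eq_infnorm matrix_vector_mult_scaleR infnorm_mul field_simps)
qed

lemma opnorm_inf_nonneg: "opnorm_inf (A :: real^'n^'m) \<ge> 0"
proof -
  have "supnorm (A *v 0) \<le> opnorm_inf A"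
    unfolding opnorm_inf_def
    by (intro cSUP_upper bdd_above_supnorm_matrix_vector) (simp add: supnorm_eq_infnorm infnorm_0)
  then show ?thesis by (simp add: supnorm_eq_infnorm infnorm_0)
qed

lemma diagm_vector: "diagm lam *v z = (\<chi> k. lam$k * z$k)"
  by (simp add: diagm_def matrix_vector_mult_def vec_eq_iff if_distrib[of "\<lambda>c. c * _"] cong: if_cong)

lemma abs_le_opnorm_inf_diagm: "\<bar>lam$k\<bar> \<le> opnorm_inf (diagm lam)"
proof -
  let ?e = "axis k 1 :: real^'a"
  have "\<bar>(diagm lam *v ?e) $ k\<bar> \<le> opnorm_inf (diagm lam) * infnorm ?e"
    using component_le_infnorm_cart infnorm_matrix_vector_le order_trans by blast
  also have "\<dots> \<le> opnorm_inf (diagm lam) * 1"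
    using infnorm_le_norm[of ?e] by (intro mult_left_mono opnorm_inf_nonneg) simp
  finally show ?thesis by (simp add: diagm_vector)
qed

lemma matpow_diagm: "matpow (diagm lam) n *v z = dil lam n z"
proof (induction n)
  case (Suc n)
  then show ?case
    by (simp add: matrix_vector_mul_assoc[symmetric] diagm_vector dil_def vec_eq_iff)
qed (simp add: dil_def vec_eq_iff)

lemma weight_eq_multipow: "weight lam ks = multipow lam (count_list ks)"
proof (induction ks)
  case (Cons k ks)
  have "multipow lam (count_list (k # ks)) = (\<Prod>i\<in>UNIV. (if i = k then lam$i else 1) * lam$i ^ count_list ks i)"
    unfolding multipow_def by (intro prod.cong) auto
  also have "\<dots> = lam$k * multipow lam (count_list ks)"
    by (simp add: prod.distrib multipow_def)
  finally show ?case by (simp only: weight_Cons Cons)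
qed (simp add: weight_def multipow_def)

lemma sum_count_list: "sum (count_list ks) (UNIV :: 'm::finite set) = length ks"
proof (induction ks)
  case (Cons k ks)
  have "sum (count_list (k # ks)) UNIV = (\<Sum>i\<in>UNIV. (if i = k then 1 else 0) + count_list ks i)"
    by (intro sum.cong) auto
  then show ?case using Cons by (simp add: sum.distrib)
qed simp

section \<open>Blocks and the derivative tower of the fixed-point map\<close>

definition block_inj :: "(nat \<Rightarrow> 'k) \<Rightarrow> nat \<Rightarrow> real^'d \<Rightarrow> (real^'d)^'k" where
  "block_inj blk i y = (\<chi> k. if k = blk i then y else 0)"

lemma linear_block_inj: "linear (block_inj blk i)"
  by (rule linearI) (auto simp: block_inj_def vec_eq_iff)

lemma sum_block_inj:
  assumes "bij_betw blk {..N} UNIV"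
  shows "(\<Sum>i\<le>N. block_inj blk i (y i)) = (\<chi> k. y (inv_into {..N} blk k))"
proof (subst vec_eq_iff, rule allI)
  fix k
  let ?j = "inv_into {..N} blk k"
  have j: "?j \<in> {..N}" "blk ?j = k"
    using assms inv_into_into[of k blk "{..N}"] f_inv_into_f[of k blk "{..N}"] by (auto simp: bij_betw_def)
  have "(\<Sum>i\<le>N. block_inj blk i (y i)) $ k = (\<Sum>i\<le>N. if i = ?j then y i else 0)"
    unfolding sum_component
  proof (rule sum.cong)
    fix i assume "i \<in> {..N}"
    then have "k = blk i \<longleftrightarrow> i = ?j" using assms j by (metis bij_betw_inv_into_left)
    then show "block_inj blk i (y i) $ k = (if i = ?j then y i else 0)" by (simp add: block_inj_def)
  qed simp
  also have "\<dots> = y ?j" using j(1) by simp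
  finally show "(\<Sum>i\<le>N. block_inj blk i (y i)) $ k = (\<chi> k. y (inv_into {..N} blk k)) $ k" by simp
qed

lemma Ck_on_open_imp_tower:
  assumes "Ck_on k U Z" "open U"
  obtains D where "tower k U D" "\<And>x. x \<in> U \<Longrightarrow> D [] x = Z x"
proof -
  obtain D where D: "\<forall>x\<in>U. D 0 x [] = Z x"
    "\<forall>j<k. \<forall>hs. length hs = j \<longrightarrow>
       (\<forall>x\<in>U. ((\<lambda>y. D j y hs) has_derivative (\<lambda>h. D (Suc j) x (h # hs))) (at x within U))"
    "\<forall>j\<le>k. \<forall>hs. length hs = j \<longrightarrow> continuous_on U (\<lambda>x. D j x hs)"
    using assms(1) unfolding Ck_on_def by (elim exE conjE)
  have "tower k U (\<lambda>hs x. D (length hs) x hs)"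
    unfolding tower_def
  proof (intro conjI allI impI ballI)
    show "((\<lambda>x. D (length hs) x hs) has_derivative (\<lambda>h. D (length (h # hs)) x (h # hs))) (at x)"
      if "length hs < k" "x \<in> U" for hs x
      using D(2)[rule_format, OF that(1) refl that(2)] at_within_open[OF that(2) assms(2)] by simp
  qed (use D(3) in blast)
  then show ?thesis by (rule that) (use D(1) in simp)
qed

text \<open>The derivatives of the linear map x \<mapsto> x$k, which supply the summand x_0 of
  \<open>G\<close>.\<close>

definition proj_tower :: "'k \<Rightarrow> ((real^'d)^'k) list \<Rightarrow> (real^'d)^'k \<Rightarrow> real^'d" where
  "proj_tower k hs x = (case hs of [] \<Rightarrow> x$k | [h] \<Rightarrow> h$k | _ \<Rightarrow> 0)"

lemma tower_proj:
  fixes k :: "'k::finite"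
  shows "tower n UNIV (proj_tower k :: ((real^'d)^'k) list \<Rightarrow> _)"
  unfolding tower_def
proof (intro conjI allI impI ballI)
  have nth: "((\<lambda>x. x$k) has_derivative (\<lambda>h. h$k)) (at x)" for x :: "(real^'d)^'k"
    by (rule bounded_linear_imp_has_derivative[OF bounded_linear_vec_nth])
  show "(proj_tower k hs has_derivative (\<lambda>h. proj_tower k (h # hs) x)) (at x)" for hs and x :: "(real^'d)^'k"
    by (cases hs; cases "tl hs") (auto simp: proj_tower_def[abs_def] nth)
  then show "continuous_on UNIV (proj_tower k hs)" for hs :: "((real^'d)^'k) list"
    by (intro continuous_at_imp_continuous_on ballI has_derivative_continuous)
qed

lemma tower_diff_linear:
  assumes "tower k U D" "tower k UNIV E" "bounded_linear T"
  shows "tower k U (\<lambda>hs x. E hs x - T (D hs x))"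
  unfolding tower_def
proof (intro conjI allI impI ballI)
  interpret T: bounded_linear T by fact
  show "((\<lambda>x. E hs x - T (D hs x)) has_derivative (\<lambda>h. E (h # hs) x - T (D (h # hs) x))) (at x)"
    if "length hs < k" "x \<in> U" for hs x
    using tower_has_derivative[OF assms(1) that] tower_has_derivative[OF assms(2) that(1)]
    by (intro has_derivative_diff T.has_derivative) auto
  show "continuous_on U (\<lambda>x. E hs x - T (D hs x))" if "length hs \<le> k" for hs
    using tower_continuous[OF assms(1) that] tower_continuous[OF assms(2) that]
    by (intro continuous_on_diff T.continuous_on) (auto intro: continuous_on_subset)
qed

text \<open>Continuity of the finitely many functions \<open>D [\<iota> i e]\<close> extends the
  bounds at 0 to a ball. The loss \<epsilon> will be paid from the slack in the contraction
  hypothesis.\<close>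

lemma small_first_derivative_ball:
  fixes D :: "'x::euclidean_space list \<Rightarrow> 'x \<Rightarrow> 'b::euclidean_space" and \<iota> :: "nat \<Rightarrow> 'b \<Rightarrow> 'x"
  assumes D: "tower k U D" "k \<ge> 1" and U: "open U" "0 \<in> U" and \<iota>: "\<And>i. linear (\<iota> i)"
    and \<alpha>: "\<And>i y. i \<le> N \<Longrightarrow> infnorm (D [\<iota> i y] 0) \<le> \<alpha> i * infnorm y" and \<epsilon>: "\<epsilon> > 0"
  obtains \<delta> where "\<delta> > 0" "cball 0 \<delta> \<subseteq> U"
    "\<And>i x y. i \<le> N \<Longrightarrow> x \<in> cball 0 \<delta> \<Longrightarrow> infnorm (D [\<iota> i y] x) \<le> (\<alpha> i + \<epsilon>) * infnorm y"
proof -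
  \<comment> \<open>The error for a general \<open>y\<close> is a sum over the basis, so each basis
    direction gets an equal share of \<epsilon>.\<close>
  let ?\<eta> = "\<epsilon> / DIM('b)"
  have "\<forall>\<^sub>F x in nhds 0. dist (D [\<iota> i (e::'b)] x) (D [\<iota> i e] 0) < ?\<eta>" for i e
  proof -
    have "isCont (D [\<iota> i e]) 0"
      using tower_continuous[OF D(1), of "[\<iota> i e]"] D(2) U by (metis One_nat_def continuous_on_interior interior_open length_Cons list.size(3))
    then have "(D [\<iota> i e] \<longlongrightarrow> D [\<iota> i e] 0) (nhds 0)" by (simp add: isCont_def tendsto_at_iff_tendsto_nhds)
    then show ?thesis using \<epsilon> by (intro tendstoD) simp_all
  qed
  then have "\<forall>\<^sub>F x in nhds 0. \<forall>i\<in>{..N}. \<forall>e\<in>(Basis::'b set). dist (D [\<iota> i e] x) (D [\<iota> i e] 0) < ?\<eta>"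
    by (intro eventually_ball_finite ballI) auto
  moreover have "\<forall>\<^sub>F x in nhds 0. x \<in> U" using U by (rule eventually_nhds_in_open)
  ultimately have "\<forall>\<^sub>F x in nhds 0. (\<forall>i\<in>{..N}. \<forall>e\<in>(Basis::'b set). dist (D [\<iota> i e] x) (D [\<iota> i e] 0) < ?\<eta>) \<and> x \<in> U"
    by (rule eventually_conj)
  then obtain d where d: "d > 0" "\<And>x i e. dist x 0 < d \<Longrightarrow> i \<le> N \<Longrightarrow> e \<in> Basis \<Longrightarrow> dist (D [\<iota> i (e::'b)] x) (D [\<iota> i e] 0) < ?\<eta>"
    "\<And>x. dist x 0 < d \<Longrightarrow> x \<in> U"
    unfolding eventually_nhds_metric by auto
  have "infnorm (D [\<iota> i y] x) \<le> (\<alpha> i + \<epsilon>) * infnorm y" if i: "i \<le> N" and x: "x \<in> cball 0 (d / 2)" for i x y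
  proof -
    have x: "dist x 0 < d" using x d(1) by simp
    have lin: "linear (\<lambda>y. D [\<iota> i y] w)" if "w \<in> U" for w
    proof -
      have "linear (\<lambda>h. D [h] w)" by (rule tower_linear[OF D(1)]) (use D(2) that in auto)
      then show ?thesis using linear_compose[OF \<iota>, of "\<lambda>h. D [h] w"] by (simp add: o_def)
    qed
    have "D [\<iota> i y] x - D [\<iota> i y] 0 = (\<Sum>e\<in>Basis. (y \<bullet> e) *\<^sub>R (D [\<iota> i e] x - D [\<iota> i e] 0))"
      using linear_Basis_expansion[OF lin[OF d(3)[OF x]], of y] linear_Basis_expansion[OF lin[OF U(2)], of y]
      by (simp add: scaleR_diff_right sum_subtractf)
    also have "infnorm \<dots> \<le> (\<Sum>e\<in>(Basis::'b set). infnorm y * ?\<eta>)"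
    proof (intro order_trans[OF infnorm_sum_le] sum_mono)
      fix e :: 'b assume e: "e \<in> Basis"
      have "infnorm (D [\<iota> i e] x - D [\<iota> i e] 0) \<le> ?\<eta>"
        using d(2)[OF x i e] infnorm_le_norm[of "D [\<iota> i e] x - D [\<iota> i e] 0"] by (simp add: dist_norm)
      then show "infnorm ((y \<bullet> e) *\<^sub>R (D [\<iota> i e] x - D [\<iota> i e] 0)) \<le> infnorm y * ?\<eta>"
        unfolding infnorm_mul using Basis_le_infnorm[OF e] by (intro mult_mono) (auto simp: infnorm_pos_le)
    qed
    also have "\<dots> = \<epsilon> * infnorm y" by simp
    finally have "infnorm (D [\<iota> i y] x - D [\<iota> i y] 0) \<le> \<epsilon> * infnorm y" .
    then show ?thesis
      using \<alpha>[OF i, of y] infnorm_triangle[of "D [\<iota> i y] 0" "D [\<iota> i y] x - D [\<iota> i y] 0"]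
      by (simp add: algebra_simps)
  qed
  moreover have "cball 0 (d / 2) \<subseteq> U" using d(1,3) by (auto intro!: d(3))
  ultimately show ?thesis using that[of "d / 2"] d(1) by simp
qed

lemma matrix_inv_vector:
  fixes A :: "real^'n^'n"
  assumes "invertible A"
  shows "A *v (matrix_inv A *v y) = y" "matrix_inv A *v (A *v y) = y"
proof -
  have "A ** matrix_inv A = mat 1 \<and> matrix_inv A ** A = mat 1"
    unfolding matrix_inv_def by (rule someI_ex) (use assms in \<open>simp add: invertible_def\<close>)
  then show "A *v (matrix_inv A *v y) = y" "matrix_inv A *v (A *v y) = y"
    by (simp_all add: matrix_vector_mul_assoc)
qed

lemma blockDeriv_vector:
  assumes "tower (Suc r) U D" "\<And>x. x \<in> U \<Longrightarrow> D [] x = Z x" "open U" "0 \<in> U"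
  shows "blockDeriv Z blk i *v y = D [block_inj blk i y] 0"
proof -
  have "(D [] has_derivative (\<lambda>h. D [h] 0)) (at 0)" by (rule tower_has_derivative[OF assms(1)]) (use assms in auto)
  then have "(Z has_derivative (\<lambda>h. D [h] 0)) (at 0)"
    by (rule has_derivative_transform_within_open[OF _ assms(3,4)]) (use assms(2) in auto)
  then have "frechet_derivative Z (at 0) = (\<lambda>h. D [h] 0)" by (rule frechet_derivative_at[symmetric])
  then have "blockDeriv Z blk i = matrix (\<lambda>y. D [block_inj blk i y] 0)"
    by (simp add: blockDeriv_def block_inj_def)
  moreover have "linear (\<lambda>y. D [block_inj blk i y] 0)"
  proof -
    have "linear (\<lambda>h. D [h] 0)" by (rule tower_linear[OF assms(1)]) (use assms in auto)
    then show ?thesis using linear_compose[OF linear_block_inj, of "\<lambda>h. D [h] 0"] by (simp add: o_def)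
  qed
  ultimately show ?thesis by (simp add: matrix_works)
qed

lemma sum_matrix_vector_mult:
  fixes A :: "'i \<Rightarrow> real^'n^'m"
  shows "sum A I *v x = (\<Sum>i\<in>I. A i *v x)"
  by (induction I rule: infinite_finite_induct) (auto simp: matrix_vector_mult_add_rdistrib)

text \<open>Functions are total, so the conclusion also asserts that the tuple lies in
  \<open>U\<close>; outside \<open>U\<close> the equation would say nothing about the given
  map.\<close>

theorem mainTheorem14:
  fixes Z :: "(real^'d)^'k \<Rightarrow> real^'d"
    and U :: "((real^'d)^'k) set"
    and blk :: "nat \<Rightarrow> 'k"
    and N r :: nat
    and lam :: "real^'m"
    and v :: "'m \<Rightarrow> real^'d"
  assumes r: "r \<ge> 2"
    and blk: "bij_betw blk {..N} UNIV"
    and U: "open U" "0 \<in> U"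
    and Zsmooth: "Ck_on (r + 1) U Z"
    and Z0: "Z 0 = 0"
    and B0: "invertible (blockDeriv Z blk 0)"
    and snr: "stable_nonresonant Z blk N lam"
    and eigv: "\<And>j. Tmat Z blk N (lam $ j) *v v j = 0"
    and indep: "inj v" "independent (range v)"
    and mu: "\<exists>\<mu>. opnorm_inf (diagm lam) ^ r \<le> \<mu> \<and> \<mu> < 1 \<and>
              (\<Sum>i=1..N. \<mu> ^ i * opnorm_inf (matrix_inv (blockDeriv Z blk 0) ** blockDeriv Z blk i)) < 1"
  shows "\<exists>\<rho>>0. \<exists>P :: real^'m \<Rightarrow> real^'d.
           Ck_on r {z. supnorm z \<le> \<rho>} P \<and>
           P 0 = 0 \<and>
           (P has_derivative (\<lambda>z. (\<chi> a b. v b $ a) *v z)) (at 0 within {z. supnorm z \<le> \<rho>}) \<and>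
           (\<forall>z\<in>{z. supnorm z \<le> \<rho>}.
              (\<chi> k. P (matpow (diagm lam) (inv_into {..N} blk k) *v z)) \<in> U \<and>
              Z (\<chi> k. P (matpow (diagm lam) (inv_into {..N} blk k) *v z)) = 0)"
proof -
  let ?B = "blockDeriv Z blk" and ?\<iota> = "block_inj blk :: nat \<Rightarrow> real^'d \<Rightarrow> (real^'d)^'k"
  let ?C = "matrix_inv (?B 0)"
  define L where "L = opnorm_inf (diagm lam)"
  obtain \<mu> where \<mu>: "L ^ r \<le> \<mu>" "\<mu> < 1" "(\<Sum>i=1..N. \<mu> ^ i * opnorm_inf (?C ** ?B i)) < 1"
    using mu L_def by auto
  obtain D where D: "tower (r + 1) U D" "\<And>x. x \<in> U \<Longrightarrow> D [] x = Z x"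
    using Ck_on_open_imp_tower[OF Zsmooth U(1)] by blast
  have D': "tower (Suc r) U D" using D(1) by simp
  define G where "G hs x = proj_tower (blk 0) hs x - ?C *v D hs x" for hs x
  have G: "tower (Suc r) U G"
    unfolding G_def[abs_def] by (rule tower_diff_linear[OF D' tower_proj]) simp
  have G_nil: "G [] x = x$blk 0 - ?C *v Z x" if "x \<in> U" for x
    using D(2)[OF that] by (simp add: G_def proj_tower_def)
  have G_block: "G [?\<iota> i y] 0 = ?\<iota> i y $ blk 0 - ?C *v (?B i *v y)" for i y
    using blockDeriv_vector[OF D' D(2) U, of blk i y] by (simp add: G_def proj_tower_def)
  have blk0: "blk 0 = blk i \<longleftrightarrow> i = 0" if "i \<le> N" for i
    using blk that by (auto simp: bij_betw_def inj_on_def)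
  \<comment> \<open>Block 0 contributes 0: the derivative of x_0 is cancelled by B_0^{-1}
    B_0.\<close>
  define \<alpha> where "\<alpha> i = (if i = 0 then 0 else opnorm_inf (?C ** ?B i))" for i
  have \<alpha>0: "\<alpha> i \<ge> 0" for i by (simp add: \<alpha>_def opnorm_inf_nonneg)
  have \<alpha>: "infnorm (G [?\<iota> i y] 0) \<le> \<alpha> i * infnorm y" if i: "i \<le> N" for i y
  proof (cases "i = 0")
    case True
    then show ?thesis
      unfolding G_block by (simp add: matrix_inv_vector(2)[OF B0] block_inj_def \<alpha>_def infnorm_0)
  next
    case False
    then have "G [?\<iota> i y] 0 = - ((?C ** ?B i) *v y)"
      unfolding G_block using blk0[OF i] by (auto simp: block_inj_def matrix_vector_mul_assoc)
    then show ?thesis using False infnorm_matrix_vector_le[of "?C ** ?B i" y] by (simp add: infnorm_neg \<alpha>_def)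
  qed
  have L0: "L \<ge> 0" by (simp add: L_def opnorm_inf_nonneg)
  have lamL: "\<bar>lam$k\<bar> \<le> L" for k unfolding L_def by (rule abs_le_opnorm_inf_diagm)
  have L1: "L \<le> 1" using \<mu>(1,2) one_le_power[of L r] by linarith
  have Lpow: "L ^ (i * r) \<le> 1" for i using L0 L1 by (rule power_le_one)
  \<comment> \<open>The contraction factor at 0. It is compared with the hypothesis on \<mu> through
    L^(i*r) = (L^r)^i \<le> \<mu>^i.\<close>
  define S where "S = (\<Sum>i\<le>N. \<alpha> i * L ^ (i * r))"
  have "S < 1"
  proof -
    have "S = (\<Sum>i=1..N. \<alpha> i * L ^ (i * r))"
      unfolding S_def by (rule sum.mono_neutral_right) (auto simp: \<alpha>_def)
    also have "\<dots> \<le> (\<Sum>i=1..N. \<mu> ^ i * opnorm_inf (?C ** ?B i))"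
    proof (rule sum_mono)
      fix i assume i: "i \<in> {1..N}"
      have "L ^ (i * r) = (L ^ r) ^ i" by (metis mult.commute power_mult)
      also have "\<dots> \<le> \<mu> ^ i" using \<mu>(1) L0 by (intro power_mono) auto
      finally show "\<alpha> i * L ^ (i * r) \<le> \<mu> ^ i * opnorm_inf (?C ** ?B i)"
        using i \<alpha>0[of i] by (simp add: \<alpha>_def mult.commute mult_right_mono)
    qed
    finally show ?thesis using \<mu>(3) by linarith
  qed
  \<comment> \<open>There are N + 1 blocks and each \<open>L ^ (i * r)\<close> is at most 1, so
    enlarging every bound by \<epsilon> uses at most half of the slack 1 - S.\<close>
  define \<epsilon> where "\<epsilon> = (1 - S) / (2 * (real N + 1))"
  have \<epsilon>: "\<epsilon> > 0" using \<open>S < 1\<close> by (simp add: \<epsilon>_def)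
  obtain \<delta> where \<delta>: "\<delta> > 0" "cball 0 \<delta> \<subseteq> U"
    "\<And>i x y. i \<le> N \<Longrightarrow> x \<in> cball 0 \<delta> \<Longrightarrow> infnorm (G [?\<iota> i y] x) \<le> (\<alpha> i + \<epsilon>) * infnorm y"
    by (rule small_first_derivative_ball[OF G _ U linear_block_inj \<alpha> \<epsilon>]) auto
  have contraction: "(\<Sum>i\<le>N. (\<alpha> i + \<epsilon>) * L ^ (i * r)) < 1"
  proof -
    have "(\<Sum>i\<le>N. \<epsilon> * L ^ (i * r)) \<le> (\<Sum>i\<le>N. \<epsilon> * 1)"
      using \<epsilon> Lpow by (intro sum_mono mult_left_mono) auto
    also have "\<dots> = (1 - S) / 2" by (simp add: \<epsilon>_def field_simps)
    finally have "S + (\<Sum>i\<le>N. \<epsilon> * L ^ (i * r)) \<le> S + (1 - S) / 2" by (rule add_left_mono)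
    also have "\<dots> < 1" using \<open>S < 1\<close> by (simp add: field_simps)
    finally have "S + (\<Sum>i\<le>N. \<epsilon> * L ^ (i * r)) < 1" .
    then show ?thesis by (simp add: S_def distrib_right sum.distrib)
  qed
  interpret functional_equation U G ?\<iota> lam L N r "\<lambda>i. \<alpha> i + \<epsilon>" \<delta>
  proof (rule functional_equation.intro)
    show "linear (?\<iota> i)" for i by (rule linear_block_inj)
    show "infnorm (G [?\<iota> i y] x) \<le> (\<alpha> i + \<epsilon>) * infnorm y" if "i \<le> N" "x \<in> cball 0 \<delta>" for i x y
      using that by (rule \<delta>(3))
    show "\<alpha> i + \<epsilon> \<ge> 0" for i using \<alpha>0[of i] \<epsilon> by simp
  qed (use G U(1) lamL L1 r \<delta>(1,2) contraction in auto)
  \<comment> \<open>Only block 0 sees the projection x_0, whence the summand \<open>y\<close>.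
    Eigenvectors become fixed points, and non-resonance becomes solvability for every right-hand
    side.\<close>
  have lin_at_0: "lin_at_0 t y = y - ?C *v (Tmat Z blk N t *v y)" for t y
  proof -
    have "Tmat Z blk N t *v y = (\<Sum>i\<le>N. t ^ i *\<^sub>R (?B i *v y))"
      unfolding Tmat_def atLeast0AtMost by (simp add: sum_matrix_vector_mult scaleR_matrix_vector_assoc)
    then have "?C *v (Tmat Z blk N t *v y) = (\<Sum>i\<le>N. t ^ i *\<^sub>R (?C *v (?B i *v y)))"
      by (simp add: linear_sum[OF matrix_vector_mul_linear] matrix_vector_mult_scaleR)
    moreover have "(\<Sum>i\<le>N. t ^ i *\<^sub>R (?\<iota> i y $ blk 0)) = (\<Sum>i\<le>N. if i = 0 then y else 0)"
      by (intro sum.cong) (auto simp: block_inj_def blk0)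
    ultimately show ?thesis
      unfolding lin_at_0_def G_block scaleR_diff_right sum_subtractf by simp
  qed
  have G0: "G [] 0 = 0" using G_nil[OF zero_in_U] Z0 by simp
  have eig: "lin_at_0 (lam$k) (v k) = v k" for k unfolding lin_at_0 eigv by simp
  have nonres: "\<exists>x. lin_at_0 (weight lam ks) x - x = y" if "length ks \<ge> 2" for ks y
  proof -
    let ?T = "Tmat Z blk N (weight lam ks)"
    have "charF Z blk N (weight lam ks) \<noteq> 0"
      using snr that unfolding stable_nonresonant_def weight_eq_multipow by (simp add: sum_count_list)
    then have T: "invertible ?T" by (simp add: charF_def invertible_det_nz)
    \<comment> \<open>The solution of -B_0^{-1} T x = y.\<close>
    let ?x = "- (matrix_inv ?T *v (?B 0 *v y))"
    have "?T *v ?x = - (?B 0 *v y)"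
      by (simp add: linear_neg[OF matrix_vector_mul_linear] matrix_inv_vector(1)[OF T])
    then have "?C *v (?T *v ?x) = - y"
      by (simp add: linear_neg[OF matrix_vector_mul_linear] matrix_inv_vector(2)[OF B0])
    then have "lin_at_0 (weight lam ks) ?x - ?x = y" unfolding lin_at_0 by simp
    then show ?thesis by blast
  qed
  obtain R P where P: "0 < R" "flatC R 1 r 0 (\<lambda>_. P)" "P 0 = 0"
    "(P has_derivative (\<lambda>h. \<Sum>k\<in>UNIV. h$k *\<^sub>R v k)) (at 0)"
    "\<And>z. z \<in> ball 0 R \<Longrightarrow> orbit P z \<in> U \<and> residual P z = 0"
    using smooth_solution[OF G0 assms(1) eig nonres] by blast
  \<comment> \<open>The Euclidean norm is at most sqrt m times the sup norm, so the closed cube lies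
    in the ball of radius R / 2.\<close>
  define \<rho> where "\<rho> = R / (2 * sqrt DIM(real^'m))"
  have \<rho>: "\<rho> > 0" using P(1) by (simp add: \<rho>_def)
  have sub: "{z :: real^'m. supnorm z \<le> \<rho>} \<subseteq> ball 0 R"
  proof
    fix z :: "real^'m" assume "z \<in> {z. supnorm z \<le> \<rho>}"
    then have "sqrt DIM(real^'m) * infnorm z \<le> sqrt DIM(real^'m) * \<rho>"
      by (intro mult_left_mono) (auto simp: supnorm_eq_infnorm)
    also have "\<dots> = R / 2" by (simp add: \<rho>_def)
    finally show "z \<in> ball 0 R" using norm_le_infnorm[of z] P(1) by simp
  qed
  have orbit_eq: "orbit P z = (\<chi> k. P (matpow (diagm lam) (inv_into {..N} blk k) *v z))" for z
    unfolding orbit_def sum_block_inj[OF blk] matpow_diagm ..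
  have sol: "orbit P z \<in> U \<and> Z (orbit P z) = 0" if "z \<in> ball 0 R" for z
  proof -
    have x: "orbit P z \<in> U" using P(5)[OF that] by blast
    \<comment> \<open>Block 0 of the orbit is \<open>P z\<close> itself, so a vanishing residual
      reduces to B_0^{-1} Z = 0 on the orbit.\<close>
    have "0 = inv_into {..N} blk (blk 0)" using blk by (simp add: bij_betw_def)
    then have "orbit P z $ blk 0 = P z" by (simp add: orbit_eq flip: \<open>0 = _\<close>)
    then have "?C *v Z (orbit P z) = 0"
      using P(5)[OF that] G_nil[OF x] by (simp add: residual_def)
    then show ?thesis using x matrix_inv_vector(1)[OF B0, of "Z (orbit P z)"] by simp
  qed
  have "(\<lambda>h. \<Sum>k\<in>UNIV. h$k *\<^sub>R v k) = (\<lambda>z. (\<chi> a b. v b $ a) *v z)"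
    by (simp add: fun_eq_iff vec_eq_iff matrix_vector_mult_def mult.commute)
  then have deriv: "(P has_derivative (\<lambda>z. (\<chi> a b. v b $ a) *v z)) (at 0 within {z. supnorm z \<le> \<rho>})"
    using P(4) has_derivative_at_withinI by metis
  show ?thesis
  proof (intro exI[of _ \<rho>] conjI exI[of _ P] ballI)
    show "Ck_on r {z. supnorm z \<le> \<rho>} P" by (rule flatC_imp_Ck_on[OF P(2) sub])
    show "(\<chi> k. P (matpow (diagm lam) (inv_into {..N} blk k) *v z)) \<in> U"
      "Z (\<chi> k. P (matpow (diagm lam) (inv_into {..N} blk k) *v z)) = 0"
      if "z \<in> {z. supnorm z \<le> \<rho>}" for z
      using sol[of z] that sub unfolding orbit_eq by auto
  qed (use \<rho> P(3) deriv in auto)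
qed

end
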